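(* Let $k$ be a field and let $\mathcal L$ be the degenerate affine Hecke category over $k$. Then its deformation cohomology is the exterior algebra of the polynomial algebra $k[x]$ (considered as a vector space placed in degree one): there is an isomorphism of graded algebras $$H^*(\mathcal L)\simeq\Lambda^*(k[x]).$$
   Context: **Degenerate affine Hecke algebra.** $\Lambda_n$ is the unital associative $k$-algebra generated by $t_1,\dots,t_{n-1},y_1,\dots,y_n$ with relations $t_i^2=1$; $t_it_{i+1}t_i=t_{i+1}t_it_{i+1}$; $t_it_j=t_jt_i$ for $|i-j|>1$; $y_it_i-t_iy_{i+1}=1$; $t_iy_j=y_jt_i$ for $j\ne i,i+1$; $y_iy_j=y_jy_i$. ($\Lambda_0=k$.) The assignments $t_i\otimes1\mapsto t_i$, $1\otimes t_j\mapsto t_{j+m}$, $y_i\otimes1\mapsto y_i$, $1\otimes y_j\mapsto y_{j+m}$ define algebra homomorphisms $\Lambda_m\otimes\Lambda_n\to\Lambda_{m+n}$. **The category $\mathcal L$.** Objects $[n]$, $n\ge0$, no nonzero morphisms between different objects, $\mathrm{End}([n])=\Lambda_n$, $[m]\otimes[n]=[m+n]$, tensor product of morphisms given by the homomorphisms above. **Deformation cohomology.** For a strict $k$-linear tensor category $\mathcal C$ with unit $I$ let $E^n(\mathcal C)$ ($n\ge 1$) be the space of families $a=(a_{X_1,\dots,X_n})$, $a_{X_1,\dots,X_n}\in \mathrm{End}_{\mathcal C}(X_1\otimes\dots\otimes X_n)$, natural in $X_1,\dots,X_n\in\mathcal C$ (that is, commuting with $f_1\otimes\dots\otimes f_n$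 for all $f_i:X_i\to Y_i$), and $E^0(\mathcal C)=\mathrm{End}_{\mathcal C}(I)$. The differential is $\partial=\sum_{i=0}^{n+1}(-1)^i\partial_i$, where $\partial_0(a)_{X_1,\dots,X_{n+1}}=1_{X_1}\otimes a_{X_2,\dots,X_{n+1}}$, $\partial_i(a)_{X_1,\dots,X_{n+1}}=a_{X_1,\dots,X_i\otimes X_{i+1},\dots,X_{n+1}}$ for $1\le i\le n$, and $\partial_{n+1}(a)_{X_1,\dots,X_{n+1}}=a_{X_1,\dots,X_n}\otimes 1_{X_{n+1}}$. $H^*(\mathcal C)$ is the cohomology of this complex; the product is induced by $(a\cup b)_{X_1,\dots,X_{m+n}}=a_{X_1,\dots,X_m}\otimes b_{X_{m+1},\dots,X_{m+n}}$. *)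

theory Defs
  imports
    "HOL-Library.Poly_Mapping"
    "HOL-Computational_Algebra.Polynomial"
    "HOL-Algebra.QuotRing"
    "HOL-Algebra.Module"
    "HOL-Algebra.Algebraic_Closure_Type"
begin

no_notation var (\<open>X\<index>\<close>)

section \<open>Associative algebras presented by generators and relations\<close>

text \<open>
  The free monoid on \<open>'g\<close>, written additively, so that the convolution product of finitely
  supported functions makes \<open>'g fmon \<Rightarrow>\<^sub>0 'k\<close> the free associative unital algebra on \<open>'g\<close>.
\<close>

datatype 'g fmon = FMon (letters: "'g list")

instantiation fmon :: (type) monoid_add
begin

definition zero_fmon :: "'a fmon" where
  "0 = FMon []"

definition plus_fmon :: "'a fmon \<Rightarrow> 'a fmon \<Rightarrow> 'a fmon" where
  "u + v = FMon (letters u @ letters v)"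

instance
  by intro_classes (simp_all add: zero_fmon_def plus_fmon_def)

end

type_synonym ('g, 'k) free_alg = "'g fmon \<Rightarrow>\<^sub>0 'k"

definition gen :: "'g \<Rightarrow> ('g, 'k::field) free_alg" where
  "gen g = Poly_Mapping.single (FMon [g]) 1"

definition scal :: "'k::field \<Rightarrow> ('g, 'k) free_alg" where
  "scal c = Poly_Mapping.single 0 c"

definition free_algebra :: "'g set \<Rightarrow> ('g, 'k::field) free_alg ring" where
  "free_algebra G =
    \<lparr>carrier = {p. \<forall>w\<in>Poly_Mapping.keys p. set (letters w) \<subseteq> G},
     monoid.mult = (*), one = 1, zero = 0, add = (+)\<rparr>"

text \<open>\<^const>\<open>genideal\<close> (\<open>Idl\<close>) is the generated two-sided ideal.\<close>

definition rel_ideal :: "'g set \<Rightarrow> ('g, 'k::field) free_alg set \<Rightarrow> ('g, 'k) free_alg set" where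
  "rel_ideal G R = Idl\<^bsub>free_algebra G\<^esub> R"

definition cls :: "'g set \<Rightarrow> ('g, 'k::field) free_alg set \<Rightarrow> ('g, 'k) free_alg
    \<Rightarrow> ('g, 'k) free_alg set" where
  "cls G R p = rel_ideal G R +>\<^bsub>free_algebra G\<^esub> p"

text \<open>The record type \<open>module\<close> is used here as the type of a ring with scalar multiplication.\<close>

definition presented_algebra :: "'g set \<Rightarrow> ('g, 'k::field) free_alg set
    \<Rightarrow> ('k, ('g, 'k) free_alg set) module" where
  "presented_algebra G R =
    ring.extend (free_algebra G Quot rel_ideal G R)
      (module.fields (\<lambda>c A. \<Union>p\<in>A. cls G R (scal c * p)))"


section \<open>Strict linear tensor categories\<close>

text \<open>
  The operations on morphisms are indexed by objects, so the hom-spaces need not be disjoint: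
  \<open>Comp X Y Z g f\<close> is \<open>g \<circ> f\<close> for \<open>f : X \<rightarrow> Y\<close>, \<open>g : Y \<rightarrow> Z\<close>, and \<open>TensMor X Y X' Y' f g\<close> is
  \<open>f \<otimes> g : X \<otimes> X' \<rightarrow> Y \<otimes> Y'\<close> for \<open>f : X \<rightarrow> Y\<close>, \<open>g : X' \<rightarrow> Y'\<close>. Of the records \<open>Hom X Y\<close>
  only the vector space structure is used.
\<close>

record ('k, 'o, 'm) tensor_category =
  Ob :: "'o set"
  Hom :: "'o \<Rightarrow> 'o \<Rightarrow> ('k, 'm) module"
  Comp :: "'o \<Rightarrow> 'o \<Rightarrow> 'o \<Rightarrow> 'm \<Rightarrow> 'm \<Rightarrow> 'm"
  Ident :: "'o \<Rightarrow> 'm"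
  Unit :: "'o"
  Tens :: "'o \<Rightarrow> 'o \<Rightarrow> 'o"
  TensMor :: "'o \<Rightarrow> 'o \<Rightarrow> 'o \<Rightarrow> 'o \<Rightarrow> 'm \<Rightarrow> 'm \<Rightarrow> 'm"

definition mor :: "('k, 'o, 'm) tensor_category \<Rightarrow> 'o \<Rightarrow> 'o \<Rightarrow> 'm set" where
  "mor C X Y = carrier (Hom C X Y)"

definition bilinear_op :: "('k::field, 'a) module \<Rightarrow> ('k, 'b) module \<Rightarrow> ('k, 'c) module
    \<Rightarrow> ('a \<Rightarrow> 'b \<Rightarrow> 'c) \<Rightarrow> bool" where
  "bilinear_op U V W \<beta> \<longleftrightarrow>
    (\<forall>u\<in>carrier U. \<forall>v\<in>carrier V. \<beta> u v \<in> carrier W) \<and>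
    (\<forall>u\<in>carrier U. \<forall>u'\<in>carrier U. \<forall>v\<in>carrier V.
       \<beta> (u \<oplus>\<^bsub>U\<^esub> u') v = \<beta> u v \<oplus>\<^bsub>W\<^esub> \<beta> u' v) \<and>
    (\<forall>u\<in>carrier U. \<forall>v\<in>carrier V. \<forall>v'\<in>carrier V.
       \<beta> u (v \<oplus>\<^bsub>V\<^esub> v') = \<beta> u v \<oplus>\<^bsub>W\<^esub> \<beta> u v') \<and>
    (\<forall>c. \<forall>u\<in>carrier U. \<forall>v\<in>carrier V.
       \<beta> (c \<odot>\<^bsub>U\<^esub> u) v = c \<odot>\<^bsub>W\<^esub> \<beta> u v \<and> \<beta> u (c \<odot>\<^bsub>V\<^esub> v) = c \<odot>\<^bsub>W\<^esub> \<beta> u v)"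

locale strict_linear_tensor_category =
  fixes C :: "('k::field, 'o, 'm) tensor_category"
  assumes hom_module: "\<lbrakk>X \<in> Ob C; Y \<in> Ob C\<rbrakk> \<Longrightarrow>
        Module.module (ring_of_type_algebra :: 'k ring) (Hom C X Y)"
    and ident_closed: "X \<in> Ob C \<Longrightarrow> Ident C X \<in> mor C X X"
    and comp_bilinear: "\<lbrakk>X \<in> Ob C; Y \<in> Ob C; Z \<in> Ob C\<rbrakk> \<Longrightarrow>
        bilinear_op (Hom C Y Z) (Hom C X Y) (Hom C X Z) (Comp C X Y Z)"
    and comp_assoc: "\<lbrakk>W \<in> Ob C; X \<in> Ob C; Y \<in> Ob C; Z \<in> Ob C;
        f \<in> mor C W X; g \<in> mor C X Y; h \<in> mor C Y Z\<rbrakk> \<Longrightarrow>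
        Comp C W X Z (Comp C X Y Z h g) f = Comp C W Y Z h (Comp C W X Y g f)"
    and comp_ident_left: "\<lbrakk>X \<in> Ob C; Y \<in> Ob C; f \<in> mor C X Y\<rbrakk> \<Longrightarrow>
        Comp C X Y Y (Ident C Y) f = f"
    and comp_ident_right: "\<lbrakk>X \<in> Ob C; Y \<in> Ob C; f \<in> mor C X Y\<rbrakk> \<Longrightarrow>
        Comp C X X Y f (Ident C X) = f"
    and unit_closed: "Unit C \<in> Ob C"
    and tens_closed: "\<lbrakk>X \<in> Ob C; Y \<in> Ob C\<rbrakk> \<Longrightarrow> Tens C X Y \<in> Ob C"
    and tens_assoc: "\<lbrakk>X \<in> Ob C; Y \<in> Ob C; Z \<in> Ob C\<rbrakk> \<Longrightarrow>
        Tens C (Tens C X Y) Z = Tens C X (Tens C Y Z)"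
    and tens_unit_left: "X \<in> Ob C \<Longrightarrow> Tens C (Unit C) X = X"
    and tens_unit_right: "X \<in> Ob C \<Longrightarrow> Tens C X (Unit C) = X"
    and tens_bilinear: "\<lbrakk>X \<in> Ob C; Y \<in> Ob C; X' \<in> Ob C; Y' \<in> Ob C\<rbrakk> \<Longrightarrow>
        bilinear_op (Hom C X Y) (Hom C X' Y') (Hom C (Tens C X X') (Tens C Y Y'))
          (TensMor C X Y X' Y')"
    and tens_ident: "\<lbrakk>X \<in> Ob C; Y \<in> Ob C\<rbrakk> \<Longrightarrow>
        TensMor C X X Y Y (Ident C X) (Ident C Y) = Ident C (Tens C X Y)"
    and tens_comp: "\<lbrakk>X \<in> Ob C; Y \<in> Ob C; Z \<in> Ob C; X' \<in> Ob C; Y' \<in> Ob C; Z' \<in> Ob C;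
        f \<in> mor C X Y; g \<in> mor C Y Z; f' \<in> mor C X' Y'; g' \<in> mor C Y' Z'\<rbrakk> \<Longrightarrow>
        TensMor C X Z X' Z' (Comp C X Y Z g f) (Comp C X' Y' Z' g' f') =
        Comp C (Tens C X X') (Tens C Y Y') (Tens C Z Z')
          (TensMor C Y Z Y' Z' g g') (TensMor C X Y X' Y' f f')"
    and tens_mor_assoc: "\<lbrakk>X \<in> Ob C; Y \<in> Ob C; X' \<in> Ob C; Y' \<in> Ob C; X'' \<in> Ob C; Y'' \<in> Ob C;
        f \<in> mor C X Y; g \<in> mor C X' Y'; h \<in> mor C X'' Y''\<rbrakk> \<Longrightarrow>
        TensMor C (Tens C X X') (Tens C Y Y') X'' Y'' (TensMor C X Y X' Y' f g) h =
        TensMor C X Y (Tens C X' X'') (Tens C Y' Y'') f (TensMor C X' Y' X'' Y'' g h)"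
    and tens_mor_unit_left: "\<lbrakk>X \<in> Ob C; Y \<in> Ob C; f \<in> mor C X Y\<rbrakk> \<Longrightarrow>
        TensMor C (Unit C) (Unit C) X Y (Ident C (Unit C)) f = f"
    and tens_mor_unit_right: "\<lbrakk>X \<in> Ob C; Y \<in> Ob C; f \<in> mor C X Y\<rbrakk> \<Longrightarrow>
        TensMor C X Y (Unit C) (Unit C) f (Ident C (Unit C)) = f"

text \<open>\<open>tens_mor_list C Xs Ys fs\<close> is only meant for three lists of the same length.\<close>

definition tens_list :: "('k, 'o, 'm) tensor_category \<Rightarrow> 'o list \<Rightarrow> 'o" where
  "tens_list C Xs = foldr (Tens C) Xs (Unit C)"

fun tens_mor_list :: "('k, 'o, 'm) tensor_category \<Rightarrow> 'o list \<Rightarrow> 'o list \<Rightarrow> 'm list \<Rightarrow> 'm" where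
  "tens_mor_list C (X # Xs) (Y # Ys) (f # fs) =
     TensMor C X Y (tens_list C Xs) (tens_list C Ys) f (tens_mor_list C Xs Ys fs)"
| "tens_mor_list C _ _ _ = Ident C (Unit C)"


section \<open>Graded algebras\<close>

text \<open>
  A graded algebra is given by its homogeneous components, the products
  \<open>A\<^sub>m \<times> A\<^sub>n \<rightarrow> A\<^sub>m\<^sub>+\<^sub>n\<close> and the unit in degree 0. Again the ring multiplication and ring unit fields
  of the records \<open>Piece A n\<close> are irrelevant.
\<close>

record ('k, 'a) graded_algebra =
  Piece :: "nat \<Rightarrow> ('k, 'a) module"
  Gmult :: "nat \<Rightarrow> nat \<Rightarrow> 'a \<Rightarrow> 'a \<Rightarrow> 'a"
  Gone :: "'a"

definition linear_iso :: "('k::field, 'a) module \<Rightarrow> ('k, 'b) module \<Rightarrow> ('a \<Rightarrow> 'b) \<Rightarrow> bool" where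
  "linear_iso V W f \<longleftrightarrow>
    bij_betw f (carrier V) (carrier W) \<and>
    (\<forall>x\<in>carrier V. \<forall>y\<in>carrier V. f (x \<oplus>\<^bsub>V\<^esub> y) = f x \<oplus>\<^bsub>W\<^esub> f y) \<and>
    (\<forall>c. \<forall>x\<in>carrier V. f (c \<odot>\<^bsub>V\<^esub> x) = c \<odot>\<^bsub>W\<^esub> f x)"

definition graded_algebra_iso :: "('k::field, 'a) graded_algebra \<Rightarrow> ('k, 'b) graded_algebra
    \<Rightarrow> (nat \<Rightarrow> 'a \<Rightarrow> 'b) \<Rightarrow> bool" where
  "graded_algebra_iso A B \<phi> \<longleftrightarrow>
    (\<forall>n. linear_iso (Piece A n) (Piece B n) (\<phi> n)) \<and>
    (\<forall>m n. \<forall>x\<in>carrier (Piece A m). \<forall>y\<in>carrier (Piece A n).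
       \<phi> (m + n) (Gmult A m n x y) = Gmult B m n (\<phi> m x) (\<phi> n y)) \<and>
    \<phi> 0 (Gone A) = Gone B"


section \<open>Deformation cohomology\<close>

definition ob_lists :: "('k, 'o, 'm) tensor_category \<Rightarrow> nat \<Rightarrow> 'o list set" where
  "ob_lists C n = {Xs. length Xs = n \<and> set Xs \<subseteq> Ob C}"

definition natural_family :: "('k, 'o, 'm) tensor_category \<Rightarrow> nat \<Rightarrow> ('o list \<Rightarrow> 'm) \<Rightarrow> bool" where
  "natural_family C n a \<longleftrightarrow>
    (\<forall>Xs\<in>ob_lists C n. \<forall>Ys\<in>ob_lists C n. \<forall>fs.
       length fs = n \<and> (\<forall>i<n. fs ! i \<in> mor C (Xs ! i) (Ys ! i)) \<longrightarrow>
       Comp C (tens_list C Xs) (tens_list C Ys) (tens_list C Ys)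
         (a Ys) (tens_mor_list C Xs Ys fs) =
       Comp C (tens_list C Xs) (tens_list C Xs) (tens_list C Ys)
         (tens_mor_list C Xs Ys fs) (a Xs))"

text \<open>
  For \<open>n = 0\<close> the only index is the empty list and naturality is vacuous, so this is the
  endomorphism space of the unit object. Families are normalised to \<open>undefined\<close> outside the index
  set, so that equality of families is equality of functions.
\<close>

definition cochains :: "('k, 'o, 'm) tensor_category \<Rightarrow> nat \<Rightarrow> ('o list \<Rightarrow> 'm) set" where
  "cochains C n =
    {a \<in> (\<Pi>\<^sub>E Xs\<in>ob_lists C n. mor C (tens_list C Xs) (tens_list C Xs)). natural_family C n a}"

definition cochain_space :: "('k, 'o, 'm) tensor_category \<Rightarrow> nat \<Rightarrow> ('k, 'o list \<Rightarrow> 'm) module" where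
  "cochain_space C n =
    \<lparr>carrier = cochains C n, monoid.mult = undefined, one = undefined,
     zero = (\<lambda>Xs\<in>ob_lists C n. \<zero>\<^bsub>Hom C (tens_list C Xs) (tens_list C Xs)\<^esub>),
     add = (\<lambda>a b. \<lambda>Xs\<in>ob_lists C n. a Xs \<oplus>\<^bsub>Hom C (tens_list C Xs) (tens_list C Xs)\<^esub> b Xs),
     module.smult = (\<lambda>c a. \<lambda>Xs\<in>ob_lists C n. c \<odot>\<^bsub>Hom C (tens_list C Xs) (tens_list C Xs)\<^esub> a Xs)\<rparr>"

text \<open>\<open>coface C n i a Xs\<close> is the value of \<open>\<partial>\<^sub>i a\<close> at the \<open>(n+1)\<close>-tuple \<open>Xs\<close>, for \<open>i \<le> n + 1\<close>.\<close>

definition coface :: "('k, 'o, 'm) tensor_category \<Rightarrow> nat \<Rightarrow> nat \<Rightarrow> ('o list \<Rightarrow> 'm) \<Rightarrow> 'o list \<Rightarrow> 'm" where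
  "coface C n i a Xs =
    (if i = 0 then
       TensMor C (hd Xs) (hd Xs) (tens_list C (tl Xs)) (tens_list C (tl Xs))
         (Ident C (hd Xs)) (a (tl Xs))
     else if i \<le> n then
       a (take (i - 1) Xs @ [Tens C (Xs ! (i - 1)) (Xs ! i)] @ drop (i + 1) Xs)
     else
       TensMor C (tens_list C (butlast Xs)) (tens_list C (butlast Xs)) (last Xs) (last Xs)
         (a (butlast Xs)) (Ident C (last Xs)))"

definition differential :: "('k::field, 'o, 'm) tensor_category \<Rightarrow> nat \<Rightarrow> ('o list \<Rightarrow> 'm) \<Rightarrow> 'o list \<Rightarrow> 'm" where
  "differential C n a = (\<lambda>Xs\<in>ob_lists C (n + 1).
     \<Oplus>\<^bsub>Hom C (tens_list C Xs) (tens_list C Xs)\<^esub>i\<in>{..n + 1}.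
       (- 1) ^ i \<odot>\<^bsub>Hom C (tens_list C Xs) (tens_list C Xs)\<^esub> coface C n i a Xs)"

definition cocycles :: "('k::field, 'o, 'm) tensor_category \<Rightarrow> nat \<Rightarrow> ('o list \<Rightarrow> 'm) set" where
  "cocycles C n = {a \<in> cochains C n. differential C n a = \<zero>\<^bsub>cochain_space C (n + 1)\<^esub>}"

definition coboundaries :: "('k::field, 'o, 'm) tensor_category \<Rightarrow> nat \<Rightarrow> ('o list \<Rightarrow> 'm) set" where
  "coboundaries C n =
    (case n of 0 \<Rightarrow> {\<zero>\<^bsub>cochain_space C 0\<^esub>} | Suc m \<Rightarrow> differential C m ` cochains C m)"

definition cohom_class :: "('k::field, 'o, 'm) tensor_category \<Rightarrow> nat \<Rightarrow> ('o list \<Rightarrow> 'm)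
    \<Rightarrow> ('o list \<Rightarrow> 'm) set" where
  "cohom_class C n a = coboundaries C n +>\<^bsub>cochain_space C n\<^esub> a"

definition cohomology_space :: "('k::field, 'o, 'm) tensor_category \<Rightarrow> nat
    \<Rightarrow> ('k, ('o list \<Rightarrow> 'm) set) module" where
  "cohomology_space C n =
    \<lparr>carrier = cohom_class C n ` cocycles C n, monoid.mult = undefined, one = undefined,
     zero = coboundaries C n,
     add = set_add (cochain_space C n),
     module.smult = (\<lambda>c A. \<Union>a\<in>A. cohom_class C n (c \<odot>\<^bsub>cochain_space C n\<^esub> a))\<rparr>"

definition cup :: "('k, 'o, 'm) tensor_category \<Rightarrow> nat \<Rightarrow> nat \<Rightarrow> ('o list \<Rightarrow> 'm) \<Rightarrow> ('o list \<Rightarrow> 'm)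
    \<Rightarrow> 'o list \<Rightarrow> 'm" where
  "cup C m n a b = (\<lambda>Xs\<in>ob_lists C (m + n).
     TensMor C (tens_list C (take m Xs)) (tens_list C (take m Xs))
       (tens_list C (drop m Xs)) (tens_list C (drop m Xs)) (a (take m Xs)) (b (drop m Xs)))"

definition deformation_cohomology :: "('k::field, 'o, 'm) tensor_category
    \<Rightarrow> ('k, ('o list \<Rightarrow> 'm) set) graded_algebra" where
  "deformation_cohomology C =
    \<lparr>Piece = cohomology_space C,
     Gmult = (\<lambda>m n A B. \<Union>a\<in>A. \<Union>b\<in>B. cohom_class C (m + n) (cup C m n a b)),
     Gone = cohom_class C 0 (\<lambda>Xs\<in>ob_lists C 0. Ident C (Unit C))\<rparr>"


section \<open>The degenerate affine Hecke category\<close>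

datatype hecke_gen = T nat | Y nat

definition hecke_gens :: "nat \<Rightarrow> hecke_gen set" where
  "hecke_gens n = {T i | i. 1 \<le> i \<and> i < n} \<union> {Y j | j. 1 \<le> j \<and> j \<le> n}"

abbreviation tt :: "nat \<Rightarrow> (hecke_gen, 'k::field) free_alg" where
  "tt i \<equiv> gen (T i)"

abbreviation yy :: "nat \<Rightarrow> (hecke_gen, 'k::field) free_alg" where
  "yy j \<equiv> gen (Y j)"

definition hecke_rels :: "nat \<Rightarrow> (hecke_gen, 'k::field) free_alg set" where
  "hecke_rels n =
     {tt i * tt i - 1 | i. 1 \<le> i \<and> i < n}
   \<union> {tt i * tt (i + 1) * tt i - tt (i + 1) * tt i * tt (i + 1) | i. 1 \<le> i \<and> i + 1 < n}
   \<union> {tt i * tt j - tt j * tt i | i j.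
        1 \<le> i \<and> i < n \<and> 1 \<le> j \<and> j < n \<and> \<bar>int i - int j\<bar> > 1}
   \<union> {yy i * tt i - tt i * yy (i + 1) - 1 | i. 1 \<le> i \<and> i < n}
   \<union> {tt i * yy j - yy j * tt i | i j.
        1 \<le> i \<and> i < n \<and> 1 \<le> j \<and> j \<le> n \<and> j \<noteq> i \<and> j \<noteq> i + 1}
   \<union> {yy i * yy j - yy j * yy i | i j. 1 \<le> i \<and> i \<le> n \<and> 1 \<le> j \<and> j \<le> n}"

definition hecke_algebra :: "nat \<Rightarrow> ('k::field, (hecke_gen, 'k) free_alg set) module" where
  "hecke_algebra n = presented_algebra (hecke_gens n) (hecke_rels n)"

fun shift_gen :: "nat \<Rightarrow> hecke_gen \<Rightarrow> hecke_gen" where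
  "shift_gen m (T i) = T (i + m)"
| "shift_gen m (Y j) = Y (j + m)"

text \<open>The homomorphism of free algebras induced by a map of generators.\<close>

definition free_map :: "('g \<Rightarrow> 'h) \<Rightarrow> ('g, 'k::field) free_alg \<Rightarrow> ('h, 'k) free_alg" where
  "free_map f p = (\<Sum>w\<in>Poly_Mapping.keys p.
     Poly_Mapping.single (map_fmon f w) (Poly_Mapping.lookup p w))"

text \<open>
  The homomorphism \<open>\<Lambda>\<^sub>m \<otimes> \<Lambda>\<^sub>n \<rightarrow> \<Lambda>\<^sub>m\<^sub>+\<^sub>n\<close>, as the bilinear map sending the classes of \<open>p\<close>, \<open>q\<close> to
  the class of \<open>p\<close> times the shift of \<open>q\<close>, in the style of \<^const>\<open>rcoset_mult\<close>.
\<close>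

definition hecke_tensor :: "nat \<Rightarrow> nat \<Rightarrow> (hecke_gen, 'k::field) free_alg set
    \<Rightarrow> (hecke_gen, 'k) free_alg set \<Rightarrow> (hecke_gen, 'k) free_alg set" where
  "hecke_tensor m n A B = (\<Union>p\<in>A. \<Union>q\<in>B.
     cls (hecke_gens (m + n)) (hecke_rels (m + n)) (p * free_map (shift_gen m) q))"

text \<open>The hom-space between distinct objects is the algebra without generators in which \<open>1 = 0\<close>.\<close>

definition hecke_hom :: "nat \<Rightarrow> nat \<Rightarrow> ('k::field, (hecke_gen, 'k) free_alg set) module" where
  "hecke_hom m n = (if m = n then hecke_algebra n else presented_algebra {} {1})"

definition hecke_category :: "('k::field, nat, (hecke_gen, 'k) free_alg set) tensor_category" where
  "hecke_category =
    \<lparr>Ob = UNIV,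
     Hom = hecke_hom,
     Comp = (\<lambda>l m n g f. if l = m \<and> m = n then g \<otimes>\<^bsub>hecke_algebra n\<^esub> f else \<zero>\<^bsub>hecke_hom l n\<^esub>),
     Ident = (\<lambda>n. \<one>\<^bsub>hecke_algebra n\<^esub>),
     Unit = 0,
     Tens = (+),
     TensMor = (\<lambda>m m' n n' f g.
       if m = m' \<and> n = n' then hecke_tensor m n f g else \<zero>\<^bsub>hecke_hom (m + n) (m' + n')\<^esub>)\<rparr>"


section \<open>The exterior algebra of a vector space\<close>

text \<open>
  The tensor algebra of \<open>V\<close> is the free algebra on symbols \<open>gen v\<close> modulo linearity of \<open>gen\<close>; the
  exterior algebra is its quotient by the squares of the elements of \<open>V\<close>. The piece of degree \<open>n\<close>
  consists of the classes of combinations of words of length \<open>n\<close>, so \<open>V\<close> is in degree one.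
\<close>

definition exterior_rels :: "('k::field, 'v) module \<Rightarrow> ('v, 'k) free_alg set" where
  "exterior_rels V =
     {gen (v \<oplus>\<^bsub>V\<^esub> w) - gen v - gen w | v w. v \<in> carrier V \<and> w \<in> carrier V}
   \<union> {gen (c \<odot>\<^bsub>V\<^esub> v) - scal c * gen v | c v. v \<in> carrier V}
   \<union> {gen v * gen v | v. v \<in> carrier V}"

definition exterior_power :: "('k::field, 'v) module \<Rightarrow> nat \<Rightarrow> ('v, 'k) free_alg set set" where
  "exterior_power V n =
    {cls (carrier V) (exterior_rels V) p | p.
       p \<in> carrier (free_algebra (carrier V)) \<and>
       (\<forall>w\<in>Poly_Mapping.keys p. length (letters w) = n)}"

definition exterior_algebra :: "('k::field, 'v) module \<Rightarrow> ('k, ('v, 'k) free_alg set) graded_algebra" where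
  "exterior_algebra V =
    (let E = presented_algebra (carrier V) (exterior_rels V) in
     \<lparr>Piece = (\<lambda>n. E\<lparr>carrier := exterior_power V n\<rparr>),
      Gmult = (\<lambda>m n. monoid.mult E),
      Gone = \<one>\<^bsub>E\<^esub>\<rparr>)"

definition polynomial_space :: "('k::field, 'k poly) module" where
  "polynomial_space = ring.extend ring_of_type_algebra (module.fields Polynomial.smult)"


section \<open>The degenerate affine Hecke category is a strict linear tensor category\<close>


lemma letters_zero [simp]: "letters 0 = []" by (simp add: zero_fmon_def)
lemma letters_plus [simp]: "letters (u + v) = letters u @ letters v" by (simp add: plus_fmon_def)

lemma scal_1 [simp]: "scal 1 = 1" by (simp add: scal_def)
lemma scal_0 [simp]: "scal 0 = 0" by (simp add: scal_def)
lemma scal_add: "scal (a + b) = scal a + scal b" by (simp add: scal_def single_add)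
lemma scal_mult: "scal (a * b) = scal a * scal b" by (simp add: scal_def mult_single)

lemma single_times_scal: "Poly_Mapping.single w a * scal b = Poly_Mapping.single w (a * b)"
  by (simp add: scal_def mult_single)

lemma poly_mapping_expand:
  fixes p :: "'a \<Rightarrow>\<^sub>0 'b::comm_monoid_add"
  shows "p = (\<Sum>w\<in>Poly_Mapping.keys p. Poly_Mapping.single w (Poly_Mapping.lookup p w))"
proof (rule poly_mapping_eqI)
  fix k
  show "Poly_Mapping.lookup p k = Poly_Mapping.lookup
      (\<Sum>w\<in>Poly_Mapping.keys p. Poly_Mapping.single w (Poly_Mapping.lookup p w)) k"
    by (cases "k \<in> Poly_Mapping.keys p")
      (auto simp: lookup_sum lookup_single when_def sum.delta in_keys_iff)
qed

lemma scal_comm: "scal c * p = p * scal c"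
proof -
  have "scal c * (\<Sum>w\<in>A. Poly_Mapping.single w (f w)) = (\<Sum>w\<in>A. Poly_Mapping.single w (f w)) * scal c" for A and f :: "'a fmon \<Rightarrow> 'b"
    by (simp add: sum_distrib_left sum_distrib_right scal_def mult_single mult.commute)
  from this[where A = "Poly_Mapping.keys p" and f = "Poly_Mapping.lookup p"]
  show ?thesis by (simp flip: poly_mapping_expand)
qed

lemma free_algebra_simps [simp]:
  "monoid.mult (free_algebra G) = (*)" "one (free_algebra G) = 1"
  "ring.zero (free_algebra G) = 0" "add (free_algebra G) = (+)"
  by (simp_all add: free_algebra_def)

lemma free_carrier:
  "p \<in> carrier (free_algebra G) \<longleftrightarrow> (\<forall>w\<in>Poly_Mapping.keys p. set (letters w) \<subseteq> G)"
  by (simp add: free_algebra_def)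

lemma free_add [intro]: "p \<in> carrier (free_algebra G) \<Longrightarrow> q \<in> carrier (free_algebra G) \<Longrightarrow> p + q \<in> carrier (free_algebra G)"
  using Poly_Mapping.keys_add[of p q] unfolding free_carrier by blast
lemma free_uminus [intro]: "p \<in> carrier (free_algebra G) \<Longrightarrow> - p \<in> carrier (free_algebra G)"
  unfolding free_carrier by simp
lemma free_diff [intro]: "p \<in> carrier (free_algebra G) \<Longrightarrow> q \<in> carrier (free_algebra G) \<Longrightarrow> p - q \<in> carrier (free_algebra G)"
  using free_add[of p G "- q"] by auto
lemma free_mult [intro]: "p \<in> carrier (free_algebra G) \<Longrightarrow> q \<in> carrier (free_algebra G) \<Longrightarrow> p * q \<in> carrier (free_algebra G)"
proof -
  assume "p \<in> carrier (free_algebra G)" "q \<in> carrier (free_algebra G)"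
  then show ?thesis
    using Poly_Mapping.keys_mult[of p q] unfolding free_carrier by fastforce
qed
lemma free_scal [intro, simp]: "scal c \<in> carrier (free_algebra G)"
  by (auto simp: free_carrier scal_def)
lemma free_0 [intro, simp]: "0 \<in> carrier (free_algebra G)" by (auto simp: free_carrier)
lemma free_1 [intro, simp]: "1 \<in> carrier (free_algebra G)"
  using free_scal[of 1 G] by (simp del: free_scal)
lemma free_gen [intro]: "g \<in> G \<Longrightarrow> gen g \<in> carrier (free_algebra G)"
  by (auto simp: free_carrier gen_def)
lemma free_sum [intro]: "(\<And>i. i \<in> A \<Longrightarrow> f i \<in> carrier (free_algebra G)) \<Longrightarrow> sum f A \<in> carrier (free_algebra G)"
  by (induction A rule: infinite_finite_induct) auto

lemma ring_free: "ring (free_algebra G :: ('g, 'k::field) free_alg ring)"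
proof (rule ringI)
  show "abelian_group (free_algebra G :: ('g, 'k) free_alg ring)"
  proof (rule abelian_groupI)
    fix p :: "('g, 'k) free_alg"
    assume "p \<in> carrier (free_algebra G)"
    then show "\<exists>y\<in>carrier (free_algebra G). y \<oplus>\<^bsub>free_algebra G\<^esub> p = \<zero>\<^bsub>free_algebra G\<^esub>"
      by (intro bexI[of _ "- p"]) auto
  qed (auto simp: algebra_simps)
  show "Group.monoid (free_algebra G :: ('g, 'k) free_alg ring)"
    by (rule monoidI) (auto simp: algebra_simps)
qed (auto simp: algebra_simps)

lemma free_single:
  "set l \<subseteq> G \<Longrightarrow> Poly_Mapping.single (FMon l) c \<in> carrier (free_algebra G)"
  by (auto simp: free_carrier)

lemma single_Cons: "Poly_Mapping.single (FMon (g # l)) c = gen g * Poly_Mapping.single (FMon l) c"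
  by (simp add: gen_def mult_single plus_fmon_def)

lemma free_induct [consumes 1, case_names scal gen add mult]:
  assumes p: "p \<in> carrier (free_algebra G)"
    and s: "\<And>c. P (scal c)" and g: "\<And>g. g \<in> G \<Longrightarrow> P (gen g)"
    and a: "\<And>p q. \<lbrakk>p \<in> carrier (free_algebra G); q \<in> carrier (free_algebra G); P p; P q\<rbrakk> \<Longrightarrow> P (p + q)"
    and m: "\<And>p q. \<lbrakk>p \<in> carrier (free_algebra G); q \<in> carrier (free_algebra G); P p; P q\<rbrakk> \<Longrightarrow> P (p * q)"
  shows "P p"
proof -
  have single: "P (Poly_Mapping.single (FMon l) c)" if "set l \<subseteq> G" for l c
    using that
  proof (induction l)
    case Nil
    then show ?case using s[of c] by (simp add: scal_def zero_fmon_def)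
  next
    case (Cons x l)
    then show ?case unfolding single_Cons by (intro m g free_gen free_single) auto
  qed
  have single': "P (Poly_Mapping.single w c)" if "set (letters w) \<subseteq> G" for w c
    using single[OF that] by simp
  have "P (\<Sum>w\<in>A. Poly_Mapping.single w (Poly_Mapping.lookup p w))
     \<and> (\<Sum>w\<in>A. Poly_Mapping.single w (Poly_Mapping.lookup p w)) \<in> carrier (free_algebra G)"
    if "finite A" "A \<subseteq> Poly_Mapping.keys p" for A
    using that
  proof (induction A)
    case empty
    then show ?case using s[of 0] by simp
  next
    case (insert w A)
    have w: "set (letters w) \<subseteq> G" using insert p by (auto simp: free_carrier)
    then show ?case using insert free_single[OF w] by (auto intro!: a single')
  qed
  from this[of "Poly_Mapping.keys p"] show ?thesis by (simp flip: poly_mapping_expand)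
qed

lemma ideal_rel: "R \<subseteq> carrier (free_algebra G) \<Longrightarrow> ideal (rel_ideal G R) (free_algebra G)"
  unfolding rel_ideal_def by (rule ring.genideal_ideal[OF ring_free])

context
  fixes G :: "'g set" and R :: "('g, 'k::field) free_alg set"
  assumes R: "R \<subseteq> carrier (free_algebra G)"
begin

interpretation I: ideal "rel_ideal G R" "free_algebra G"
  by (rule ideal_rel[OF R])

lemma cls_eq_iff: "p \<in> carrier (free_algebra G) \<Longrightarrow> q \<in> carrier (free_algebra G) \<Longrightarrow>
  cls G R p = cls G R q \<longleftrightarrow> p - q \<in> rel_ideal G R"
proof -
  assume pq: "p \<in> carrier (free_algebra G)" "q \<in> carrier (free_algebra G)"
  have "a_minus (free_algebra G) p q = p - q"
  proof -
    have "a_inv (free_algebra G) q = - q"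
      using pq by (intro I.minus_equality) auto
    then show ?thesis by (simp add: a_minus_def)
  qed
  then show ?thesis
    using I.quotient_eq_iff_same_a_r_cos[OF I.ideal_axioms pq] by (simp add: cls_def)
qed

lemma cls_self: "p \<in> carrier (free_algebra G) \<Longrightarrow> p \<in> cls G R p"
  unfolding cls_def by (rule I.a_rcos_self)

lemma cls_memD: "p \<in> carrier (free_algebra G) \<Longrightarrow> q \<in> cls G R p \<Longrightarrow> q \<in> carrier (free_algebra G) \<and> cls G R q = cls G R p"
  unfolding cls_def
  using I.a_repr_independence[OF _ _ I.a_subgroup] I.a_elemrcos_carrier by metis

lemma pa_carrier: "carrier (presented_algebra G R) = cls G R ` carrier (free_algebra G)"
  by (auto simp: presented_algebra_def ring.extend_def module.fields_def FactRing_def A_RCOSETS_def' cls_def)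
lemma pa_mult: "p \<in> carrier (free_algebra G) \<Longrightarrow> q \<in> carrier (free_algebra G) \<Longrightarrow>
  cls G R p \<otimes>\<^bsub>presented_algebra G R\<^esub> cls G R q = cls G R (p * q)"
  using I.rcoset_mult_add[of p q]
  by (simp add: presented_algebra_def ring.extend_def module.fields_def FactRing_simps cls_def)
lemma pa_add: "p \<in> carrier (free_algebra G) \<Longrightarrow> q \<in> carrier (free_algebra G) \<Longrightarrow>
  cls G R p \<oplus>\<^bsub>presented_algebra G R\<^esub> cls G R q = cls G R (p + q)"
  using I.a_rcos_sum[of p q]
  by (simp add: presented_algebra_def ring.extend_def module.fields_def FactRing_simps cls_def)
lemma pa_one: "\<one>\<^bsub>presented_algebra G R\<^esub> = cls G R 1"
  by (simp add: presented_algebra_def ring.extend_def module.fields_def FactRing_simps cls_def)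
lemma pa_zero: "\<zero>\<^bsub>presented_algebra G R\<^esub> = cls G R 0"
  using I.a_coset_add_zero[OF I.a_subset]
  by (simp add: presented_algebra_def ring.extend_def module.fields_def FactRing_simps cls_def)
lemma union_cls:
  assumes "p \<in> carrier (free_algebra G)" "\<And>q. q \<in> cls G R p \<Longrightarrow> f q = A"
  shows "(\<Union>q\<in>cls G R p. f q) = A"
  using assms cls_self[OF assms(1)] by auto

lemma ideal_mult: "x \<in> rel_ideal G R \<Longrightarrow> p \<in> carrier (free_algebra G) \<Longrightarrow> p * x \<in> rel_ideal G R \<and> x * p \<in> rel_ideal G R"
  using I.I_l_closed[of x p] I.I_r_closed[of x p] by simp
lemma ideal_add: "x \<in> rel_ideal G R \<Longrightarrow> y \<in> rel_ideal G R \<Longrightarrow> x + y \<in> rel_ideal G R"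
  using additive_subgroup.a_closed[OF I.additive_subgroup_axioms, of x y] by simp
lemma ideal_0: "0 \<in> rel_ideal G R"
  using additive_subgroup.zero_closed[OF I.additive_subgroup_axioms] by simp
lemma ideal_rels: "R \<subseteq> rel_ideal G R"
  unfolding rel_ideal_def by (rule ring.genideal_self[OF ring_free R])

lemma pa_smult: "p \<in> carrier (free_algebra G) \<Longrightarrow>
  c \<odot>\<^bsub>presented_algebra G R\<^esub> cls G R p = cls G R (scal c * p)"
  unfolding presented_algebra_def ring.extend_def module.fields_def
  apply simp
  apply (rule union_cls, assumption)
  subgoal for q
    using cls_memD[of p q] ideal_mult[of "q - p" "scal c"]
    by (auto simp: cls_eq_iff algebra_simps free_mult)
  done

lemma pa_module: "Module.module (ring_of_type_algebra :: 'k ring) (presented_algebra G R)"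
proof (rule moduleI)
  show "cring (ring_of_type_algebra :: 'k ring)" by (rule cring_from_type_algebra)
  show "abelian_group (presented_algebra G R)"
  proof (rule abelian_groupI)
    fix x assume "x \<in> carrier (presented_algebra G R)"
    then obtain p where "x = cls G R p" "p \<in> carrier (free_algebra G)" by (auto simp: pa_carrier)
    then show "\<exists>y\<in>carrier (presented_algebra G R).
        y \<oplus>\<^bsub>presented_algebra G R\<^esub> x = \<zero>\<^bsub>presented_algebra G R\<^esub>"
      by (intro bexI[of _ "cls G R (- p)"]) (auto simp: pa_carrier pa_add pa_zero free_uminus)
  qed (auto simp: pa_carrier pa_add pa_zero free_add algebra_simps)
qed (auto simp: pa_carrier pa_add pa_smult free_mult free_add algebra_simps
       ring_of_type_algebra_def scal_add scal_mult)

end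

lemma free_map_superset:
  assumes "finite S" "Poly_Mapping.keys p \<subseteq> S"
  shows "free_map f p = (\<Sum>w\<in>S. Poly_Mapping.single (map_fmon f w) (Poly_Mapping.lookup p w))"
  unfolding free_map_def using assms by (intro sum.mono_neutral_left) (auto simp: in_keys_iff)

lemma free_map_add: "free_map f (p + q) = free_map f p + free_map f q"
proof -
  let ?S = "Poly_Mapping.keys p \<union> Poly_Mapping.keys q"
  show ?thesis
    using free_map_superset[of ?S p f] free_map_superset[of ?S q f]
      free_map_superset[of ?S "p + q" f] Poly_Mapping.keys_add[of p q]
    by (simp add: lookup_add single_add sum.distrib)
qed

lemma free_map_0 [simp]: "free_map f 0 = 0" by (simp add: free_map_def)
lemma free_map_single [simp]: "free_map f (Poly_Mapping.single w c) = Poly_Mapping.single (map_fmon f w) c"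
  by (simp add: free_map_def)
lemma free_map_sum: "free_map f (sum h A) = (\<Sum>x\<in>A. free_map f (h x))"
  by (induction A rule: infinite_finite_induct) (simp_all add: free_map_add)
lemma map_fmon_plus: "map_fmon f (u + v) = map_fmon f u + map_fmon f v"
  by (cases u; cases v) (simp add: plus_fmon_def)
lemma map_fmon_0 [simp]: "map_fmon f 0 = 0" by (simp add: zero_fmon_def)
lemma free_map_mult: "free_map f (p * q) = free_map f p * free_map f q"
proof -
  have "free_map f ((\<Sum>w\<in>A. Poly_Mapping.single w (h w)) * (\<Sum>w\<in>B. Poly_Mapping.single w (k w)))
    = free_map f (\<Sum>w\<in>A. Poly_Mapping.single w (h w)) * free_map f (\<Sum>w\<in>B. Poly_Mapping.single w (k w))"
    for A B h k
    by (simp add: sum_product free_map_sum mult_single map_fmon_plus)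
  from this[of "Poly_Mapping.lookup p" "Poly_Mapping.keys p" "Poly_Mapping.lookup q" "Poly_Mapping.keys q"]
  show ?thesis by (simp flip: poly_mapping_expand)
qed
lemma free_map_scal [simp]: "free_map f (scal c) = scal c" by (simp add: scal_def)
lemma free_map_1 [simp]: "free_map f 1 = 1" using free_map_scal[of f 1] by (simp del: free_map_scal)
lemma free_map_gen [simp]: "free_map f (gen g) = gen (f g)" by (simp add: gen_def)
lemma free_map_diff: "free_map f (p - q) = free_map f p - free_map f q"
  using free_map_add[of f "p - q" q] by simp
lemma free_map_closed:
  "p \<in> carrier (free_algebra G) \<Longrightarrow> f ` G \<subseteq> G' \<Longrightarrow> free_map f p \<in> carrier (free_algebra G')"
  by (induction rule: free_induct) (auto simp: free_map_add free_map_mult)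
lemma free_map_comp: "free_map f (free_map g p) = free_map (f \<circ> g) p"
proof -
  have "p \<in> carrier (free_algebra UNIV)" by (simp add: free_carrier)
  then show ?thesis
    by (induction rule: free_induct) (auto simp: free_map_add free_map_mult)
qed
lemma free_map_id: "free_map id p = p"
proof -
  have "p \<in> carrier (free_algebra UNIV)" by (simp add: free_carrier)
  then show ?thesis
    by (induction rule: free_induct) (auto simp: free_map_add free_map_mult)
qed

lemma free_map_ideal:
  fixes f :: "'g \<Rightarrow> 'h" and R :: "('g, 'k::field) free_alg set" and R' :: "('h, 'k) free_alg set"
  assumes R: "R \<subseteq> carrier (free_algebra G)" and R': "R' \<subseteq> carrier (free_algebra G')"
    and f: "f ` G \<subseteq> G'" and fR: "free_map f ` R \<subseteq> rel_ideal G' R'" and p: "p \<in> rel_ideal G R"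
  shows "free_map f p \<in> rel_ideal G' R'"
proof -
  interpret I': ideal "rel_ideal G' R'" "free_algebra G'" by (rule ideal_rel[OF R'])
  let ?J = "{p \<in> carrier (free_algebra G). free_map f p \<in> rel_ideal G' R'}"
  have inv: "a_inv (free_algebra G) x = - x" if "x \<in> carrier (free_algebra G)" for x :: "('g,'k) free_alg"
    using that by (intro abelian_group.minus_equality[OF ring.is_abelian_group[OF ring_free]]) auto
  have "ideal ?J (free_algebra G)"
  proof (rule idealI[OF ring_free])
    show "subgroup ?J (add_monoid (free_algebra G))"
    proof (rule group.subgroupI)
      show "group (add_monoid (free_algebra G :: ('g,'k) free_alg ring))"
        using abelian_group.a_group[OF ring.is_abelian_group[OF ring_free]] .
      show "?J \<noteq> {}" using ideal_0[OF R'] by (auto intro!: exI[of _ 0])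
    next
      fix a assume a: "a \<in> ?J"
      have "inv\<^bsub>add_monoid (free_algebra G)\<^esub> a = - a"
        using a inv[of a] by (simp add: a_inv_def)
      moreover have "free_map f (- a) = scal (-1) * free_map f a"
        using free_map_diff[of f 0 a] by (simp add: scal_def single_uminus[of 0 1])
      ultimately show "inv\<^bsub>add_monoid (free_algebra G)\<^esub> a \<in> ?J"
        using a ideal_mult[OF R', of "free_map f a" "scal (-1)"] by auto
    qed (auto simp: free_map_add free_add ideal_add[OF R'])
  next
    fix a x :: "('g, 'k) free_alg" assume "a \<in> ?J" "x \<in> carrier (free_algebra G)"
    then show "x \<otimes>\<^bsub>free_algebra G\<^esub> a \<in> ?J" "a \<otimes>\<^bsub>free_algebra G\<^esub> x \<in> ?J"
      using ideal_mult[OF R', of "free_map f a" "free_map f x"] free_map_closed[OF _ f, of x]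
      by (auto simp: free_map_mult)
  qed
  moreover have "R \<subseteq> ?J" using R fR by auto
  ultimately have "rel_ideal G R \<subseteq> ?J"
    unfolding rel_ideal_def by (intro ring.genideal_minimal[OF ring_free]) auto
  then show ?thesis using p by auto
qed

lemma commute_ideal:
  assumes R: "R \<subseteq> carrier (free_algebra G)" and A: "A \<subseteq> G" and B: "B \<subseteq> G"
    and AB: "\<And>a b. a \<in> A \<Longrightarrow> b \<in> B \<Longrightarrow> gen a * gen b - gen b * gen a \<in> rel_ideal G R"
    and p: "p \<in> carrier (free_algebra A)" and q: "q \<in> carrier (free_algebra B)"
  shows "p * q - q * p \<in> rel_ideal G R"
proof -
  have sub: "x \<in> carrier (free_algebra G)" if "x \<in> carrier (free_algebra S)" "S \<subseteq> G" for x S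
    using that by (fastforce simp: free_carrier)
  have general: "x * y - y * x \<in> rel_ideal G R"
    if y: "y \<in> carrier (free_algebra S)" and S: "S \<subseteq> G" and x: "x \<in> carrier (free_algebra G)"
    and g: "\<And>b. b \<in> S \<Longrightarrow> x * gen b - gen b * x \<in> rel_ideal G R" for x y S
    using y
  proof (induction rule: free_induct)
    case (scal c)
    then show ?case using ideal_0[OF R] by (simp add: scal_comm)
  next
    case (gen b) then show ?case by (rule g)
  next
    case (add y z)
    then have "(x * y - y * x) + (x * z - z * x) \<in> rel_ideal G R" by (intro ideal_add[OF R])
    then show ?case by (simp add: algebra_simps)
  next
    case (mult y z)
    then have "(x * y - y * x) * z + y * (x * z - z * x) \<in> rel_ideal G R"
      using sub[OF _ S] by (intro ideal_add[OF R] ideal_mult[OF R, THEN conjunct1] ideal_mult[OF R, THEN conjunct2]) auto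
    then show ?case by (simp add: algebra_simps)
  qed
  have swap: "x * y - y * x \<in> rel_ideal G R" if "y * x - x * y \<in> rel_ideal G R" for x y
  proof -
    have "scal (-1) * (y * x - x * y) \<in> rel_ideal G R"
      using ideal_mult[OF R that] by auto
    then show ?thesis by (simp add: scal_def single_uminus[of 0 1])
  qed
  show ?thesis
  proof (rule general[OF q B sub[OF p A]])
    fix b assume b: "b \<in> B"
    show "p * gen b - gen b * p \<in> rel_ideal G R"
      by (rule swap, rule general[OF p A]) (use b B in \<open>auto intro: swap[OF AB]\<close>)
  qed
qed


abbreviation HF :: "nat \<Rightarrow> (hecke_gen, 'k::field) free_alg set" where
  "HF n \<equiv> carrier (free_algebra (hecke_gens n))"
abbreviation HI :: "nat \<Rightarrow> (hecke_gen, 'k::field) free_alg set" where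
  "HI n \<equiv> rel_ideal (hecke_gens n) (hecke_rels n)"
abbreviation HC :: "nat \<Rightarrow> (hecke_gen, 'k::field) free_alg \<Rightarrow> (hecke_gen, 'k) free_alg set" where
  "HC n \<equiv> cls (hecke_gens n) (hecke_rels n)"

lemma hecke_gens_T [simp]: "T i \<in> hecke_gens n \<longleftrightarrow> 1 \<le> i \<and> i < n" by (auto simp: hecke_gens_def)
lemma hecke_gens_Y [simp]: "Y i \<in> hecke_gens n \<longleftrightarrow> 1 \<le> i \<and> i \<le> n" by (auto simp: hecke_gens_def)

lemma hecke_rels_carrier: "hecke_rels n \<subseteq> (HF n :: (hecke_gen, 'k::field) free_alg set)"
  unfolding hecke_rels_def by (auto intro!: free_diff free_mult free_gen)

lemma hecke_gens_mono: "hecke_gens m \<subseteq> hecke_gens (m + n)"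
  by (auto simp: hecke_gens_def)
lemma hecke_rels_mono: "hecke_rels m \<subseteq> hecke_rels (m + n)"
proof -
  have "i < m \<Longrightarrow> i < m + n" "i \<le> m \<Longrightarrow> i \<le> m + n" for i by auto
  then show ?thesis unfolding hecke_rels_def by (intro Un_mono) blast+
qed
lemma hecke_gens_shift: "shift_gen m ` hecke_gens n \<subseteq> hecke_gens (m + n)"
  by (auto simp: hecke_gens_def)

lemma hecke_rels_shift: "free_map (shift_gen m) ` hecke_rels n \<subseteq> (hecke_rels (m + n) :: (hecke_gen, 'k::field) free_alg set)"
proof -
  have 1: "free_map (shift_gen m) ` {tt i * tt i - 1 | i. 1 \<le> i \<and> i < n} \<subseteq>
     ({tt i * tt i - 1 | i. 1 \<le> i \<and> i < m + n} :: (hecke_gen, 'k) free_alg set)"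
    by (auto simp: free_map_diff free_map_mult)
  have 2: "free_map (shift_gen m) ` {tt i * tt (i + 1) * tt i - tt (i + 1) * tt i * tt (i + 1) | i. 1 \<le> i \<and> i + 1 < n} \<subseteq>
     ({tt i * tt (i + 1) * tt i - tt (i + 1) * tt i * tt (i + 1) | i. 1 \<le> i \<and> i + 1 < m + n} :: (hecke_gen, 'k) free_alg set)"
    by (auto simp: free_map_diff free_map_mult) ((rule_tac x="i + m" in exI, simp)?)
  have 3: "free_map (shift_gen m) ` {tt i * tt j - tt j * tt i | i j. 1 \<le> i \<and> i < n \<and> 1 \<le> j \<and> j < n \<and> \<bar>int i - int j\<bar> > 1} \<subseteq>
     ({tt i * tt j - tt j * tt i | i j. 1 \<le> i \<and> i < m + n \<and> 1 \<le> j \<and> j < m + n \<and> \<bar>int i - int j\<bar> > 1} :: (hecke_gen, 'k) free_alg set)"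
    by (auto simp: free_map_diff free_map_mult) ((rule_tac x="i + m" in exI, rule_tac x="j + m" in exI, simp)?)
  have 4: "free_map (shift_gen m) ` {yy i * tt i - tt i * yy (i + 1) - 1 | i. 1 \<le> i \<and> i < n} \<subseteq>
     ({yy i * tt i - tt i * yy (i + 1) - 1 | i. 1 \<le> i \<and> i < m + n} :: (hecke_gen, 'k) free_alg set)"
    by (auto simp: free_map_diff free_map_mult) ((rule_tac x="i + m" in exI, simp)?)
  have 5: "free_map (shift_gen m) ` {tt i * yy j - yy j * tt i | i j. 1 \<le> i \<and> i < n \<and> 1 \<le> j \<and> j \<le> n \<and> j \<noteq> i \<and> j \<noteq> i + 1} \<subseteq>
     ({tt i * yy j - yy j * tt i | i j. 1 \<le> i \<and> i < m + n \<and> 1 \<le> j \<and> j \<le> m + n \<and> j \<noteq> i \<and> j \<noteq> i + 1} :: (hecke_gen, 'k) free_alg set)"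
    by (auto simp: free_map_diff free_map_mult) ((rule_tac x="i + m" in exI, rule_tac x="j + m" in exI, simp)?)
  have 6: "free_map (shift_gen m) ` {yy i * yy j - yy j * yy i | i j. 1 \<le> i \<and> i \<le> n \<and> 1 \<le> j \<and> j \<le> n} \<subseteq>
     ({yy i * yy j - yy j * yy i | i j. 1 \<le> i \<and> i \<le> m + n \<and> 1 \<le> j \<and> j \<le> m + n} :: (hecke_gen, 'k) free_alg set)"
    by (auto simp: free_map_diff free_map_mult) ((rule_tac x="i + m" in exI, rule_tac x="j + m" in exI, simp)?)
  show ?thesis
    unfolding hecke_rels_def image_Un by (intro Un_mono 1 2 3 4 5 6)
qed

lemma HF_mono: "p \<in> HF m \<Longrightarrow> p \<in> HF (m + n)"
  using hecke_gens_mono[of m n] by (fastforce simp: free_carrier)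
lemma HF_shift: "q \<in> HF n \<Longrightarrow> free_map (shift_gen m) q \<in> HF (m + n)"
  by (rule free_map_closed[OF _ hecke_gens_shift])
lemma HI_mono: "p \<in> HI m \<Longrightarrow> p \<in> HI (m + n)"
  using free_map_ideal[OF hecke_rels_carrier[of m] hecke_rels_carrier[of "m + n"], of id p]
    hecke_gens_mono[of m n] hecke_rels_mono[of m n] ideal_rels[OF hecke_rels_carrier[of "m + n"]]
  by (fastforce simp: free_map_id)
lemma HI_shift: "q \<in> HI n \<Longrightarrow> free_map (shift_gen m) q \<in> HI (m + n)"
  using free_map_ideal[OF hecke_rels_carrier[of n] hecke_rels_carrier[of "m + n"] hecke_gens_shift, of q]
    hecke_rels_shift[of m n] ideal_rels[OF hecke_rels_carrier[of "m + n"]] by blast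

lemma hecke_relI:
  "\<lbrakk>1 \<le> i; i < n; 1 \<le> j; j < n; \<bar>int i - int j\<bar> > 1\<rbrakk> \<Longrightarrow> tt i * tt j - tt j * tt i \<in> hecke_rels n"
  "\<lbrakk>1 \<le> i; i < n; 1 \<le> j; j \<le> n; j \<noteq> i; j \<noteq> i + 1\<rbrakk> \<Longrightarrow> tt i * yy j - yy j * tt i \<in> hecke_rels n"
  "\<lbrakk>1 \<le> i; i \<le> n; 1 \<le> j; j \<le> n\<rbrakk> \<Longrightarrow> yy i * yy j - yy j * yy i \<in> hecke_rels n"
  unfolding hecke_rels_def by blast+

lemma HI_commute:
  fixes p q :: "(hecke_gen, 'k::field) free_alg"
  assumes p: "p \<in> HF m" and q: "q \<in> HF n"
  shows "p * free_map (shift_gen m) q - free_map (shift_gen m) q * p \<in> HI (m + n)"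
proof (rule commute_ideal[OF hecke_rels_carrier hecke_gens_mono hecke_gens_shift _ p free_map_closed[OF q subset_refl]])
  fix a b assume a: "a \<in> hecke_gens m" and b: "b \<in> shift_gen m ` hecke_gens n"
  have swap: "(x :: (hecke_gen, 'k) free_alg) - y \<in> HI (m + n)" if "y - x \<in> hecke_rels (m + n)" for x y
  proof -
    have "y - x \<in> HI (m + n)" using that ideal_rels[OF hecke_rels_carrier] by blast
    then have "scal (-1) * (y - x) \<in> HI (m + n)" using ideal_mult[OF hecke_rels_carrier] by blast
    then show ?thesis by (simp add: scal_def single_uminus[of 0 1])
  qed
  have base: "(x :: (hecke_gen, 'k) free_alg) \<in> HI (m + n)" if "x \<in> hecke_rels (m + n)" for x
    using that ideal_rels[OF hecke_rels_carrier] by blast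
  show "gen a * gen b - gen b * gen a \<in> (HI (m + n) :: (hecke_gen, 'k) free_alg set)"
  proof -
    from b consider (t) j where "b = T (j + m)" "1 \<le> j" "j < n" | (y) j where "b = Y (j + m)" "1 \<le> j" "j \<le> n"
      by (auto simp: hecke_gens_def)
    then show ?thesis
    proof cases
      case t
      then show ?thesis using a by (cases a) (auto intro!: base[OF hecke_relI(1)] swap[OF hecke_relI(2)])
    next
      case y
      then show ?thesis using a by (cases a) (auto intro!: base[OF hecke_relI(2)] base[OF hecke_relI(3)])
    qed
  qed
qed

lemmas HC_eq_iff = cls_eq_iff[OF hecke_rels_carrier]

lemma HC_cong_mult:
  assumes "HC n p = HC n p'" "HC n q = HC n q'" "p \<in> HF n" "p' \<in> HF n" "q \<in> HF n" "q' \<in> HF n"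
  shows "HC n (p * q) = HC n (p' * q')"
  using assms pa_mult[OF hecke_rels_carrier, of p n q] pa_mult[OF hecke_rels_carrier, of p' n q'] by simp

lemma hecke_tensor_HC:
  assumes "p \<in> HF m" "q \<in> HF n"
  shows "hecke_tensor m n (HC m p) (HC n q) = HC (m + n) (p * free_map (shift_gen m) q)"
  unfolding hecke_tensor_def
proof (intro union_cls[OF hecke_rels_carrier] assms)
  fix p' q' assume p': "p' \<in> HC m p" and q': "q' \<in> HC n q"
  have P: "p' \<in> HF m" "HC m p' = HC m p" using cls_memD[OF hecke_rels_carrier assms(1) p'] by auto
  have Q: "q' \<in> HF n" "HC n q' = HC n q" using cls_memD[OF hecke_rels_carrier assms(2) q'] by auto
  have "HC (m + n) p' = HC (m + n) p"
    using P assms HI_mono[of "p' - p" m n] by (simp add: HC_eq_iff HF_mono)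
  moreover have "HC (m + n) (free_map (shift_gen m) q') = HC (m + n) (free_map (shift_gen m) q)"
    using Q assms HI_shift[of "q' - q" n m] by (simp add: HC_eq_iff HF_shift free_map_diff)
  ultimately show "HC (m + n) (p' * free_map (shift_gen m) q') = HC (m + n) (p * free_map (shift_gen m) q)"
    using P Q assms by (intro HC_cong_mult) (auto simp: HF_mono HF_shift)
qed

lemma ha_carrier: "carrier (hecke_algebra n) = HC n ` HF n"
  and ha_mult: "p \<in> HF n \<Longrightarrow> q \<in> HF n \<Longrightarrow> HC n p \<otimes>\<^bsub>hecke_algebra n\<^esub> HC n q = HC n (p * q)"
  and ha_add: "p \<in> HF n \<Longrightarrow> q \<in> HF n \<Longrightarrow> HC n p \<oplus>\<^bsub>hecke_algebra n\<^esub> HC n q = HC n (p + q)"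
  and ha_smult: "p \<in> HF n \<Longrightarrow> c \<odot>\<^bsub>hecke_algebra n\<^esub> HC n p = HC n (scal c * p)"
  and ha_one: "\<one>\<^bsub>hecke_algebra n\<^esub> = HC n 1"
  and ha_zero: "\<zero>\<^bsub>hecke_algebra n\<^esub> = HC n 0"
  unfolding hecke_algebra_def
  by (rule pa_carrier pa_mult pa_add pa_smult pa_one pa_zero; (rule hecke_rels_carrier | assumption))+

lemma one_rel: "{1} \<subseteq> carrier (free_algebra {})" by simp

lemma hh_module: "Module.module (ring_of_type_algebra :: 'k::field ring) (hecke_hom m n)"
  unfolding hecke_hom_def hecke_algebra_def
  by (auto intro!: pa_module hecke_rels_carrier)

lemma trivial_carrier: "carrier (presented_algebra {} {1 :: ('g, 'k::field) free_alg}) = {\<zero>\<^bsub>presented_algebra {} {1}\<^esub>}"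
proof -
  have "(1 :: ('g, 'k) free_alg) \<in> rel_ideal {} {1}" using ideal_rels[OF one_rel] by blast
  then have "p \<in> rel_ideal {} {1}" if "p \<in> carrier (free_algebra {})" for p :: "('g, 'k) free_alg"
    using ideal_mult[OF one_rel _ that, of 1] by simp
  then have "cls {} {1} p = cls {} {1} 0" if "p \<in> carrier (free_algebra {})" for p :: "('g, 'k) free_alg"
    using that by (simp add: cls_eq_iff[OF one_rel])
  then have "cls {} {1 :: ('g, 'k) free_alg} ` carrier (free_algebra {}) = {cls {} {1} 0}"
    using free_0[of "{}"] by blast
  then show ?thesis by (simp add: pa_carrier[OF one_rel] pa_zero[OF one_rel])
qed

lemma hh_carrier: "carrier (hecke_hom m n) = (if m = n then HC n ` HF n else {\<zero>\<^bsub>hecke_hom m n\<^esub>})"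
  using trivial_carrier by (auto simp: hecke_hom_def ha_carrier)
lemma hh_zero_diag: "\<zero>\<^bsub>hecke_hom n n\<^esub> = HC n 0"
  by (simp add: hecke_hom_def ha_zero)
lemma hh_zero_closed: "\<zero>\<^bsub>hecke_hom m n\<^esub> \<in> carrier (hecke_hom m n)"
  by (auto simp: hh_carrier hh_zero_diag)

lemma hh_diag [simp]: "hecke_hom n n = hecke_algebra n" by (simp add: hecke_hom_def)

lemma bilinear_zero:
  assumes "Module.module (ring_of_type_algebra :: 'k::field ring) W"
  shows "bilinear_op U V W (\<lambda>u v. \<zero>\<^bsub>W\<^esub>)"
proof -
  interpret W: Module.module "ring_of_type_algebra :: 'k ring" W by fact
  show ?thesis
    using W.smult_r_null by (auto simp: bilinear_op_def ring_of_type_algebra_def)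
qed

lemma bilinear_cong:
  "bilinear_op U V W f \<Longrightarrow> (\<And>u v. f u v = g u v) \<Longrightarrow> bilinear_op U V W g"
  by (simp add: bilinear_op_def)

lemma hecke_category_simps [simp]:
  "Ob hecke_category = UNIV" "Hom hecke_category = hecke_hom"
  "Ident hecke_category n = HC n 1" "Unit hecke_category = 0" "Tens hecke_category = (+)"
  "mor hecke_category m n = carrier (hecke_hom m n)"
  by (simp_all add: hecke_category_def ha_one mor_def)

lemma comp_hecke: "Comp hecke_category l m n g f =
    (if l = m \<and> m = n then g \<otimes>\<^bsub>hecke_algebra n\<^esub> f else \<zero>\<^bsub>hecke_hom l n\<^esub>)"
  and tens_hecke: "TensMor hecke_category m m' n n' f g =
    (if m = m' \<and> n = n' then hecke_tensor m n f g else \<zero>\<^bsub>hecke_hom (m + n) (m' + n')\<^esub>)"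
  by (simp_all add: hecke_category_def)

lemma comp_hecke_HC: "p \<in> HF n \<Longrightarrow> q \<in> HF n \<Longrightarrow> Comp hecke_category n n n (HC n p) (HC n q) = HC n (p * q)"
  by (simp add: comp_hecke ha_mult)
lemma tens_hecke_HC: "p \<in> HF m \<Longrightarrow> q \<in> HF n \<Longrightarrow>
    TensMor hecke_category m m n n (HC m p) (HC n q) = HC (m + n) (p * free_map (shift_gen m) q)"
  by (simp add: tens_hecke hecke_tensor_HC)

lemma comp_zero_left: "f \<in> carrier (hecke_hom l m) \<Longrightarrow>
    Comp hecke_category l m n \<zero>\<^bsub>hecke_hom m n\<^esub> f = \<zero>\<^bsub>hecke_hom l n\<^esub>"
  by (auto simp: comp_hecke hh_carrier ha_zero ha_mult)
lemma comp_zero_right: "g \<in> carrier (hecke_hom m n) \<Longrightarrow>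
    Comp hecke_category l m n g \<zero>\<^bsub>hecke_hom l m\<^esub> = \<zero>\<^bsub>hecke_hom l n\<^esub>"
  by (auto simp: comp_hecke hh_carrier ha_zero ha_mult)
lemma tens_zero_left: "g \<in> carrier (hecke_hom n n') \<Longrightarrow>
    TensMor hecke_category m m' n n' \<zero>\<^bsub>hecke_hom m m'\<^esub> g = \<zero>\<^bsub>hecke_hom (m + n) (m' + n')\<^esub>"
  by (auto simp: tens_hecke hh_carrier ha_zero hecke_tensor_HC)
lemma tens_zero_right: "f \<in> carrier (hecke_hom m m') \<Longrightarrow>
    TensMor hecke_category m m' n n' f \<zero>\<^bsub>hecke_hom n n'\<^esub> = \<zero>\<^bsub>hecke_hom (m + n) (m' + n')\<^esub>"
  by (auto simp: tens_hecke hh_carrier ha_zero hecke_tensor_HC)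

lemma comp_hecke_bilinear:
  "bilinear_op (hecke_hom m n) (hecke_hom l m) (hecke_hom l n) (Comp hecke_category l m n)"
proof (cases "l = m \<and> m = n")
  case True
  have "p * (scal c * q) = scal c * (p * q)" for c p and q :: "(hecke_gen, 'a) free_alg"
    by (metis mult.assoc scal_comm)
  then show ?thesis using True
    by (auto simp: bilinear_op_def ha_carrier ha_add ha_smult comp_hecke_HC free_add free_mult algebra_simps)
next
  case False
  show ?thesis
    by (rule bilinear_cong[OF bilinear_zero[OF hh_module]]) (use False in \<open>auto simp: comp_hecke\<close>)
qed

lemma tens_hecke_bilinear:
  "bilinear_op (hecke_hom m m') (hecke_hom n n') (hecke_hom (m + n) (m' + n')) (TensMor hecke_category m m' n n')"
proof (cases "m = m' \<and> n = n'")
  case True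
  have "p * (scal c * q) = scal c * (p * q)" for c p and q :: "(hecke_gen, 'a) free_alg"
    by (metis mult.assoc scal_comm)
  then show ?thesis using True
    by (auto simp: bilinear_op_def ha_carrier ha_add ha_smult tens_hecke_HC free_add free_mult
      HF_mono HF_shift free_map_add free_map_mult algebra_simps)
next
  case False
  show ?thesis
    by (rule bilinear_cong[OF bilinear_zero[OF hh_module]]) (use False in \<open>auto simp: tens_hecke\<close>)
qed

lemma comp_closed: "f \<in> carrier (hecke_hom l m) \<Longrightarrow> g \<in> carrier (hecke_hom m n) \<Longrightarrow>
  Comp hecke_category l m n g f \<in> carrier (hecke_hom l n)"
  using comp_hecke_bilinear unfolding bilinear_op_def by blast
lemma tensm_closed: "f \<in> carrier (hecke_hom m m') \<Longrightarrow> g \<in> carrier (hecke_hom n n') \<Longrightarrow>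
  TensMor hecke_category m m' n n' f g \<in> carrier (hecke_hom (m + n) (m' + n'))"
  using tens_hecke_bilinear unfolding bilinear_op_def by blast

lemma hh_offdiag: "f \<in> carrier (hecke_hom m n) \<Longrightarrow> m \<noteq> n \<Longrightarrow> f = \<zero>\<^bsub>hecke_hom m n\<^esub>"
  by (simp add: hh_carrier)

lemma shift_shift: "free_map (shift_gen m) (free_map (shift_gen n) p) = free_map (shift_gen (m + n)) p"
proof -
  have "shift_gen m \<circ> shift_gen n = shift_gen (m + n)"
  proof
    show "(shift_gen m \<circ> shift_gen n) x = shift_gen (m + n) x" for x by (cases x) auto
  qed
  then show ?thesis by (simp add: free_map_comp)
qed
lemma shift_0: "free_map (shift_gen 0) p = p"
proof -
  have "shift_gen 0 = id"
  proof
    show "shift_gen 0 x = id x" for x by (cases x) auto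
  qed
  then show ?thesis by (simp add: free_map_id)
qed

lemma hecke_category_strict: "strict_linear_tensor_category (hecke_category :: ('k::field, nat, _) tensor_category)"
proof (rule strict_linear_tensor_category.intro, unfold hecke_category_simps, goal_cases)
  case (1 X Y) show ?case by (rule hh_module)
next
  case (2 X) show ?case by (simp add: ha_carrier)
next
  case 3 show ?case by (rule comp_hecke_bilinear)
next
  case (4 W X Y Z f g h)
  note f = 4(5) and g = 4(6) and h = 4(7)
  consider "W \<noteq> X" | "X \<noteq> Y" | "Y \<noteq> Z" | "W = X" "X = Y" "Y = Z" by blast
  then show ?case
  proof cases
    case 1
    have f0: "f = \<zero>\<^bsub>hecke_hom W X\<^esub>" by (rule hh_offdiag[OF f 1])
    show ?thesis unfolding f0
      using g h by (simp add: comp_zero_right comp_closed)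
  next
    case 2
    have f0: "g = \<zero>\<^bsub>hecke_hom X Y\<^esub>" by (rule hh_offdiag[OF g 2])
    show ?thesis unfolding f0
      using f h by (simp add: comp_zero_right comp_zero_left comp_closed)
  next
    case 3
    have f0: "h = \<zero>\<^bsub>hecke_hom Y Z\<^esub>" by (rule hh_offdiag[OF h 3])
    show ?thesis unfolding f0
      using f g by (simp add: comp_zero_right comp_zero_left comp_closed)
  next
    case 4
    then show ?thesis using f g h
      by (auto simp: ha_carrier comp_hecke_HC free_mult mult.assoc)
  qed
next
  case (5 X Y f)
  show ?case
  proof (cases "X = Y")
    case True
    then show ?thesis using 5 by (auto simp: ha_carrier comp_hecke ha_mult)
  next
    case False
    show ?thesis unfolding hh_offdiag[OF 5(3) False] using False by (simp add: comp_hecke)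
  qed
next
  case (6 X Y f)
  show ?case
  proof (cases "X = Y")
    case True
    then show ?thesis using 6 by (auto simp: ha_carrier comp_hecke ha_mult)
  next
    case False
    show ?thesis unfolding hh_offdiag[OF 6(3) False] using False by (simp add: comp_hecke)
  qed
next
  case 12 show ?case by (rule tens_hecke_bilinear)
next
  case (13 X Y)
  show ?case by (simp add: tens_hecke_HC)
next
  case (14 X Y Z X' Y' Z' f g f' g')
  note f = 14(7) and g = 14(8) and f' = 14(9) and g' = 14(10)
  note zero = comp_zero_left comp_zero_right tens_zero_left tens_zero_right comp_closed tensm_closed hh_zero_closed
  consider "X \<noteq> Y" | "Y \<noteq> Z" | "X' \<noteq> Y'" | "Y' \<noteq> Z'" | "X = Y" "Y = Z" "X' = Y'" "Y' = Z'" by blast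
  then show ?case
  proof cases
    case 1
    show ?thesis unfolding hh_offdiag[OF f 1] using f f' g g' by (simp add: zero)
  next
    case 2
    show ?thesis unfolding hh_offdiag[OF g 2] using f f' g g' by (simp add: zero)
  next
    case 3
    show ?thesis unfolding hh_offdiag[OF f' 3] using f f' g g' by (simp add: zero)
  next
    case 4
    show ?thesis unfolding hh_offdiag[OF g' 4] using f f' g g' by (simp add: zero)
  next
    case 5
    obtain p q p' q' where eq: "f = HC X p" "g = HC X q" "f' = HC X' p'" "g' = HC X' q'"
      and F: "p \<in> HF X" "q \<in> HF X" "p' \<in> HF X'" "q' \<in> HF X'"
      using f g f' g' 5 by (auto simp: ha_carrier)
    let ?s = "free_map (shift_gen X)"
    have "q * (p * ?s q' - ?s q' * p) * ?s p' \<in> HI (X + X')"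
      using HI_commute[OF F(1) F(4)] F
      by (intro ideal_mult[OF hecke_rels_carrier, THEN conjunct1] ideal_mult[OF hecke_rels_carrier, THEN conjunct2])
        (auto simp: HF_mono HF_shift)
    then have "HC (X + X') (q * p * ?s (q' * p')) = HC (X + X') (q * ?s q' * (p * ?s p'))"
      using F by (subst HC_eq_iff) (simp_all add: HF_mono HF_shift free_mult free_map_mult right_diff_distrib left_diff_distrib mult.assoc)
    then show ?thesis
      using F 5 unfolding eq by (simp add: comp_hecke_HC tens_hecke_HC free_mult HF_mono HF_shift)
  qed
next
  case (15 X Y X' Y' X'' Y'' f g h)
  note f = 15(7) and g = 15(8) and h = 15(9)
  note zero = tens_zero_left tens_zero_right tensm_closed hh_zero_closed
  consider "X \<noteq> Y" | "X' \<noteq> Y'" | "X'' \<noteq> Y''" | "X = Y" "X' = Y'" "X'' = Y''" by blast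
  then show ?case
  proof cases
    case 1
    show ?thesis unfolding hh_offdiag[OF f 1] using f g h by (simp add: zero add.assoc)
  next
    case 2
    show ?thesis unfolding hh_offdiag[OF g 2] using f g h by (simp add: zero add.assoc)
  next
    case 3
    show ?thesis unfolding hh_offdiag[OF h 3]
      using f g h tens_zero_right[OF tensm_closed[OF f g], of X'' Y''] by (simp add: zero add.assoc)
  next
    case 4
    then show ?thesis using f g h
      by (auto simp: ha_carrier tens_hecke_HC free_mult HF_mono HF_shift free_map_mult shift_shift
          mult.assoc add.assoc)
  qed
next
  case (16 X Y f)
  show ?case
  proof (cases "X = Y")
    case True
    then show ?thesis using 16 by (auto simp: ha_carrier tens_hecke hecke_tensor_HC shift_0)
  next
    case False
    show ?thesis unfolding hh_offdiag[OF 16(3) False] using False by (simp add: tens_hecke)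
  qed
next
  case (17 X Y f)
  have *: "hecke_tensor Y 0 (HC Y p) (HC 0 1) = HC Y p" if "p \<in> HF Y" for p
    using that by (simp add: hecke_tensor_HC)
  then show ?case
  proof (cases "X = Y")
    case True
    then show ?thesis using 17 * by (auto simp: ha_carrier tens_hecke)
  next
    case False
    show ?thesis unfolding hh_offdiag[OF 17(3) False] using False by (simp add: tens_hecke)
  qed
qed simp_all

end

theory Submission
  imports Defs "HOL-Library.Multiset_Order" "HOL-Combinatorics.Transposition"
begin

text \<open>The polynomials in the \<open>y\<^sub>j\<close> are the centralizer in \<open>\<Lambda>\<^sub>N\<close> of all \<open>y\<^sub>j\<close>, and such a
  polynomial commutes with \<open>t\<^sub>i\<close> precisely if it is symmetric in \<open>y\<^sub>i\<close> and \<open>y\<^sub>i\<^sub>+\<^sub>1\<close>. A natural family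
  of degree \<open>n\<close> is therefore a family of polynomials that are symmetric within \<open>n\<close> blocks of
  variables. The coefficient of a monomial depends only on the \<open>n\<close> multisets of exponents in the blocks,
  and on these coefficient functions the differential is that of the bar complex of the free
  commutative monoid on generators \<open>z\<^sub>0, z\<^sub>1, \<dots>\<close> (with \<open>z\<^sub>i\<close> for the exponent \<open>i\<close>), with the augmentation
  \<open>z\<^sub>0 \<mapsto> 1\<close>, \<open>z\<^sub>i \<mapsto> 0\<close> for \<open>i > 0\<close>. The substitution \<open>z\<^sub>0 \<mapsto> z\<^sub>0 - 1\<close> turns this into the augmentation at
  the origin, for which the complex splits according to the total multiset; an explicit homotopy, valid
  in every characteristic, shows that the cohomology has as a basis the products of distinct dual
  generators. The dual of \<open>z\<^sub>i\<close> corresponds to \<open>x\<^sup>i\<close>.\<close>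

section \<open>The bar complex of a commutative monoid\<close>

text \<open>Tensoring with an identity multiplies by the constant polynomial 1, whose coefficient
  function is 1 on multisets of zeros and 0 elsewhere: this is the augmentation in the outer faces.
  An inner face leaves the polynomial alone and merges two blocks, so it adds two multisets.
  Exponents are unbounded, so the monoid has infinitely many generators, and arbitrary coefficient
  functions would give infinite combinations of dual generators: k[[x]] instead of k[x] in degree
  one. They are excluded because each value of a family is a polynomial. This condition
  (\<open>lfin\<close>) has to be carried through the decomposition and the choice of primitives.
  Splitting by totals is compatible with it: a class of degree n lives on totals of size n, where
  only finitely many exponents occur. Two facts on \<Lambda>_n need its basis, monomials times
  permutations: the centralizer of the y_j, and the fact that equal cochains have equal
  coefficients. Rewriting with the relations shows that these elements span. Their independence
  comes from an action on the free module with this basis, in which the t_i act through divided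
  differences.\<close>

text \<open>The recursive call starts with the face \<open>\<epsilon> N * F (M # L)\<close>, which
  is foreign to the full alternating sum; the third term cancels it. In degree 0 the two outer faces
  cancel, which is why \<open>[M]\<close> gives 0 and why for \<open>[M, N]\<close> the third term
  is the last outer face itself. \<open>F\<close> is a function on lists of all lengths; the degree
  is the length.\<close>

fun bar_d :: "('a::comm_monoid_add \<Rightarrow> 'k::comm_ring_1) \<Rightarrow> ('a list \<Rightarrow> 'k) \<Rightarrow> 'a list \<Rightarrow> 'k" where
  "bar_d \<epsilon> F [] = 0"
| "bar_d \<epsilon> F [M] = 0"
| "bar_d \<epsilon> F (M # N # L) = \<epsilon> M * F (N # L) - F ((M + N) # L) + \<epsilon> N * F (M # L)
    - bar_d \<epsilon> (\<lambda>K. F (M # K)) (N # L)"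

definition bar_cup :: "nat \<Rightarrow> ('a list \<Rightarrow> 'k::comm_ring_1) \<Rightarrow> ('a list \<Rightarrow> 'k) \<Rightarrow> 'a list \<Rightarrow> 'k" where
  "bar_cup m F G L = F (take m L) * G (drop m L)"

lemma bar_d_add: "bar_d \<epsilon> (\<lambda>K. F K + G K) L = bar_d \<epsilon> F L + bar_d \<epsilon> G L"
  by (induction L arbitrary: F G rule: induct_list012) (simp_all add: algebra_simps)

lemma bar_d_scale: "bar_d \<epsilon> (\<lambda>K. c * F K) L = c * bar_d \<epsilon> F L"
  by (induction L arbitrary: F rule: induct_list012) (simp_all add: algebra_simps)

lemma bar_d_zero: "bar_d \<epsilon> (\<lambda>K. 0) L = 0"
  using bar_d_scale[of \<epsilon> 0] by simp

lemma bar_d_uminus: "bar_d \<epsilon> (\<lambda>K. - F K) L = - bar_d \<epsilon> F L"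
  using bar_d_scale[of \<epsilon> "-1"] by simp

lemma bar_d_diff: "bar_d \<epsilon> (\<lambda>K. F K - G K) L = bar_d \<epsilon> F L - bar_d \<epsilon> G L"
  using bar_d_add[of \<epsilon> F "\<lambda>K. - G K"] by (simp add: bar_d_uminus)

lemmas bar_d_linear = bar_d_add bar_d_diff bar_d_scale bar_d_uminus bar_d_zero

lemma bar_d_sum: "bar_d \<epsilon> (\<lambda>K. \<Sum>x\<in>A. F x K) L = (\<Sum>x\<in>A. bar_d \<epsilon> (F x) L)"
  by (induction A rule: infinite_finite_induct) (simp_all add: bar_d_linear)

lemma bar_d_cong:
  assumes "\<And>K. length K = length L - 1 \<Longrightarrow> F K = F' K"
  shows "bar_d \<epsilon> F L = bar_d \<epsilon> F' L"
  using assms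
proof (induction L arbitrary: F F' rule: induct_list012)
  case (3 M N L)
  have "bar_d \<epsilon> (\<lambda>K. F (M # K)) (N # L) = bar_d \<epsilon> (\<lambda>K. F' (M # K)) (N # L)"
    by (rule 3(2)) (simp add: 3(3))
  then show ?case by (simp add: 3(3))
qed simp_all

lemma bar_d_bar_d:
  assumes e: "\<And>M N. \<epsilon> (M + N) = \<epsilon> M * \<epsilon> N"
  shows "bar_d \<epsilon> (bar_d \<epsilon> F) L = 0"
proof (induction L arbitrary: F rule: induct_list012)
  case (3 M N L)
  show ?case
  proof (cases L)
    case (Cons P L')
    have *: "bar_d \<epsilon> (\<lambda>K. bar_d \<epsilon> F (M # N # K)) (P # L') =
        \<epsilon> M * bar_d \<epsilon> (\<lambda>K. F (N # K)) (P # L') - bar_d \<epsilon> (\<lambda>K. F ((M + N) # K)) (P # L')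
        + \<epsilon> N * bar_d \<epsilon> (\<lambda>K. F (M # K)) (P # L') - bar_d \<epsilon> (\<lambda>K. bar_d \<epsilon> (\<lambda>K. F (M # K)) (N # K)) (P # L')"
      by (simp add: bar_d_linear)
    have "bar_d \<epsilon> (bar_d \<epsilon> (\<lambda>K. F (M # K))) (N # P # L') = 0"
      using 3(2) Cons by simp
    then show ?thesis
      unfolding Cons bar_d.simps(3)[of \<epsilon> "bar_d \<epsilon> F"] bar_d.simps(3)[of \<epsilon> "\<lambda>K. bar_d \<epsilon> F (M # K)"] *
        bar_d.simps(3)[of \<epsilon> "bar_d \<epsilon> (\<lambda>K. F (M # K))"]
      unfolding bar_d.simps(3)[of \<epsilon> F]
      by (simp add: e algebra_simps)
  qed simp
qed simp_all

text \<open>For m = 0 the left factor is the constant \<open>F []\<close>, whose differential is 0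
  on lists of length at most one. Each further entry of the left factor is peeled off the
  list.\<close>

lemma bar_d_cup:
  "bar_d \<epsilon> (bar_cup m F G) L = bar_cup (Suc m) (bar_d \<epsilon> F) G L + (-1) ^ m * bar_cup m F (bar_d \<epsilon> G) L"
proof (induction m arbitrary: F L)
  case 0
  show ?case
    by (cases "(\<epsilon>, G, L)" rule: bar_d.cases)
      (auto simp: bar_cup_def bar_d_scale algebra_simps)
next
  case (Suc m)
  have *: "(\<lambda>K. bar_cup (Suc m) F G (M # K)) = bar_cup m (\<lambda>K. F (M # K)) G" for M
    by (simp add: bar_cup_def fun_eq_iff)
  show ?case
  proof (cases "(\<epsilon>, G, L)" rule: bar_d.cases)
    case (3 a b M N L')
    then show ?thesis
      using Suc[of "\<lambda>K. F (M # K)" "N # L'"] by (simp add: * ) (simp add: bar_cup_def algebra_simps)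
  qed (simp_all add: bar_cup_def)
qed

section \<open>The homotopy contracting the bar complex of a free commutative monoid\<close>

abbreviation eps0 :: "'a multiset \<Rightarrow> 'k::comm_ring_1" where
  "eps0 M \<equiv> (if M = {#} then 1 else 0)"

abbreviation bar0 :: "('a multiset list \<Rightarrow> 'k::comm_ring_1) \<Rightarrow> 'a multiset list \<Rightarrow> 'k" where
  "bar0 \<equiv> bar_d eps0"

lemma bar0_bar0: "bar0 (bar0 F) L = 0"
  by (rule bar_d_bar_d) auto

lemma bar0_cong:
  assumes "\<And>K. length K = length L - 1 \<Longrightarrow> sum_list K = sum_list L \<Longrightarrow> F K = F' K"
  shows "bar0 F L = bar0 F' L"
  using assms
proof (induction L arbitrary: F F' rule: induct_list012)
  case (3 M N L)
  have "bar0 (\<lambda>K. F (M # K)) (N # L) = bar0 (\<lambda>K. F' (M # K)) (N # L)"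
    by (rule 3(2)) (simp add: 3(3))
  moreover have "F ((M + N) # L) = F' ((M + N) # L)" by (rule 3(3)) (simp_all add: add.assoc)
  ultimately show ?case by (simp add: 3(3))
qed simp_all

fun rem1_list :: "'a \<Rightarrow> 'a multiset list \<Rightarrow> 'a multiset list" where
  "rem1_list i [] = []"
| "rem1_list i (M # L) = (if i \<in># M then (M - {#i#}) # L else M # rem1_list i L)"

text \<open>The alternating sum over all ways to move one copy of \<open>i\<close> out of the first entry containing it
  into a new entry further to the left.\<close>

fun hty :: "'a \<Rightarrow> ('a multiset list \<Rightarrow> 'k::comm_ring_1) \<Rightarrow> 'a multiset list \<Rightarrow> 'k" where
  "hty i F [] = 0"
| "hty i F (M # L) = (if i \<in># M then F ({#i#} # (M - {#i#}) # L)
     else F ({#i#} # M # rem1_list i L) - hty i (\<lambda>K. F (M # K)) L)"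

text \<open>The contribution of the last face to the failure of \<open>rem1_list\<close> to commute with the
  differential.\<close>

fun corr :: "'a \<Rightarrow> ('a multiset list \<Rightarrow> 'k::comm_ring_1) \<Rightarrow> 'a multiset list \<Rightarrow> 'k" where
  "corr i G [] = 0"
| "corr i G (N # L) = (if i \<in># N then (if N = {#i#} \<and> L = [] then - G [] else 0)
     else - corr i (\<lambda>K. G (N # K)) L)"

text \<open>What the homotopy leaves over. On \<open>X @ [{#i#}]\<close> with no i in
  \<open>X\<close> it is the sum of the values of \<open>F\<close> over all insertions of
  \<open>{#i#}\<close> into \<open>X\<close>, with sign (-1)^j for the place j steps before the end;
  on other lists it is 0. The insertions with j > 0 come from \<open>corr\<close>.\<close>

fun qop :: "'a \<Rightarrow> ('a multiset list \<Rightarrow> 'k::comm_ring_1) \<Rightarrow> 'a multiset list \<Rightarrow> 'k" where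
  "qop i F [] = 0"
| "qop i F (M # L) = (if i \<in># M then (if M = {#i#} \<and> L = [] then F [{#i#}] else 0)
     else qop i (\<lambda>K. F (M # K)) L + corr i (\<lambda>K. F ({#i#} # M # K)) L)"

lemma hty_add: "hty i (\<lambda>K. F K + G K) L = hty i F L + hty i G L"
  by (induction L arbitrary: F G) simp_all

lemma hty_scale: "hty i (\<lambda>K. c * F K) L = c * hty i F L"
  by (induction L arbitrary: F) (simp_all add: algebra_simps)

lemma hty_scale_right: "hty i (\<lambda>K. F K * c) L = hty i F L * c"
  using hty_scale[of i c F] by (simp add: mult.commute)

lemma hty_uminus: "hty i (\<lambda>K. - F K) L = - hty i F L"
  using hty_scale[of i "-1"] by simp

lemma hty_diff: "hty i (\<lambda>K. F K - G K) L = hty i F L - hty i G L"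
  using hty_add[of i F "\<lambda>K. - G K"] by (simp add: hty_uminus)

text \<open>\<open>hty\<close> inserts an entry, so it never evaluates its argument at the empty
  list.\<close>

lemma hty_cong_nonempty:
  assumes "\<And>M K. F (M # K) = F' (M # K)"
  shows "hty i F L = hty i F' L"
proof (cases L)
  case (Cons N L')
  have "F = F' \<or> (\<forall>M K. F (M # K) = F' (M # K))" using assms by blast
  then show ?thesis using Cons assms by simp
qed simp

lemma sum_rem1_list: "i \<in># sum_list L \<Longrightarrow> sum_list (rem1_list i L) = sum_list L - {#i#}"
proof (induction L)
  case (Cons M L)
  show ?case
  proof (cases "i \<in># M")
    case False
    then have "i \<in># sum_list L" using Cons.prems by auto
    then show ?thesis using Cons.IH False by (metis diff_union_single_conv rem1_list.simps(2) sum_list.Cons)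
  qed (use Cons in \<open>auto dest!: multi_member_split\<close>)
qed simp

lemma length_rem1_list [simp]: "length (rem1_list i L) = length L"
  by (induction L) auto

lemma hty_zero:
  assumes "i \<in># sum_list L"
    and "\<And>K. length K = Suc (length L) \<Longrightarrow> sum_list K = sum_list L \<Longrightarrow> F K = 0"
  shows "hty i F L = 0"
  using assms
proof (induction L arbitrary: F)
  case (Cons M L)
  show ?case
  proof (cases "i \<in># M")
    case True
    then show ?thesis by (auto intro!: Cons.prems(2))
  next
    case False
    then have i: "i \<in># sum_list L" using Cons.prems(1) by auto
    have "hty i (\<lambda>K. F (M # K)) L = 0"
      by (rule Cons.IH[OF i]) (simp add: Cons.prems(2))
    moreover have "F ({#i#} # M # rem1_list i L) = 0"
      using i by (intro Cons.prems(2)) (simp_all add: sum_rem1_list)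
    ultimately show ?thesis using False by simp
  qed
qed simp

lemma corr_cong:
  assumes "i \<in># sum_list L"
    and "\<And>K. Suc (length K) = length L \<Longrightarrow> sum_list K = sum_list L - {#i#} \<Longrightarrow> F K = F' K"
  shows "corr i F L = corr i F' L"
  using assms
proof (induction L arbitrary: F F')
  case (Cons M L)
  show ?case
  proof (cases "i \<in># M")
    case True
    then show ?thesis using Cons.prems(2)[of "[]"] by auto
  next
    case False
    then have i: "i \<in># sum_list L" using Cons.prems(1) by auto
    have "corr i (\<lambda>K. F (M # K)) L = corr i (\<lambda>K. F' (M # K)) L"
      using i by (intro Cons.IH Cons.prems(2)) simp_all
    then show ?thesis using False by simp
  qed
qed simp

lemma qop_cong:
  assumes "i \<in># sum_list L"
    and "\<And>K. length K = length L \<Longrightarrow> sum_list K = sum_list L \<Longrightarrow> F K = F' K"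
  shows "qop i F L = qop i F' L"
  using assms
proof (induction L arbitrary: F F')
  case (Cons M L)
  show ?case
  proof (cases "i \<in># M")
    case True
    then show ?thesis using Cons.prems(2)[of "[M]"] by auto
  next
    case False
    then have i: "i \<in># sum_list L" using Cons.prems(1) by auto
    have "qop i (\<lambda>K. F (M # K)) L = qop i (\<lambda>K. F' (M # K)) L"
      by (rule Cons.IH[OF i]) (simp add: Cons.prems(2))
    moreover have "corr i (\<lambda>K. F ({#i#} # M # K)) L = corr i (\<lambda>K. F' ({#i#} # M # K)) L"
      using i by (intro corr_cong Cons.prems(2)) simp_all
    ultimately show ?thesis using False by simp
  qed
qed simp

lemma corr_zero: "corr i (\<lambda>K. 0) L = 0"
  by (induction L) auto

lemma qop_zero: "qop i (\<lambda>K. 0) L = 0"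
  by (induction L) (auto simp: corr_zero)

lemma corr_support:
  "corr i F L \<noteq> 0 \<Longrightarrow> \<exists>K. L = K @ [{#i#}] \<and> i \<notin># sum_list K"
proof (induction L arbitrary: F)
  case (Cons M L)
  show ?case
  proof (cases "i \<in># M")
    case True
    then show ?thesis using Cons.prems by (auto split: if_splits)
  next
    case False
    then obtain K where "L = K @ [{#i#}]" "i \<notin># sum_list K" using Cons by fastforce
    then show ?thesis using False by (intro exI[of _ "M # K"]) simp
  qed
qed simp

lemma qop_support:
  "qop i F L \<noteq> 0 \<Longrightarrow> \<exists>K. L = K @ [{#i#}] \<and> i \<notin># sum_list K"
proof (induction L arbitrary: F)
  case (Cons M L)
  show ?case
  proof (cases "i \<in># M")
    case True
    then show ?thesis using Cons.prems by (auto split: if_splits)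
  next
    case False
    then have "qop i (\<lambda>K. F (M # K)) L \<noteq> 0 \<or> corr i (\<lambda>K. F ({#i#} # M # K)) L \<noteq> 0"
      using Cons.prems by auto
    then obtain K where "L = K @ [{#i#}]" "i \<notin># sum_list K" using Cons.IH corr_support by metis
    then show ?thesis using False by (intro exI[of _ "M # K"]) simp
  qed
qed simp

text \<open>Only the outer faces test whether an entry is empty. Removing i changes them when it
  empties the first or the last entry: the new first face is the last summand, the new last face is
  \<open>corr\<close>. Inner faces commute with the removal.\<close>

lemma bar0_rem1_list:
  assumes "i \<in># sum_list L"
  shows "bar0 G (rem1_list i L) = bar0 (\<lambda>K. G (rem1_list i K)) L + corr i G L
     + (if i \<in># hd L then eps0 (hd L - {#i#}) * G (tl L) else 0)"
  using assms
proof (induction L arbitrary: G rule: induct_list012)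
  case (2 M)
  then show ?case by (auto dest: multi_member_split)
next
  case (3 M N L)
  show ?case
  proof (cases "i \<in># M")
    case True
    then obtain M' where "M = add_mset i M'" by (auto dest: multi_member_split)
    then show ?thesis by simp
  next
    case False
    then have i: "i \<in># sum_list (N # L)" using 3(3) by auto
    note IH = 3(2)[OF i, of "\<lambda>K. G (M # K)"]
    show ?thesis
    proof (cases "i \<in># N")
      case True
      then obtain N' where "N = add_mset i N'" by (auto dest: multi_member_split)
      then show ?thesis using False IH by (simp add: algebra_simps)
    next
      case N: False
      then show ?thesis using False IH by (simp add: algebra_simps)
    qed
  qed
qed simp

text \<open>If the first entry contains i, the face of \<open>hty i (bar0 F)\<close> that merges
  \<open>{#i#}\<close> back into it gives \<open>- F L\<close>, and everything else cancels. If not,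
  peeling off this entry \<open>M\<close> gives the claim for \<open>F (M # K)\<close> together with
  the defect computed in \<open>bar0_rem1_list\<close>, whose last face ends up in
  \<open>qop\<close>.\<close>

theorem homotopy:
  assumes "i \<in># sum_list L"
  shows "bar0 (hty i F) L + hty i (bar0 F) L = qop i F L - F L"
  using assms
proof (induction L arbitrary: F rule: induct_list012)
  case (2 M)
  then obtain M' where "M = add_mset i M'" by (auto dest: multi_member_split)
  then show ?case by simp
next
  case (3 M N L)
  show ?case
  proof (cases "i \<in># M")
    case True
    then obtain M' where "M = add_mset i M'" by (auto dest: multi_member_split)
    then show ?thesis by (simp add: algebra_simps)
  next
    case False
    then have i: "i \<in># sum_list (N # L)" using 3(3) by auto
    \<comment> \<open>The faces of \<open>bar0 F (M # K)\<close> as functions of \<open>K\<close>,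
      so that the linearity of \<open>hty\<close> applies. They represent it for nonempty
      \<open>K\<close> only, as \<open>hd\<close> and \<open>tl\<close> are arbitrary at
      \<open>[]\<close>.\<close>
    let ?FM = "\<lambda>K. F (M # K)" and ?A = "\<lambda>K. F ((M + hd K) # tl K)" and ?B = "\<lambda>K. eps0 (hd K) * F (M # tl K)"
      and ?FiM = "\<lambda>K. F ({#i#} # M # K)"
    note IH = 3(2)[OF i, of ?FM]
    have "hty i (\<lambda>K. bar0 F (M # K)) (N # L) =
        hty i (\<lambda>K. eps0 M * F K - ?A K + ?B K - bar0 ?FM K) (N # L)"
      by (rule hty_cong_nonempty) simp
    also have "\<dots> = eps0 M * hty i F (N # L) - hty i ?A (N # L) + hty i ?B (N # L) - hty i (bar0 ?FM) (N # L)"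
      by (simp only: hty_add hty_diff hty_scale)
    finally have 1: "hty i (\<lambda>K. bar0 F (M # K)) (N # L) = \<dots>" .

    note 3 = bar0_rem1_list[OF i, of ?FiM]
    have "bar0 (hty i F) (M # N # L) + hty i (bar0 F) (M # N # L) =
      eps0 M * hty i F (N # L) - hty i F ((M + N) # L) + eps0 N * hty i F (M # L)
      - bar0 (\<lambda>K. hty i F (M # K)) (N # L) + bar0 F ({#i#} # M # rem1_list i (N # L))
      - hty i (\<lambda>K. bar0 F (M # K)) (N # L)"
      using False by simp
    also have "\<dots> = qop i F (M # N # L) - F (M # N # L)"
    proof (cases "i \<in># N")
      case True
      then obtain N' where N: "N = add_mset i N'" by (auto dest: multi_member_split)
      have e: "i \<notin># M" by fact
      show ?thesis using e 1 3 IH unfolding N by (simp add: algebra_simps bar_d_diff)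
    next
      case N: False
      show ?thesis using False N 1 3 IH
        by (simp add: algebra_simps hty_scale hty_scale_right hty_diff hty_add hty_uminus bar_d_linear split del: if_split)
    qed
    finally show ?thesis .
  qed
qed simp

text \<open>On totals that contain i, \<open>qop i\<close> differs from the identity by a
  null-homotopic map, so it is a chain map there.\<close>

lemma qop_bar0:
  assumes i: "i \<in># sum_list L"
  shows "qop i (bar0 G) L = bar0 (qop i G) L"
proof -
  have "bar0 (qop i G) L = bar0 (\<lambda>K. bar0 (hty i G) K + hty i (bar0 G) K + G K) L"
  proof (rule bar0_cong)
    fix K assume "sum_list K = sum_list L"
    then have "i \<in># sum_list K" using i by simp
    from homotopy[OF this, of G]
    show "qop i G K = bar0 (hty i G) K + hty i (bar0 G) K + G K" by simp
  qed
  also have "\<dots> = bar0 (hty i (bar0 G)) L + bar0 G L"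
    by (simp add: bar_d_linear bar0_bar0)
  also have "\<dots> = qop i (bar0 G) L"
  proof -
    have "hty i (bar0 (bar0 G)) L = 0" by (rule hty_zero[OF i]) (simp add: bar0_bar0)
    then show ?thesis using homotopy[OF i, of "bar0 G"] by (simp add: algebra_simps)
  qed
  finally show ?thesis by simp
qed

section \<open>Dual generators, their products, and cocycles of a fixed total\<close>

text \<open>The degree-one cocycle dual to the generator i, applied to lists of length one, in
  particular as right factor of a \<open>bar_cup\<close>.\<close>

definition dual1 :: "'a \<Rightarrow> 'a multiset list \<Rightarrow> 'k::comm_ring_1" where
  "dual1 i L = (if hd L = {#i#} then 1 else 0)"

lemma bar0_dual1: "length L = 2 \<Longrightarrow> bar0 (dual1 i) (L :: 'a multiset list) = (0 :: 'b::comm_ring_1)"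
  by (cases "(eps0 :: 'a multiset \<Rightarrow> 'b, dual1 i :: _ \<Rightarrow> 'b, L)" rule: bar_d.cases) (auto simp: dual1_def union_is_single)

lemma bar0_cup_dual1:
  "length L = m + 2 \<Longrightarrow> bar0 (bar_cup m F (dual1 i)) L = bar_cup (Suc m) (bar0 F) (dual1 i) L"
  unfolding bar_d_cup by (simp add: bar_cup_def bar0_dual1)

text \<open>By \<open>qop_support\<close>, \<open>qop i F\<close> is a product with the cocycle
  \<open>dual1 i\<close> on the right, so the Leibniz rule leaves only the differential of the left
  factor.\<close>

lemma bar0_qop_snoc:
  assumes "i \<notin># sum_list K"
  shows "bar0 (qop i F) (K @ [{#i#}]) = bar0 (\<lambda>X. qop i F (X @ [{#i#}])) K"
proof (cases K rule: rev_cases)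
  case (snoc K' M)
  let ?m = "length K'" and ?F' = "\<lambda>X. qop i F (X @ [{#i#}])"
  have "qop i F L = bar_cup ?m ?F' (dual1 i) L" if len: "length L = Suc ?m" for L
  proof -
    obtain L' N where L: "L = L' @ [N]" "length L' = ?m"
      using len by (cases L rule: rev_cases) auto
    then show ?thesis using qop_support[of i F L] by (auto simp: bar_cup_def dual1_def)
  qed
  then have "bar0 (qop i F) (K @ [{#i#}]) = bar0 (bar_cup ?m ?F' (dual1 i)) (K @ [{#i#}])"
    using snoc by (intro bar_d_cong) simp
  also have "\<dots> = bar0 ?F' K"
    using snoc by (simp add: bar0_cup_dual1) (simp add: bar_cup_def dual1_def)
  finally show ?thesis .
qed simp

text \<open>The cup product of the dual generators of \<open>S\<close> in increasing order.\<close>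

definition std :: "nat set \<Rightarrow> nat multiset list \<Rightarrow> 'k::comm_ring_1" where
  "std S L = (if L = map (\<lambda>i. {#i#}) (sorted_list_of_set S) then 1 else 0)"

lemma sorted_list_of_set_Max:
  assumes "finite S" "S \<noteq> {}"
  shows "sorted_list_of_set S = sorted_list_of_set (S - {Max S}) @ [Max S]"
proof -
  define m where "m = Max S"
  have m: "m \<in> S" and lt: "\<forall>x\<in>S - {m}. x < m"
    using assms by (auto simp: m_def order_less_le Max_ge)
  let ?l = "sorted_list_of_set (S - {m}) @ [m]"
  have "sorted_wrt (<) ?l \<and> set ?l = S \<and> length ?l = card S"
    using assms(1) m lt card_Suc_Diff1[OF assms(1) m] by (auto simp: sorted_wrt_append)
  then have "sorted_list_of_set S = ?l"
    by (rule sorted_list_of_set_unique[OF assms(1), THEN iffD1])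
  then show ?thesis by (simp add: m_def)
qed

lemma std_snoc:
  assumes "finite S" "S \<noteq> {}"
  shows "std S (K @ [M]) = std (S - {Max S}) K * dual1 (Max S) [M]"
  unfolding std_def sorted_list_of_set_Max[OF assms] dual1_def by simp

lemma std_nonzero:
  assumes "std S L \<noteq> 0" "finite S"
  shows "sum_list L = mset_set S" "length L = card S"
proof -
  have "L = map (\<lambda>i. {#i#}) (sorted_list_of_set S)" using assms(1) by (simp add: std_def split: if_splits)
  then show "sum_list L = mset_set S" "length L = card S"
    using assms(2) by (simp_all flip: mset_set_set)
qed

text \<open>For total \<open>{#}\<close> there is one list in each length, and the differential is
  alternately zero and the identity: only degree 0 has cohomology.\<close>

lemma bar0_replicate_empty:
  "bar0 G (replicate (Suc n) {#}) = (if even n then 0 else G (replicate n {#}))"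
proof (induction n arbitrary: G)
  case (Suc n)
  show ?case using Suc[of "\<lambda>K. G ({#} # K)"] by simp
qed simp

lemma sum_list_eq_empty: "sum_list L = {#} \<longleftrightarrow> L = replicate (length L) {#}"
  by (induction L) auto

text \<open>The bar complex splits according to the total multiset \<open>D\<close>. For \<open>D \<noteq> {#}\<close> the homotopy for
  \<open>i = Max D\<close> reduces a cocycle to one that is supported on lists ending in \<open>{#i#}\<close>, that is, to
  a cocycle of total \<open>D - {#i#}\<close>.\<close>

theorem cocycle_local:
  fixes F :: "nat multiset list \<Rightarrow> 'k::comm_ring_1"
  assumes "\<And>L. length L = Suc n \<Longrightarrow> sum_list L = D \<Longrightarrow> bar0 F L = 0"
  shows "\<exists>G c. (c \<noteq> 0 \<longrightarrow> (\<exists>S. finite S \<and> card S = n \<and> D = mset_set S)) \<and>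
    (\<forall>L. length L = n \<longrightarrow> sum_list L = D \<longrightarrow> F L = bar0 G L + c * std (set_mset D) L)"
  using assms
proof (induction "size D" arbitrary: D n F rule: less_induct)
  case less
  show ?case
  proof (cases "D = {#}")
    case True
    show ?thesis
    proof (cases n)
      case 0
      then show ?thesis using True
        by (intro exI[of _ "\<lambda>_. 0"] exI[of _ "F []"]) (simp add: std_def, metis card.empty finite.emptyI mset_set.empty)
    next
      case (Suc m)
      have "odd n \<Longrightarrow> F (replicate n {#}) = 0"
        using less(2)[of "replicate (Suc n) {#}"] True bar0_replicate_empty[of F n] by (simp add: sum_list_eq_empty)
      then show ?thesis using True Suc bar0_replicate_empty[of "\<lambda>_. F (replicate n {#})" m]
        by (intro exI[of _ "\<lambda>_. F (replicate n {#})"] exI[of _ 0]) (auto simp: sum_list_eq_empty split: if_splits)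
    qed
  next
    case False
    define i where "i = Max (set_mset D)"
    have i: "i \<in># D" using False by (simp add: i_def)
    show ?thesis
    proof (cases n)
      case 0
      then show ?thesis using False by (intro exI[of _ F] exI[of _ 0]) auto
    next
      case (Suc m)
      have F: "F L = qop i F L - bar0 (hty i F) L" if "length L = n" "sum_list L = D" for L
      proof -
        have iL: "i \<in># sum_list L" using i that by simp
        have "hty i (bar0 F) L = 0" by (rule hty_zero[OF iL]) (use less(2) that in auto)
        then show ?thesis using homotopy[OF iL, of F] by (simp add: algebra_simps)
      qed
      show ?thesis
      proof (cases "i \<in># D - {#i#}")
        \<comment> \<open>\<open>qop i F\<close> lives on lists in which i occurs exactly once, so
          it vanishes on this total.\<close>
        case True
        have "qop i F L = 0" if "length L = n" "sum_list L = D" for L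
          using qop_support[of i F L] that True by fastforce
        then show ?thesis using F
          by (intro exI[of _ "\<lambda>K. - hty i F K"] exI[of _ 0]) (simp add: bar_d_uminus)
      next
        case iD: False
        \<comment> \<open>The last entry is forced to be \<open>{#i#}\<close>; dropping it leaves a
          cocycle of smaller total and degree.\<close>
        define F' where "F' X = qop i F (X @ [{#i#}])" for X
        have cocycle: "bar0 F' X = 0" if "length X = Suc m" "sum_list X = D - {#i#}" for X
        proof -
          have iX: "i \<notin># sum_list X" using iD that by simp
          have sum: "sum_list (X @ [{#i#}]) = D" using that i by simp
          have iX': "i \<in># sum_list (X @ [{#i#}])" by simp
          have "bar0 F' X = bar0 (qop i F) (X @ [{#i#}])"
            using bar0_qop_snoc[OF iX, of F] by (simp add: F'_def[abs_def])
          also have "\<dots> = qop i (bar0 F) (X @ [{#i#}])" using qop_bar0[OF iX'] by metis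
          also have "\<dots> = qop i (\<lambda>_. 0) (X @ [{#i#}])"
            using that Suc sum by (intro qop_cong[OF iX'] less(2)) auto
          finally show ?thesis by (simp add: qop_zero)
        qed
        have "size (D - {#i#}) < size D" using i by (rule size_Diff1_less)
        note less(1)[of _ m F', OF this cocycle]
        then obtain G c
          where c: "c \<noteq> 0 \<longrightarrow> (\<exists>S. finite S \<and> card S = m \<and> D - {#i#} = mset_set S)"
            and G: "\<And>L. length L = m \<Longrightarrow> sum_list L = D - {#i#} \<Longrightarrow>
               F' L = bar0 G L + c * std (set_mset (D - {#i#})) L"
          by metis
        \<comment> \<open>The primitive of the smaller total times the dropped generator. For m = 0
          there is no degree m - 1, and the differential of \<open>G\<close> at \<open>[]\<close> is
          0, which the default 0 reproduces.\<close>
        define G0 where "G0 = (if m = 0 then (\<lambda>_. 0) else bar_cup (m - 1) G (dual1 i))"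
        have G0: "bar0 G0 (X @ [M]) = bar0 G X * dual1 i [M]" if "length X = m" for X M
        proof (cases m)
          case (Suc m')
          then show ?thesis using that
            by (simp add: G0_def bar0_cup_dual1) (simp add: bar_cup_def)
        qed (use that in \<open>simp add: G0_def\<close>)
        have setD: "set_mset (D - {#i#}) = set_mset D - {i}" using iD by (auto dest: in_diffD simp: in_diff_count split: if_splits)
        have std: "std (set_mset D) (X @ [M]) = (std (set_mset (D - {#i#})) X * dual1 i [M] :: 'k)" for X M
          using std_snoc[of "set_mset D" X M] False by (simp add: setD flip: i_def)
        have c': "\<exists>S. finite S \<and> card S = n \<and> D = mset_set S" if c0: "c \<noteq> 0"
        proof -
          obtain S where S: "finite S" "card S = m" "D - {#i#} = mset_set S" using c c0 by blast
          then have "i \<notin> S" using iD by simp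
          moreover have "D = add_mset i (mset_set S)" using S i by (metis insert_DiffM)
          ultimately show ?thesis using S Suc by (intro exI[of _ "insert i S"]) simp
        qed
        have "F L = bar0 (\<lambda>K. G0 K - hty i F K) L + c * std (set_mset D) L"
          if len: "length L = n" and sum: "sum_list L = D" for L
        proof -
          obtain X M where L: "L = X @ [M]" "length X = m"
            using len Suc by (cases L rule: rev_cases) auto
          have "qop i F L = bar0 G0 L + c * std (set_mset D) L"
          proof (cases "M = {#i#}")
            case True
            then have "sum_list X = D - {#i#}" using sum L by auto
            then show ?thesis using G[OF L(2)] G0[OF L(2), of M] std[of X M] True
              by (simp add: L F'_def dual1_def)
          next
            case False
            then show ?thesis using qop_support[of i F L] L G0[OF L(2), of M] std[of X M]
              by (auto simp: dual1_def)
          qed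
          then show ?thesis using F[OF len sum] by (simp add: bar_d_diff)
        qed
        then show ?thesis using c' by blast
      qed
    qed
  qed
qed

section \<open>Products of distinct dual generators are independent modulo coboundaries\<close>

lemma corr_unsupported:
  assumes "\<And>K. length K = length L - 1 \<Longrightarrow> F K = 0"
  shows "corr i F L = 0"
  using assms
proof (induction L arbitrary: F)
  case (Cons M L)
  show ?case
  proof (cases L)
    case Nil
    then show ?thesis using Cons.prems[of "[]"] by simp
  next
    case (Cons N L')
    have "corr i (\<lambda>K. F (M # K)) L = 0" by (rule Cons.IH) (simp add: Cons Cons.prems)
    then show ?thesis using Cons by simp
  qed
qed simp

text \<open>Of the signed insertions that make up \<open>qop\<close> only the one at the end
  survives if \<open>F\<close> vanishes on lists with an earlier entry \<open>{#i#}\<close>.\<close>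

lemma qop_snoc_unique:
  assumes "i \<notin># sum_list X"
    and "\<And>K. length K = Suc (length X) \<Longrightarrow> {#i#} \<in> set (butlast K) \<Longrightarrow> F K = 0"
  shows "qop i F (X @ [{#i#}]) = F (X @ [{#i#}])"
  using assms
proof (induction X arbitrary: F)
  case (Cons M X)
  have M: "i \<notin># M" and X: "i \<notin># sum_list X" using Cons.prems(1) by auto
  have "corr i (\<lambda>K. F ({#i#} # M # K)) (X @ [{#i#}]) = 0"
    by (intro corr_unsupported Cons.prems(2)) auto
  moreover have "qop i (\<lambda>K. F (M # K)) (X @ [{#i#}]) = F (M # X @ [{#i#}])"
    by (rule Cons.IH[OF X]) (auto intro!: Cons.prems(2))
  ultimately show ?case using M by simp
qed simp

text \<open>With i the maximum of \<open>S\<close>, the chain map \<open>qop i\<close> fixes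
  \<open>std S\<close> on lists ending in \<open>{#i#}\<close>, because no other factor of
  \<open>std S\<close> belongs to i. A primitive for \<open>S\<close> thus yields one for
  \<open>S\<close> without i. The descent ends at the empty list, where every differential is
  0.\<close>

theorem std_not_exact:
  fixes c :: "'k::comm_ring_1"
  assumes "finite S"
    and "\<And>L. length L = card S \<Longrightarrow> sum_list L = mset_set S \<Longrightarrow> c * std S L = bar0 G L"
  shows "c = 0"
  using assms
proof (induction "card S" arbitrary: S G)
  case 0
  then show ?case using 0(3)[of "[]"] by (auto simp: std_def)
next
  case (Suc m)
  then have S: "finite S" "S \<noteq> {}" by auto
  define i where "i = Max S"
  have i: "i \<in> S" using S by (simp add: i_def)
  have m: "m = card (S - {i})" using Suc(2) S i by simp
  show ?case
  proof (rule Suc(1)[OF m])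
    show "finite (S - {i})" using S by simp
    fix X :: "nat multiset list" assume X: "length X = card (S - {i})" "sum_list X = mset_set (S - {i})"
    have iX: "i \<notin># sum_list X" unfolding X(2) using S by simp
    have iX': "i \<in># sum_list (X @ [{#i#}])" by simp
    have sum: "sum_list (X @ [{#i#}]) = mset_set S"
      using X(2) i S by (simp add: mset_set.remove)
    have "c * std (S - {i}) X = c * std S (X @ [{#i#}])"
      using std_snoc[OF S, of X "{#i#}", where ?'a = 'k] by (simp add: i_def dual1_def)
    also have "\<dots> = qop i (\<lambda>K. c * std S K) (X @ [{#i#}])"
    proof (rule qop_snoc_unique[OF iX, symmetric])
      fix K :: "nat multiset list" assume K: "{#i#} \<in> set (butlast K)"
      show "c * std S K = 0"
      proof (rule ccontr)
        assume "c * std S K \<noteq> 0"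
        then have K': "K = map (\<lambda>i. {#i#}) (sorted_list_of_set (S - {i}) @ [i])"
          using sorted_list_of_set_Max[OF S] by (auto simp: std_def i_def split: if_splits)
        show False using K S unfolding K' by auto
      qed
    qed
    also have "\<dots> = qop i (bar0 G) (X @ [{#i#}])"
      using X(1) m sum Suc(2) by (intro qop_cong[OF iX'] Suc(4)) auto
    also have "\<dots> = bar0 (qop i G) (X @ [{#i#}])" by (rule qop_bar0[OF iX'])
    also have "\<dots> = bar0 (\<lambda>X. qop i G (X @ [{#i#}])) X" by (rule bar0_qop_snoc[OF iX])
    finally show "c * std (S - {i}) X = bar0 (\<lambda>X. qop i G (X @ [{#i#}])) X" .
  qed
qed

text \<open>Different sets have different totals, so on lists of total \<open>mset_set S\<close>
  only the term of \<open>S\<close> is left.\<close>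

theorem std_independent:
  fixes c :: "nat set \<Rightarrow> 'k::comm_ring_1"
  assumes A: "finite A" "\<And>S. S \<in> A \<Longrightarrow> finite S \<and> card S = n"
    and eq: "\<And>L. length L = n \<Longrightarrow> (\<Sum>S\<in>A. c S * std S L) = bar0 G L"
    and S: "S \<in> A"
  shows "c S = 0"
proof (rule std_not_exact[of S _ G])
  show "finite S" using A S by blast
  fix L assume L: "length L = card S" "sum_list L = mset_set S"
  have "(\<Sum>S'\<in>A. c S' * std S' L) = (\<Sum>S'\<in>{S}. c S' * std S' L)"
  proof (rule sum.mono_neutral_right[OF A(1)])
    show "\<forall>S'\<in>A - {S}. c S' * std S' L = 0"
    proof
      fix S' assume S': "S' \<in> A - {S}"
      show "c S' * std S' L = 0"
      proof (rule ccontr)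
        assume "c S' * std S' L \<noteq> 0"
        then have "std S' L \<noteq> (0 :: 'k)" by auto
        then have "mset_set S' = mset_set S" using std_nonzero(1)[of S' L, where ?'a = 'k] L A(2) S' by auto
        then show False using S' S A(2) by (metis DiffE finite_set_mset_mset_set singletonI)
      qed
    qed
  qed (use S in auto)
  then show "c S * std S L = bar0 G L" using eq[of L] L A(2)[OF S] by simp
qed

text \<open>A family of block symmetric polynomials is determined by its coefficients, a function of the
  lists of multisets of exponents in the blocks. This condition on such a function says that the
  values of the family are polynomials and not just power series.\<close>

definition lfin :: "nat \<Rightarrow> (nat multiset list \<Rightarrow> 'k::zero) \<Rightarrow> bool" where
  "lfin n F \<longleftrightarrow> (\<forall>s. \<exists>b. \<forall>L. length L = n \<longrightarrow> size (sum_list L) \<le> s \<longrightarrow> F L \<noteq> 0 \<longrightarrow> (\<forall>i\<in>#sum_list L. i \<le> b))"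

section \<open>Locally finite cocycles and primitives\<close>

lemma lfin_supp:
  assumes "lfin n F"
    and "\<And>L. length L = m \<Longrightarrow> G L \<noteq> 0 \<Longrightarrow> \<exists>K. length K = n \<and> sum_list K = sum_list L \<and> F K \<noteq> 0"
  shows "lfin m G"
  using assms unfolding lfin_def by metis

text \<open>\<open>cocycle_local\<close> gives a primitive and a constant for each total. If both
  are taken to be zero on totals where \<open>F\<close> vanishes, the assembled primitive inherits
  local finiteness. A total with nonzero constant has size n, so \<open>lfin\<close> at s = n bounds
  its elements; hence \<open>A\<close> is finite.\<close>

theorem cocycle_decomposition:
  fixes F :: "nat multiset list \<Rightarrow> 'k::comm_ring_1"
  assumes fin: "lfin n F" and cocycle: "\<And>L. length L = Suc n \<Longrightarrow> bar0 F L = 0"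
  obtains G c A where "finite A" "\<And>S. S \<in> A \<Longrightarrow> finite S \<and> card S = n"
    "lfin (n - 1) G" "\<And>L. length L = n \<Longrightarrow> F L = bar0 G L + (\<Sum>S\<in>A. c S * std S L)"
proof -
  define van where "van D \<longleftrightarrow> (\<forall>L. length L = n \<longrightarrow> sum_list L = D \<longrightarrow> F L = 0)" for D
  define good where "good D G c \<longleftrightarrow> (van D \<longrightarrow> G = (\<lambda>_. 0) \<and> c = 0) \<and>
    (c \<noteq> 0 \<longrightarrow> (\<exists>S. finite S \<and> card S = n \<and> D = mset_set S)) \<and>
    (\<forall>L. length L = n \<longrightarrow> sum_list L = D \<longrightarrow> F L = bar0 G L + c * std (set_mset D) L)" for D G c
  have "\<exists>G c. good D G c" for D
  proof (cases "van D")
    case True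
    then show ?thesis
      by (intro exI[of _ "\<lambda>_. 0"] exI[of _ 0]) (simp add: good_def van_def bar_d_zero)
  next
    case False
    then show ?thesis using cocycle_local[of n D F] cocycle unfolding good_def by simp
  qed
  then obtain GG cc where g: "\<And>D. good D (GG D) (cc D)" by metis
  define G where "G L = GG (sum_list L) L" for L
  define A where "A = {S. finite S \<and> card S = n \<and> cc (mset_set S) \<noteq> 0}"
  obtain b where b: "\<And>L i. length L = n \<Longrightarrow> size (sum_list L) \<le> n \<Longrightarrow> F L \<noteq> 0 \<Longrightarrow> i \<in># sum_list L \<Longrightarrow> i \<le> b"
    using fin unfolding lfin_def by metis
  have "A \<subseteq> Pow {..b}"
  proof
    fix S assume S: "S \<in> A"
    then have "\<not> van (mset_set S)" using g[of "mset_set S"] by (auto simp: A_def good_def)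
    then obtain L where "length L = n" "sum_list L = mset_set S" "F L \<noteq> 0" by (auto simp: van_def)
    then show "S \<in> Pow {..b}" using b[of L] S by (auto simp: A_def)
  qed
  then have A: "finite A" by (rule finite_subset) simp
  have "lfin (n - 1) G"
  proof (rule lfin_supp[OF fin])
    fix L assume "G L \<noteq> 0"
    then have "\<not> van (sum_list L)" using g[of "sum_list L"] by (auto simp: good_def G_def)
    then show "\<exists>K. length K = n \<and> sum_list K = sum_list L \<and> F K \<noteq> 0" by (auto simp: van_def)
  qed
  moreover have "F L = bar0 G L + (\<Sum>S\<in>A. cc (mset_set S) * std S L)" if L: "length L = n" for L
  proof -
    let ?D = "sum_list L"
    have "bar0 G L = bar0 (GG ?D) L" by (rule bar0_cong) (simp add: G_def)
    moreover have "(\<Sum>S\<in>A. cc (mset_set S) * std S L) = cc ?D * std (set_mset ?D) L"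
    proof (cases "cc ?D = 0")
      case True
      have "cc (mset_set S) * std S L = 0" if "S \<in> A" for S
        using that std_nonzero(1)[of S L, where ?'a = 'k] True by (cases "std S L = (0 :: 'k)") (auto simp: A_def)
      then show ?thesis using True by simp
    next
      case False
      then obtain S0 where S0: "finite S0" "card S0 = n" "?D = mset_set S0" using g[of ?D] by (auto simp: good_def)
      have "(\<Sum>S\<in>A. cc (mset_set S) * std S L) = (\<Sum>S\<in>{S0}. cc (mset_set S) * std S L)"
      proof (rule sum.mono_neutral_right[OF A])
        show "\<forall>S\<in>A - {S0}. cc (mset_set S) * std S L = 0"
        proof
          fix S assume S: "S \<in> A - {S0}"
          show "cc (mset_set S) * std S L = 0"
          proof (rule ccontr)
            assume "cc (mset_set S) * std S L \<noteq> 0"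
            then have "std S L \<noteq> (0 :: 'k)" by auto
            then have "mset_set S = mset_set S0" using std_nonzero(1)[of S L, where ?'a = 'k] S S0 by (auto simp: A_def)
            then show False using S S0 by (metis (no_types, lifting) A_def DiffE finite_set_mset_mset_set mem_Collect_eq singletonI)
          qed
        qed
      qed (use S0 False in \<open>auto simp: A_def\<close>)
      then show ?thesis using S0 by simp
    qed
    ultimately show ?thesis using g[of ?D] L by (simp add: good_def)
  qed
  ultimately show ?thesis using A by (intro that[of A G "\<lambda>S. cc (mset_set S)"]) (auto simp: A_def)
qed

text \<open>The differential respects totals, so a primitive may be cut down to the totals on which
  \<open>F\<close> does not vanish; it then inherits the local finiteness of
  \<open>F\<close>.\<close>

lemma exact_lfin:
  assumes fin: "lfin n F" and exact: "\<And>L. length L = n \<Longrightarrow> F L = bar0 G L"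
  shows "\<exists>G'. lfin (n - 1) G' \<and> (\<forall>L. length L = n \<longrightarrow> F L = bar0 G' L)"
proof -
  define P where "P D \<longleftrightarrow> (\<exists>K. length K = n \<and> sum_list K = D \<and> F K \<noteq> 0)" for D
  define G' where "G' L = (if P (sum_list L) then G L else 0)" for L
  have "lfin (n - 1) G'" by (rule lfin_supp[OF fin]) (auto simp: G'_def P_def split: if_splits)
  moreover have "F L = bar0 G' L" if "length L = n" for L
  proof (cases "P (sum_list L)")
    case True
    then have "bar0 G' L = bar0 G L" by (intro bar0_cong) (simp add: G'_def)
    then show ?thesis using exact that by simp
  next
    case False
    then have "bar0 G' L = bar0 (\<lambda>_. 0) L" by (intro bar0_cong) (simp add: G'_def)
    then show ?thesis using False that by (auto simp: P_def bar_d_zero)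
  qed
  ultimately show ?thesis by blast
qed

section \<open>Shifting the zero generator\<close>

text \<open>Under the substitution \<open>z\<^sub>0 \<mapsto> z\<^sub>0 + c\<close> in the monoid algebra \<open>k[z\<^sub>0, z\<^sub>1, \<dots>]\<close> with
  \<open>c = -1\<close> the augmentation \<open>z\<^sub>0 \<mapsto> 1\<close>, \<open>z\<^sub>i \<mapsto> 0\<close>, which governs the deformation complex, becomes the
  augmentation at the origin.\<close>

abbreviation eps1 :: "nat multiset \<Rightarrow> 'k::comm_ring_1" where
  "eps1 M \<equiv> (if set_mset M \<subseteq> {0} then 1 else 0)"

definition sub_step :: "'k::comm_ring_1 \<Rightarrow> nat \<Rightarrow> (nat multiset \<Rightarrow> 'k) \<Rightarrow> nat multiset \<Rightarrow> 'k" where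
  "sub_step c i f M = f (add_mset i M) + (if i = 0 then c * f M else 0)"

text \<open>\<open>f\<close> is extended linearly to the monoid algebra and evaluated at the
  monomial \<open>M\<close> after the substitution z_0 -> z_0 + c; \<open>sub_step\<close> is the
  transpose of multiplication by one substituted generator.\<close>

definition sub :: "'k::comm_ring_1 \<Rightarrow> (nat multiset \<Rightarrow> 'k) \<Rightarrow> nat multiset \<Rightarrow> 'k" where
  "sub c f M = fold_mset (sub_step c) f M {#}"

interpretation sub_step: comp_fun_commute "sub_step c" for c :: "'k::comm_ring_1"
  by unfold_locales (auto simp: fun_eq_iff sub_step_def add_mset_commute algebra_simps)

lemma sub_empty [simp]: "sub c f {#} = f {#}"
  by (simp add: sub_def)

lemma sub_step_rec: "sub c f (add_mset i M) = sub c (sub_step c i f) M"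
  by (simp add: sub_def sub_step.fold_mset_fun_left_comm)

lemma sub_add: "sub c (\<lambda>K. f K + g K) M = sub c f M + sub c g M"
proof (induction M arbitrary: f g)
  case (add i M)
  have "sub_step c i (\<lambda>K. f K + g K) = (\<lambda>K. sub_step c i f K + sub_step c i g K)"
    by (simp add: fun_eq_iff sub_step_def algebra_simps)
  then show ?case by (simp add: sub_step_rec add)
qed simp

lemma sub_scale: "sub c (\<lambda>K. a * f K) M = a * sub c f M"
proof (induction M arbitrary: f)
  case (add i M)
  have "sub_step c i (\<lambda>K. a * f K) = (\<lambda>K. a * sub_step c i f K)"
    by (simp add: fun_eq_iff sub_step_def algebra_simps)
  then show ?case by (simp add: sub_step_rec add)
qed simp

lemma sub_zero [simp]: "sub c (\<lambda>K. 0) M = 0"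
  using sub_scale[of c 0] by simp

lemma sub_scale_right: "sub c (\<lambda>K. f K * a) M = sub c f M * a"
  using sub_scale[of c a f] by (simp add: mult.commute)

lemma sub_diff: "sub c (\<lambda>K. f K - g K) M = sub c f M - sub c g M"
  using sub_add[of c f "\<lambda>K. - 1 * g K" M] sub_scale[of c "-1" g M] by simp

lemma sub_add_mset:
  "sub c f (add_mset i M) = sub c (\<lambda>K. f (add_mset i K)) M + (if i = 0 then c * sub c f M else 0)"
  by (simp add: sub_step_rec sub_step_def[abs_def] sub_add sub_scale)

lemma sub_union: "sub c (\<lambda>A. sub c (\<lambda>B. f (A + B)) N) M = sub c f (M + N)"
proof (induction M arbitrary: f)
  case (add i M)
  show ?case using add.IH[of f] add.IH[of "\<lambda>K. f (add_mset i K)"] by (simp add: sub_add_mset)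
qed simp

lemma sub_sub: "sub c (sub (- c) f) M = f M"
proof (induction M arbitrary: f)
  case (add i M)
  have *: "sub c (\<lambda>K. sub (- c) f (add_mset i K)) M =
      sub c (sub (- c) (\<lambda>K. f (add_mset i K))) M - (if i = 0 then c * sub c (sub (- c) f) M else 0)"
    using sub_scale[of c c "sub (- c) f" M] by (simp add: sub_add_mset sub_diff)
  show ?case unfolding sub_add_mset[of c] * by (simp add: add)
qed simp

text \<open>The augmentation \<open>eps1\<close> takes z_0 - 1 to 0.\<close>

lemma sub_eps1: "sub (- 1) eps1 M = (eps0 M :: 'k::comm_ring_1)"
proof (induction M)
  case (add i M)
  have "sub (- 1) (\<lambda>K. eps1 (add_mset i K) :: 'k) M = (if i = 0 then sub (- 1) eps1 M else 0)"
    by simp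
  then show ?case by (simp add: sub_add_mset)
qed simp

lemma sub_bar_d: "bar_d \<epsilon> (\<lambda>K. sub c (\<lambda>A. g A K) M) L = sub c (\<lambda>A. bar_d \<epsilon> (g A) L) M"
proof (induction M arbitrary: g)
  case (add i M)
  then show ?case by (cases "i = 0") (simp_all add: sub_add_mset bar_d_linear)
qed simp

lemma sub_nonzero:
  "sub c f M \<noteq> 0 \<Longrightarrow> \<exists>K j. M = K + replicate_mset j 0 \<and> f K \<noteq> 0"
proof (induction M arbitrary: f)
  case empty
  then show ?case by (intro exI[of _ "{#}"] exI[of _ 0]) simp
next
  case (add i M)
  have "sub c (\<lambda>K. f (add_mset i K)) M \<noteq> 0 \<or> i = 0 \<and> sub c f M \<noteq> 0"
    using add.prems by (auto simp: sub_add_mset split: if_splits)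
  then consider "sub c (\<lambda>K. f (add_mset i K)) M \<noteq> 0" | "i = 0" "sub c f M \<noteq> 0" by blast
  then show ?case
  proof cases
    case 1
    then obtain K j where "M = K + replicate_mset j 0" "f (add_mset i K) \<noteq> 0" using add.IH by blast
    then show ?thesis by (intro exI[of _ "add_mset i K"] exI[of _ j]) simp
  next
    case 2
    then obtain K j where "M = K + replicate_mset j 0" "f K \<noteq> 0" using add.IH by blast
    then show ?thesis using 2 by (intro exI[of _ K] exI[of _ "Suc j"]) simp
  qed
qed

text \<open>The substitution in every entry. It is an algebra homomorphism
  (\<open>sub_union\<close>), and for c = -1 it carries one augmentation to the other
  (\<open>sub_eps1\<close>); so it becomes an isomorphism between the two bar complexes.\<close>

fun mext :: "'k::comm_ring_1 \<Rightarrow> (nat multiset list \<Rightarrow> 'k) \<Rightarrow> nat multiset list \<Rightarrow> 'k" where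
  "mext c F [] = F []"
| "mext c F (M # L) = sub c (\<lambda>K. mext c (\<lambda>X. F (K # X)) L) M"

lemma mext_add: "mext c (\<lambda>K. F K + G K) L = mext c F L + mext c G L"
  by (induction L arbitrary: F G) (simp_all add: sub_add)

lemma mext_scale: "mext c (\<lambda>K. a * F K) L = a * mext c F L"
  by (induction L arbitrary: F) (simp_all add: sub_scale)

lemma mext_diff: "mext c (\<lambda>K. F K - G K) L = mext c F L - mext c G L"
  using mext_add[of c F "\<lambda>K. - 1 * G K" L] mext_scale[of c "-1" G L] by simp

lemma mext_cong:
  "(\<And>K. length K = length L \<Longrightarrow> F K = F' K) \<Longrightarrow> mext c F L = mext c F' L"
proof (induction L arbitrary: F F')
  case (Cons M L)
  have "mext c (\<lambda>X. F (K # X)) L = mext c (\<lambda>X. F' (K # X)) L" for K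
    by (rule Cons.IH) (simp add: Cons.prems)
  then show ?case by simp
qed simp

lemma mext_sub: "mext c (\<lambda>X. sub d (\<lambda>B. g B X) M) L = sub d (\<lambda>B. mext c (g B) L) M"
proof (induction M arbitrary: g)
  case (add i M)
  then show ?case by (cases "i = 0") (simp_all add: sub_add_mset mext_add mext_scale)
qed simp

lemma mext_mext: "mext c (mext (- c) F) L = F L"
proof (induction L arbitrary: F)
  case (Cons M L)
  then show ?case by (simp add: mext_sub sub_sub[where f = "\<lambda>B. F (B # L)"])
qed simp

lemma mext_bar_d: "bar0 (mext (- 1) F) L = mext (- 1) (bar_d eps1 F) L"
proof (induction L arbitrary: F rule: induct_list012)
  case 2
  show ?case by simp
next
  case (3 M N L)
  let ?m = "mext (- 1 :: 'a)" and ?s = "sub (- 1 :: 'a)"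
  have "?m (bar_d eps1 F) (M # N # L) =
    ?s (\<lambda>A. ?s (\<lambda>B. eps1 A * ?m (\<lambda>X. F (B # X)) L - ?m (\<lambda>X. F ((A + B) # X)) L + eps1 B * ?m (\<lambda>X. F (A # X)) L
      - ?m (\<lambda>X. bar_d eps1 (\<lambda>K. F (A # K)) (B # X)) L) N) M"
    by (simp only: mext.simps bar_d.simps mext_add mext_diff mext_scale)
  also have "\<dots> = eps0 M * ?m F (N # L) - ?m F ((M + N) # L) + eps0 N * ?m F (M # L)
      - ?s (\<lambda>A. ?m (bar_d eps1 (\<lambda>K. F (A # K))) (N # L)) M"
    unfolding sub_add sub_diff sub_scale sub_scale_right sub_eps1
      sub_union[of "- 1" "\<lambda>A. ?m (\<lambda>X. F (A # X)) L"] mext.simps ..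
  also have "?s (\<lambda>A. ?m (bar_d eps1 (\<lambda>K. F (A # K))) (N # L)) M =
      bar0 (\<lambda>K. ?m F (M # K)) (N # L)"
    by (simp only: 3(2)[symmetric] mext.simps(2)[of _ F M] sub_bar_d)
  finally show ?case by simp
qed simp

lemma mext_cup: "m \<le> length L \<Longrightarrow> mext c (bar_cup m F G) L = bar_cup m (mext c F) (mext c G) L"
proof (induction m arbitrary: F L)
  case 0
  then show ?case by (simp add: bar_cup_def[abs_def] mext_scale)
next
  case (Suc m)
  then obtain M L' where L: "L = M # L'" "m \<le> length L'" by (cases L) auto
  have "(\<lambda>X. bar_cup (Suc m) F G (A # X)) = bar_cup m (\<lambda>X. F (A # X)) G" for A
    by (simp add: bar_cup_def fun_eq_iff)
  then show ?case using L Suc.IH[of L'] by (simp add: sub_scale_right) (simp add: sub_scale_right bar_cup_def)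
qed

section \<open>Local finiteness under substitution, differential and products\<close>

lemma mext_nonzero:
  "mext c F L \<noteq> 0 \<Longrightarrow>
    \<exists>K j. length K = length L \<and> sum_list L = sum_list K + replicate_mset j 0 \<and> F K \<noteq> 0"
proof (induction L arbitrary: F)
  case Nil
  then show ?case by (intro exI[of _ "[]"] exI[of _ 0]) simp
next
  case (Cons M L)
  then obtain A j where A: "M = A + replicate_mset j 0" "mext c (\<lambda>X. F (A # X)) L \<noteq> 0"
    using sub_nonzero[of c "\<lambda>K. mext c (\<lambda>X. F (K # X)) L" M] by auto
  with Cons.IH[OF A(2)] obtain K j' where
    "length K = length L" "sum_list L = sum_list K + replicate_mset j' 0" "F (A # K) \<noteq> 0" by blast
  then show ?case using A
    by (intro exI[of _ "A # K"] exI[of _ "j + j'"]) (simp add: multiset_eq_iff)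
qed

text \<open>The additional elements are zeros: they do not raise the largest exponent, and dropping
  them does not enlarge the size.\<close>

lemma lfin_transfer:
  assumes F: "lfin n F"
    and "\<And>L. length L = m \<Longrightarrow> G L \<noteq> 0 \<Longrightarrow>
      \<exists>K j. length K = n \<and> sum_list L = sum_list K + replicate_mset j 0 \<and> F K \<noteq> 0"
  shows "lfin m G"
  unfolding lfin_def
proof (intro allI)
  fix s
  obtain b where b: "\<forall>L. length L = n \<longrightarrow> size (sum_list L) \<le> s \<longrightarrow> F L \<noteq> 0 \<longrightarrow> (\<forall>i\<in>#sum_list L. i \<le> b)"
    using F unfolding lfin_def by blast
  show "\<exists>b. \<forall>L. length L = m \<longrightarrow> size (sum_list L) \<le> s \<longrightarrow> G L \<noteq> 0 \<longrightarrow> (\<forall>i\<in>#sum_list L. i \<le> b)"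
  proof (intro exI[of _ b] allI impI)
    fix L assume L: "length L = m" "size (sum_list L) \<le> s" "G L \<noteq> 0"
    obtain K j where K: "length K = n" "sum_list L = sum_list K + replicate_mset j 0" "F K \<noteq> 0"
      using assms(2)[OF L(1,3)] by blast
    have "size (sum_list K) \<le> s" using L(2) unfolding K(2) by simp
    then have "\<forall>i\<in>#sum_list K. i \<le> b" using b K(1,3) by blast
    then show "\<forall>i\<in>#sum_list L. i \<le> b" unfolding K(2) by (auto dest: in_replicate_mset[THEN iffD1])
  qed
qed

lemma lfin_mext: "lfin n F \<Longrightarrow> lfin n (mext c F)"
  by (erule lfin_transfer) (drule mext_nonzero, auto)

text \<open>An outer face can drop an entry only where \<open>eps1\<close> is nonzero, and such an
  entry consists of zeros.\<close>

lemma bar_d_eps1_nonzero: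
  "bar_d eps1 F L \<noteq> 0 \<Longrightarrow>
    \<exists>K j. Suc (length K) = length L \<and> sum_list L = sum_list K + replicate_mset j 0 \<and> F K \<noteq> 0"
proof (induction L arbitrary: F rule: induct_list012)
  case (3 M N L)
  have zeros: "\<exists>j. A = replicate_mset j 0" if "set_mset A \<subseteq> {0}" for A :: "nat multiset"
    using that by (metis set_mset_subset_singletonD)
  have "set_mset M \<subseteq> {0} \<and> F (N # L) \<noteq> 0 \<or> F ((M + N) # L) \<noteq> 0 \<or> set_mset N \<subseteq> {0} \<and> F (M # L) \<noteq> 0
    \<or> bar_d eps1 (\<lambda>K. F (M # K)) (N # L) \<noteq> 0"
  proof (rule ccontr)
    assume "\<not> ?thesis"
    then have "eps1 M * F (N # L) = 0" "F ((M + N) # L) = 0" "eps1 N * F (M # L) = 0"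
      "bar_d eps1 (\<lambda>K. F (M # K)) (N # L) = 0" by simp_all
    then have "bar_d eps1 F (M # N # L) = 0" by (simp only: bar_d.simps(3)) simp
    then show False using 3(3) by simp
  qed
  then consider "set_mset M \<subseteq> {0}" "F (N # L) \<noteq> 0" | "F ((M + N) # L) \<noteq> 0" | "set_mset N \<subseteq> {0}" "F (M # L) \<noteq> 0"
    | "bar_d eps1 (\<lambda>K. F (M # K)) (N # L) \<noteq> 0"
    by blast
  then show ?case
  proof cases
    case 1
    then obtain j where "M = replicate_mset j 0" using zeros by blast
    then show ?thesis using 1 by (intro exI[of _ "N # L"] exI[of _ j]) simp
  next
    case 2
    then show ?thesis by (intro exI[of _ "(M + N) # L"] exI[of _ 0]) (simp add: add.assoc)
  next
    case 3
    then obtain j where "N = replicate_mset j 0" using zeros by blast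
    then show ?thesis using 3 by (intro exI[of _ "M # L"] exI[of _ j]) simp
  next
    case 4
    obtain K j where "Suc (length K) = length (N # L)" "sum_list (N # L) = sum_list K + replicate_mset j 0" "F (M # K) \<noteq> 0"
      using "3.IH"(2)[OF 4] by blast
    then show ?thesis by (intro exI[of _ "M # K"] exI[of _ j]) (simp add: add.assoc)
  qed
qed simp_all

lemma lfin_bar_d: "lfin n F \<Longrightarrow> lfin (Suc n) (bar_d eps1 F)"
  by (erule lfin_transfer) (drule bar_d_eps1_nonzero, auto)

lemma lfin_cup:
  assumes "lfin m F" "lfin n G"
  shows "lfin (m + n) (bar_cup m F G)"
  unfolding lfin_def
proof (intro allI)
  fix s
  obtain b1 where b1: "\<forall>L. length L = m \<longrightarrow> size (sum_list L) \<le> s \<longrightarrow> F L \<noteq> 0 \<longrightarrow> (\<forall>i\<in>#sum_list L. i \<le> b1)"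
    using assms(1) unfolding lfin_def by blast
  obtain b2 where b2: "\<forall>L. length L = n \<longrightarrow> size (sum_list L) \<le> s \<longrightarrow> G L \<noteq> 0 \<longrightarrow> (\<forall>i\<in>#sum_list L. i \<le> b2)"
    using assms(2) unfolding lfin_def by blast
  show "\<exists>b. \<forall>L. length L = m + n \<longrightarrow> size (sum_list L) \<le> s \<longrightarrow> bar_cup m F G L \<noteq> 0 \<longrightarrow> (\<forall>i\<in>#sum_list L. i \<le> b)"
  proof (intro exI[of _ "max b1 b2"] allI impI)
    fix L assume L: "length L = m + n" "size (sum_list L) \<le> s" "bar_cup m F G L \<noteq> 0"
    have nz: "F (take m L) \<noteq> 0" "G (drop m L) \<noteq> 0" using L(3) by (auto simp: bar_cup_def)
    have s: "sum_list L = sum_list (take m L) + sum_list (drop m L)"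
      by (metis append_take_drop_id sum_list_append)
    have "size (sum_list (take m L)) \<le> s" "size (sum_list (drop m L)) \<le> s" using L(2) unfolding s by simp_all
    then have "\<forall>i\<in>#sum_list (take m L). i \<le> b1" "\<forall>i\<in>#sum_list (drop m L). i \<le> b2"
      using b1[rule_format, of "take m L"] b2[rule_format, of "drop m L"] nz L(1)
      by (simp_all del: set_mset_sum_list)
    then show "\<forall>i\<in>#sum_list L. i \<le> max b1 b2" unfolding s by (auto simp: le_max_iff_disj simp del: set_mset_sum_list)
  qed
qed

lemma lfin_add:
  assumes "lfin n F" "lfin n (G :: _ \<Rightarrow> 'k::comm_ring_1)"
  shows "lfin n (\<lambda>K. F K + G K)"
  unfolding lfin_def
proof (intro allI)
  fix s
  obtain b1 where b1: "\<forall>L. length L = n \<longrightarrow> size (sum_list L) \<le> s \<longrightarrow> F L \<noteq> 0 \<longrightarrow> (\<forall>i\<in>#sum_list L. i \<le> b1)"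
    using assms(1) unfolding lfin_def by blast
  obtain b2 where b2: "\<forall>L. length L = n \<longrightarrow> size (sum_list L) \<le> s \<longrightarrow> G L \<noteq> 0 \<longrightarrow> (\<forall>i\<in>#sum_list L. i \<le> b2)"
    using assms(2) unfolding lfin_def by blast
  show "\<exists>b. \<forall>L. length L = n \<longrightarrow> size (sum_list L) \<le> s \<longrightarrow> F L + G L \<noteq> 0 \<longrightarrow> (\<forall>i\<in>#sum_list L. i \<le> b)"
  proof (intro exI[of _ "max b1 b2"] allI impI)
    fix L assume L: "length L = n" "size (sum_list L) \<le> s" "F L + G L \<noteq> 0"
    then have "F L \<noteq> 0 \<or> G L \<noteq> 0" by auto
    then have "(\<forall>i\<in>#sum_list L. i \<le> b1) \<or> (\<forall>i\<in>#sum_list L. i \<le> b2)" using b1 b2 L(1,2) by blast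
    then show "\<forall>i\<in>#sum_list L. i \<le> max b1 b2" by (auto simp: le_max_iff_disj)
  qed
qed

lemma lfin_scale: "lfin n F \<Longrightarrow> lfin n (\<lambda>K. c * F K :: 'k::comm_ring_1)"
  by (erule lfin_supp) (metis mult_zero_right)

lemma lfin_zero: "lfin n (\<lambda>_. 0)"
  by (simp add: lfin_def)

section \<open>Presented algebras modulo their relations\<close>

text \<open>The carrier elements with property \<open>P\<close> form an ideal that contains
  \<open>R\<close>; negatives are obtained as products with \<open>scal (-1)\<close>.\<close>

lemma rel_ideal_induct [consumes 2, case_names zero rel add left right]:
  assumes R: "R \<subseteq> carrier (free_algebra G)" and p: "p \<in> rel_ideal G R"
    and z: "P 0" and r: "\<And>r. r \<in> R \<Longrightarrow> P r"
    and a: "\<And>x y. x \<in> carrier (free_algebra G) \<Longrightarrow> y \<in> carrier (free_algebra G) \<Longrightarrow> P x \<Longrightarrow> P y \<Longrightarrow> P (x + y)"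
    and l: "\<And>x y. x \<in> carrier (free_algebra G) \<Longrightarrow> y \<in> carrier (free_algebra G) \<Longrightarrow> P y \<Longrightarrow> P (x * y)"
    and m: "\<And>x y. x \<in> carrier (free_algebra G) \<Longrightarrow> y \<in> carrier (free_algebra G) \<Longrightarrow> P x \<Longrightarrow> P (x * y)"
  shows "P (p :: ('g, 'k::field) free_alg)"
proof -
  let ?J = "{p \<in> carrier (free_algebra G). P p}"
  have inv: "a_inv (free_algebra G) x = - x" if "x \<in> carrier (free_algebra G)" for x :: "('g,'k) free_alg"
    using that by (intro abelian_group.minus_equality[OF ring.is_abelian_group[OF ring_free]]) auto
  have "ideal ?J (free_algebra G)"
  proof (rule idealI[OF ring_free])
    show "subgroup ?J (add_monoid (free_algebra G))"
    proof (rule group.subgroupI)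
      show "group (add_monoid (free_algebra G :: ('g,'k) free_alg ring))"
        using abelian_group.a_group[OF ring.is_abelian_group[OF ring_free]] .
      show "?J \<noteq> {}" using z by auto
    next
      fix x assume x: "x \<in> ?J"
      have "inv\<^bsub>add_monoid (free_algebra G)\<^esub> x = - x"
        using x inv[of x] by (simp add: a_inv_def)
      moreover have "scal (-1) * x = - x" by (simp add: scal_def single_uminus[of 0 1])
      ultimately show "inv\<^bsub>add_monoid (free_algebra G)\<^esub> x \<in> ?J"
        using x l[of "scal (-1)" x] by auto
    qed (auto simp: a free_add)
  qed (use l m in \<open>auto simp: free_mult\<close>)
  moreover have "R \<subseteq> ?J" using R r by auto
  ultimately have "rel_ideal G R \<subseteq> ?J"
    unfolding rel_ideal_def by (intro ring.genideal_minimal[OF ring_free]) auto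
  then show ?thesis using p by auto
qed

definition req :: "'g set \<Rightarrow> ('g, 'k::field) free_alg set \<Rightarrow> ('g, 'k) free_alg \<Rightarrow> ('g, 'k) free_alg \<Rightarrow> bool" where
  "req G R p q \<longleftrightarrow> p - q \<in> rel_ideal G R"

context
  fixes G :: "'g set" and R :: "('g, 'k::field) free_alg set"
  assumes R: "R \<subseteq> carrier (free_algebra G)"
begin

lemma rel_ideal_uminus: "x \<in> rel_ideal G R \<Longrightarrow> - x \<in> rel_ideal G R"
  using ideal_mult[OF R, of x "scal (-1)"] by (auto simp: scal_def single_uminus[of 0 1])

lemma req_refl: "req G R p p"
  by (simp add: req_def ideal_0[OF R])

lemma req_sym: "req G R p q \<Longrightarrow> req G R q p"
  unfolding req_def using rel_ideal_uminus[of "p - q"] by simp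

lemma req_trans: "req G R p q \<Longrightarrow> req G R q r \<Longrightarrow> req G R p r"
  unfolding req_def using ideal_add[OF R, of "p - q" "q - r"] by simp

lemma req_add: "req G R p q \<Longrightarrow> req G R p' q' \<Longrightarrow> req G R (p + p') (q + q')"
  unfolding req_def using ideal_add[OF R, of "p - q" "p' - q'"] by (simp add: algebra_simps)

lemma req_uminus: "req G R p q \<Longrightarrow> req G R (- p) (- q)"
  unfolding req_def using rel_ideal_uminus[of "p - q"] by simp

lemma req_diff: "req G R p q \<Longrightarrow> req G R p' q' \<Longrightarrow> req G R (p - p') (q - q')"
  using req_add[OF _ req_uminus, of p q p' q'] by simp

lemma req_left: "req G R p q \<Longrightarrow> a \<in> carrier (free_algebra G) \<Longrightarrow> req G R (a * p) (a * q)"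
  unfolding req_def using ideal_mult[OF R, of "p - q" a] by (simp add: algebra_simps)

lemma req_right: "req G R p q \<Longrightarrow> a \<in> carrier (free_algebra G) \<Longrightarrow> req G R (p * a) (q * a)"
  unfolding req_def using ideal_mult[OF R, of "p - q" a] by (simp add: algebra_simps)

lemma req_rel: "p - q \<in> R \<Longrightarrow> req G R p q"
  unfolding req_def using ideal_rels[OF R] by blast

lemma req_sum: "(\<And>x. x \<in> A \<Longrightarrow> req G R (f x) (g x)) \<Longrightarrow> req G R (sum f A) (sum g A)"
  by (induction A rule: infinite_finite_induct) (simp_all add: req_refl req_add)

end

section \<open>Representing the exterior algebra by cochains\<close>

lemma poly_mapping_keys_induct:
  assumes "P 0" "\<And>w. w \<in> Poly_Mapping.keys p \<Longrightarrow> P (Poly_Mapping.single w (Poly_Mapping.lookup p w))"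
    and "\<And>p q. P p \<Longrightarrow> P q \<Longrightarrow> P (p + q)"
  shows "P (p :: 'a \<Rightarrow>\<^sub>0 'b::comm_monoid_add)"
proof -
  have "P (\<Sum>w\<in>A. Poly_Mapping.single w (Poly_Mapping.lookup p w))" if "finite A" "A \<subseteq> Poly_Mapping.keys p" for A
    using that by (induction A) (simp_all add: assms)
  from this[of "Poly_Mapping.keys p"] show ?thesis by (simp flip: poly_mapping_expand)
qed

lemma polynomial_space_simps [simp]:
  "carrier (polynomial_space :: ('k::field, 'k poly) module) = UNIV"
  "v \<oplus>\<^bsub>polynomial_space\<^esub> w = v + w" "c \<odot>\<^bsub>polynomial_space\<^esub> v = Polynomial.smult c v"
  by (simp_all add: polynomial_space_def ring.extend_def module.fields_def ring_of_type_algebra_def)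

lemma free_UNIV [simp]: "p \<in> carrier (free_algebra UNIV)"
  by (simp add: free_carrier)

abbreviation ext_rels :: "('k::field poly, 'k) free_alg set" where
  "ext_rels \<equiv> exterior_rels (polynomial_space :: ('k, 'k poly) module)"

abbreviation ext_eq :: "('k::field poly, 'k) free_alg \<Rightarrow> ('k poly, 'k) free_alg \<Rightarrow> bool" (infix \<open>\<approx>\<close> 50) where
  "p \<approx> q \<equiv> req UNIV ext_rels p q"

abbreviation ext_ideal :: "('k::field poly, 'k) free_alg set" where
  "ext_ideal \<equiv> rel_ideal UNIV ext_rels"

lemma ext_rels_carrier: "ext_rels \<subseteq> carrier (free_algebra UNIV)"
  by (rule subsetI) (rule free_UNIV)

lemmas ext_refl = req_refl[OF ext_rels_carrier] and ext_sym = req_sym[OF ext_rels_carrier]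
  and ext_trans = req_trans[OF ext_rels_carrier] and ext_add = req_add[OF ext_rels_carrier]
  and ext_diff = req_diff[OF ext_rels_carrier] and ext_left = req_left[OF ext_rels_carrier _ free_UNIV]
  and ext_right = req_right[OF ext_rels_carrier _ free_UNIV] and ext_sum = req_sum[OF ext_rels_carrier]

lemma ext_rel:
  "gen (v + w) \<approx> gen v + gen w" "gen (Polynomial.smult c v) \<approx> scal c * gen v" "gen v * gen v \<approx> 0"
  by (rule req_rel[OF ext_rels_carrier]; force simp: exterior_rels_def algebra_simps)+

text \<open>Polarization: the square of v + w is zero.\<close>

lemma ext_anticommute: "gen v * gen w \<approx> - (gen w * gen v)"
proof -
  have "gen (v + w) * gen (v + w) \<approx> (gen v + gen w) * (gen v + gen w)"
    by (rule ext_trans[OF ext_left[OF ext_rel(1)] ext_right[OF ext_rel(1)]])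
  then have "(gen v + gen w) * (gen v + gen w) \<approx> 0"
    using ext_rel(3) ext_sym ext_trans by blast
  from ext_diff[OF ext_diff[OF this ext_rel(3)[of v]] ext_rel(3)[of w]]
  show ?thesis by (simp add: req_def algebra_simps)
qed

section \<open>Words of polynomials as cocycles\<close>

text \<open>The cup product of the degree-one cocycles of the letters. The cocycle of v takes
  \<open>{#i#}\<close> to the coefficient of x^i and multisets of any other size to 0, so x^i goes
  to the dual of z_i.\<close>

fun tw :: "'k::field poly list \<Rightarrow> nat multiset list \<Rightarrow> 'k" where
  "tw [] L = (if L = [] then 1 else 0)"
| "tw (v # vs) [] = 0"
| "tw (v # vs) (M # L) = (if size M = 1 then (\<Sum>i\<in>#M. Polynomial.coeff v i) else 0) * tw vs L"

definition theta :: "('k::field poly, 'k) free_alg \<Rightarrow> nat multiset list \<Rightarrow> 'k" where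
  "theta p L = (\<Sum>w\<in>Poly_Mapping.keys p. Poly_Mapping.lookup p w * tw (letters w) L)"

lemma theta_superset:
  assumes "finite A" "Poly_Mapping.keys p \<subseteq> A"
  shows "theta p L = (\<Sum>w\<in>A. Poly_Mapping.lookup p w * tw (letters w) L)"
  unfolding theta_def using assms by (intro sum.mono_neutral_left) (auto simp: in_keys_iff)

lemma theta_add: "theta (p + q) L = theta p L + theta q L"
proof -
  let ?A = "Poly_Mapping.keys p \<union> Poly_Mapping.keys q"
  show ?thesis
    using theta_superset[of ?A p L] theta_superset[of ?A q L] theta_superset[of ?A "p + q" L] Poly_Mapping.keys_add[of p q]
    by (simp add: lookup_add algebra_simps sum.distrib)
qed

lemma theta_single [simp]: "theta (Poly_Mapping.single w c) L = c * tw (letters w) L"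
  by (simp add: theta_def)

lemma theta_0 [simp]: "theta 0 L = 0"
  by (simp add: theta_def)

lemma theta_diff: "theta (p - q) L = theta p L - theta q L"
  using theta_add[of "p - q" q L] by simp

lemma theta_sum: "theta (sum f A) L = (\<Sum>x\<in>A. theta (f x) L)"
  by (induction A rule: infinite_finite_induct) (simp_all add: theta_add)

lemma theta_1: "theta 1 L = (if L = [] then 1 else 0)"
  unfolding single_one[symmetric] theta_single by simp

lemma theta_gen: "theta (gen v) L = tw [v] L"
  by (simp add: gen_def)

lemma tw_length: "tw vs L \<noteq> 0 \<Longrightarrow> length L = length vs"
  by (induction vs L rule: tw.induct) (auto split: if_splits)

lemma tw_append:
  "tw (u @ v) L = (if length u \<le> length L then tw u (take (length u) L) * tw v (drop (length u) L) else 0)"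
  by (induction u L rule: tw.induct) auto

text \<open>Only the cut at \<open>length u\<close> contributes. The sum over all cuts no longer
  mentions this length, so it extends bilinearly to inhomogeneous elements in
  \<open>theta_mult_sum\<close>.\<close>

lemma tw_append_sum: "tw (u @ v) L = (\<Sum>m\<le>length L. tw u (take m L) * tw v (drop m L))"
proof -
  have "(\<Sum>m\<le>length L. tw u (take m L) * tw v (drop m L)) =
      (\<Sum>m\<in>(if length u \<le> length L then {length u} else {}). tw u (take m L) * tw v (drop m L))"
  proof (rule sum.mono_neutral_right)
    have "tw u (take m L) = 0" if "m \<le> length L" "m \<noteq> length u" for m
      using tw_length[of u "take m L"] that by (cases "tw u (take m L) = 0") simp_all
    then show "\<forall>m\<in>{..length L} - (if length u \<le> length L then {length u} else {}). tw u (take m L) * tw v (drop m L) = 0"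
      by auto
  qed auto
  then show ?thesis by (simp add: tw_append)
qed

lemma theta_mult_sum: "theta (p * q) L = (\<Sum>m\<le>length L. theta p (take m L) * theta q (drop m L))"
proof -
  have "theta ((\<Sum>w\<in>A. Poly_Mapping.single w (f w)) * (\<Sum>w\<in>B. Poly_Mapping.single w (g w))) L =
    (\<Sum>m\<le>length L. theta (\<Sum>w\<in>A. Poly_Mapping.single w (f w)) (take m L) *
      theta (\<Sum>w\<in>B. Poly_Mapping.single w (g w)) (drop m L))" for A B f g
  proof -
    have "theta ((\<Sum>w\<in>A. Poly_Mapping.single w (f w)) * (\<Sum>w\<in>B. Poly_Mapping.single w (g w))) L =
      (\<Sum>u\<in>A. \<Sum>w\<in>B. \<Sum>m\<le>length L. f u * tw (letters u) (take m L) * (g w * tw (letters w) (drop m L)))"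
      unfolding sum_product theta_sum mult_single
      by (simp add: tw_append_sum sum_distrib_left mult_ac)
    also have "\<dots> = (\<Sum>m\<le>length L. \<Sum>u\<in>A. \<Sum>w\<in>B. f u * tw (letters u) (take m L) * (g w * tw (letters w) (drop m L)))"
      by (subst sum.swap[of _ A "{..length L}"], rule sum.cong[OF refl], rule sum.swap)
    finally show ?thesis by (simp add: sum_product theta_sum)
  qed
  from this[of "Poly_Mapping.lookup p" "Poly_Mapping.keys p" "Poly_Mapping.lookup q" "Poly_Mapping.keys q"]
  show ?thesis by (simp flip: poly_mapping_expand)
qed

lemma theta_scal: "theta (scal c * p) L = c * theta p L"
proof -
  have "theta (scal c * p) L = (\<Sum>m\<in>{0}. theta (scal c) (take m L) * theta p (drop m L))"
    unfolding theta_mult_sum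
    by (rule sum.mono_neutral_right) (auto simp: scal_def dest!: tw_length)
  then show ?thesis by (simp add: scal_def)
qed

definition homog :: "nat \<Rightarrow> ('g, 'k::zero) free_alg \<Rightarrow> bool" where
  "homog n p \<longleftrightarrow> (\<forall>w\<in>Poly_Mapping.keys p. length (letters w) = n)"

lemma theta_homog: "homog n p \<Longrightarrow> length L \<noteq> n \<Longrightarrow> theta p L = 0"
  unfolding theta_def homog_def by (rule sum.neutral) (metis tw_length mult_zero_right)

lemma theta_mult:
  assumes "homog m p"
  shows "length L = m + n \<Longrightarrow> theta (p * q) L = bar_cup m (theta p) (theta q) L"
proof -
  assume L: "length L = m + n"
  have "theta (p * q) L = (\<Sum>m\<in>{m}. theta p (take m L) * theta q (drop m L))"
    unfolding theta_mult_sum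
    by (rule sum.mono_neutral_right) (auto simp: L theta_homog[OF assms])
  then show ?thesis by (simp add: bar_cup_def)
qed

lemma bar0_tw: "bar0 (tw w) L = 0"
proof (induction w arbitrary: L)
  case Nil
  show ?case
  proof (cases "length L = 1")
    case True
    then show ?thesis by (cases L) auto
  next
    case False
    then have "bar0 (tw []) L = bar0 (\<lambda>_. 0) L" by (cases L) (auto intro!: bar_d_cong)
    then show ?thesis by (simp only: bar_d_zero)
  qed
next
  case (Cons v w)
  have 1: "bar0 (tw [v]) L = 0" for L
  proof (cases "length L = 2")
    case True
    then obtain M N where L: "L = [M, N]" by (metis One_nat_def Suc_1 length_0_conv length_Suc_conv)
    show ?thesis unfolding L by (cases M; cases N) auto
  next
    case False
    then have "bar0 (tw [v]) L = bar0 (\<lambda>_. 0) L"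
    proof (intro bar_d_cong)
      fix K :: "nat multiset list" assume K: "length K = length L - 1"
      show "tw [v] K = 0"
        using False K tw_length[of "[v]" K] by fastforce
    qed
    then show ?thesis by (simp add: bar_d_zero)
  qed
  have "tw (v # w) K = bar_cup 1 (tw [v]) (tw w) K" for K
    by (cases K) (auto simp: bar_cup_def)
  then have "bar0 (tw (v # w)) L = bar0 (bar_cup 1 (tw [v]) (tw w)) L" by presburger
  then show ?case unfolding bar_d_cup by (simp add: bar_cup_def 1 Cons)
qed

lemma bar0_theta: "bar0 (theta p) L = 0"
  unfolding theta_def[abs_def] by (simp add: bar_d_sum bar_d_scale bar0_tw)

text \<open>The primitive takes the pair \<open>{#i, j#}\<close> to the product of two coefficients,
  with the sign of the inner face. No division by 2 occurs, so squares are coboundaries in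
  characteristic 2 as well.\<close>

lemma theta_square: "length L = 2 \<Longrightarrow> theta (gen v * gen v) L =
   bar0 (\<lambda>L. - (if size (hd L) = 2 then (\<Prod>i\<in>#hd L. Polynomial.coeff v i) else 0)) L"
proof -
  assume "length L = 2"
  then obtain M N where L: "L = [M, N]" by (metis One_nat_def Suc_1 length_0_conv length_Suc_conv)
  have tw: "theta (gen v * gen v) [M, N] = tw [v, v] [M, N]"
    by (simp add: gen_def mult_single)
  consider "M = {#}" | "N = {#}" | "size M = 1" "size N = 1"
    | "M \<noteq> {#}" "N \<noteq> {#}" "size M \<noteq> 1 \<or> size N \<noteq> 1" by blast
  then show ?thesis
  proof cases
    case 3
    then obtain i j where "M = {#i#}" "N = {#j#}" by (metis size_1_singleton_mset)
    then show ?thesis unfolding L tw by simp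
  next
    case 4
    then have "size M \<ge> 1" "size N \<ge> 1" by (auto simp: Suc_le_eq nonempty_has_size)
    then have "size M + size N \<noteq> 2" using 4(3) by auto
    then show ?thesis unfolding L tw using 4 by auto
  qed (unfold L tw, auto)
qed

text \<open>Elements of the ideal may be inhomogeneous, so the induction provides a primitive in
  every length at once, and \<open>G\<close> may depend on the length.\<close>

lemma theta_ext_ideal:
  assumes "p \<in> ext_ideal"
  shows "\<exists>G. \<forall>L. length L = n \<longrightarrow> theta p L = bar0 G L"
  using ext_rels_carrier assms
proof (induction arbitrary: n rule: rel_ideal_induct)
  case zero
  show ?case by (intro exI[of _ "\<lambda>_. 0"]) (simp add: bar_d_zero)
next
  case (rel r)
  have lin: "(\<Sum>i\<in>#M. Polynomial.coeff (v + w) i) = (\<Sum>i\<in>#M. Polynomial.coeff v i) + (\<Sum>i\<in>#M. Polynomial.coeff w i)"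
    "(\<Sum>i\<in>#M. Polynomial.coeff (Polynomial.smult c v) i) = c * (\<Sum>i\<in>#M. Polynomial.coeff v i)" for v w c and M :: "nat multiset"
    by (induction M) (simp_all add: algebra_simps)
  have 1: "tw [v + w] L = tw [v] L + tw [w] L" "tw [Polynomial.smult c v] L = c * tw [v] L" for v w c L
    by (cases L, simp, simp add: lin algebra_simps)+
  from rel consider v w where "r = gen (v + w) - gen v - gen w" | c v where "r = gen (Polynomial.smult c v) - scal c * gen v"
    | v where "r = gen v * gen v"
    by (auto simp: exterior_rels_def)
  then show ?case
  proof cases
    case 3
    show ?thesis
    proof (cases "n = 2")
      case True
      then show ?thesis using theta_square[of _ v] 3 by blast
    next
      case False
      have "homog 2 r" by (simp add: 3 homog_def gen_def mult_single)
      then have "theta r L = bar0 (\<lambda>_. 0) L" if "length L = n" for L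
        using theta_homog[of 2 r L] that False by (simp add: bar_d_zero)
      then show ?thesis by blast
    qed
  qed (rule exI[of _ "\<lambda>_. 0"]; simp add: theta_diff theta_gen theta_scal 1 bar_d_zero)+
next
  case (add x y)
  obtain G G' where "\<forall>L. length L = n \<longrightarrow> theta x L = bar0 G L" "\<forall>L. length L = n \<longrightarrow> theta y L = bar0 G' L"
    using add by metis
  then show ?case by (intro exI[of _ "\<lambda>K. G K + G' K"]) (simp add: theta_add bar_d_add)
next
  case (left x y)
  then obtain G where G: "\<And>m L. length L = m \<Longrightarrow> theta y L = bar0 (G m) L" by metis
  show ?case
  proof (intro exI allI impI)
    fix L :: "nat multiset list" assume L: "length L = n"
    \<comment> \<open>As \<open>theta x\<close> is a cocycle, the Leibniz rule leaves only its
      second summand, whose sign is cancelled by (-1)^m.\<close>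
    have "bar0 (\<lambda>K. \<Sum>m\<le>n. (- 1) ^ m * bar_cup m (theta x) (G (n - m)) K) L =
        (\<Sum>m\<le>n. (- 1) ^ m * bar0 (bar_cup m (theta x) (G (n - m))) L)"
      by (simp add: bar_d_sum bar_d_scale)
    also have "\<dots> = (\<Sum>m\<le>n. theta x (take m L) * theta y (drop m L))"
      unfolding bar_d_cup
      by (intro sum.cong refl) (auto simp: bar_cup_def bar0_theta G L mult.assoc[symmetric] simp flip: power_mult_distrib)
    finally show "theta (x * y) L = bar0 (\<lambda>K. \<Sum>m\<le>n. (- 1) ^ m * bar_cup m (theta x) (G (n - m)) K) L"
      by (simp add: theta_mult_sum L)
  qed
next
  case (right x y)
  then obtain G where G: "\<And>m L. length L = m \<Longrightarrow> theta x L = bar0 (G m) L" by metis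
  show ?case
  proof (intro exI allI impI)
    fix L :: "nat multiset list" assume L: "length L = n"
    \<comment> \<open>The cut at 0 is absent: the value of \<open>theta x\<close> at
      \<open>[]\<close> is that of a differential, hence 0.\<close>
    have "bar0 (\<lambda>K. \<Sum>m<n. bar_cup m (G (Suc m)) (theta y) K) L =
        (\<Sum>m<n. bar0 (bar_cup m (G (Suc m)) (theta y)) L)"
      by (simp add: bar_d_sum)
    also have "\<dots> = (\<Sum>m<n. theta x (take (Suc m) L) * theta y (drop (Suc m) L))"
      unfolding bar_d_cup
      using L by (intro sum.cong refl) (simp add: bar_cup_def bar0_theta G[of _ "Suc _"])
    also have "\<dots> = (\<Sum>m\<le>n. theta x (take m L) * theta y (drop m L))"
      using G[of "[]" 0] unfolding lessThan_Suc_atMost[symmetric] sum.lessThan_Suc_shift by simp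
    finally show "theta (x * y) L = bar0 (\<lambda>K. \<Sum>m<n. bar_cup m (G (Suc m)) (theta y) K) L"
      by (simp add: theta_mult_sum L)
  qed
qed

section \<open>Sorted words of monomials span the exterior powers\<close>

abbreviation word :: "nat list \<Rightarrow> ('k::field poly) fmon" where
  "word l \<equiv> FMon (map (\<lambda>i. monom 1 i) l)"

lemma tw_word: "tw (map (\<lambda>i. monom 1 i) l) L = (if L = map (\<lambda>i. {#i#}) l then 1 else 0 :: 'k::field)"
proof (induction l arbitrary: L)
  case (Cons i l)
  show ?case
  proof (cases L)
    case (Cons M L')
    have "(if size M = 1 then (\<Sum>j\<in>#M. Polynomial.coeff (monom (1 :: 'k) i) j) else 0) = (if M = {#i#} then 1 else 0)"
    proof (cases "size M = 1")
      case True
      then obtain j where "M = {#j#}" by (metis size_1_singleton_mset)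
      then show ?thesis by auto
    qed auto
    then show ?thesis using Cons Cons.IH[of L'] by auto
  qed simp
qed simp

definition sorted_comb :: "nat \<Rightarrow> ('k::field poly, 'k) free_alg \<Rightarrow> bool" where
  "sorted_comb n q \<longleftrightarrow> (\<forall>w\<in>Poly_Mapping.keys q. \<exists>S. finite S \<and> card S = n \<and> w = word (sorted_list_of_set S))"

lemma sorted_comb_add: "sorted_comb n p \<Longrightarrow> sorted_comb n q \<Longrightarrow> sorted_comb n (p + q)"
  using Poly_Mapping.keys_add[of p q] unfolding sorted_comb_def by blast

lemma sorted_comb_sum: "(\<And>x. x \<in> A \<Longrightarrow> sorted_comb n (f x)) \<Longrightarrow> sorted_comb n (sum f A)"
  by (induction A rule: infinite_finite_induct) (auto simp: sorted_comb_add, auto simp: sorted_comb_def)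

lemma scal_single: "scal c * Poly_Mapping.single w a = Poly_Mapping.single w (c * a)"
  by (simp add: scal_def mult_single)

lemma sorted_comb_scal:
  assumes "sorted_comb n p"
  shows "sorted_comb n (scal c * p)"
proof -
  have "Poly_Mapping.keys (scal c * p) \<subseteq> Poly_Mapping.keys p"
    using Poly_Mapping.keys_mult[of "scal c" p] by (auto simp: scal_def split: if_splits)
  then show ?thesis using assms unfolding sorted_comb_def by blast
qed

text \<open>Insertion of a letter with one sign per exchange. If i already occurs, the product is 0,
  and the alternative \<open>c = 0\<close> spares a description of \<open>l'\<close>.\<close>

lemma gen_times_sorted_word:
  "sorted_wrt (<) l \<Longrightarrow> \<exists>c l'. (c = 0 \<or> sorted_wrt (<) l' \<and> set l' = insert i (set l) \<and> length l' = Suc (length l)) \<and>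
    gen (monom 1 i) * Poly_Mapping.single (word l) 1 \<approx> Poly_Mapping.single (word l') (c :: 'k::field)"
proof (induction l)
  case Nil
  have "gen (monom (1 :: 'k) i) * Poly_Mapping.single (word []) 1 = Poly_Mapping.single (word [i]) (1 :: 'k)"
    unfolding single_Cons list.map ..
  then show ?case by (intro exI[of _ 1] exI[of _ "[i]"]) (simp add: ext_refl del: list.map)
next
  case (Cons j l)
  have W: "Poly_Mapping.single (word (j # l)) 1 = gen (monom (1 :: 'k) j) * Poly_Mapping.single (word l) (1 :: 'k)" for j l
    by (simp add: single_Cons)
  consider "i = j" | "i < j" | "j < i" by linarith
  then show ?case
  proof cases
    case 1
    have "gen (monom 1 i) * Poly_Mapping.single (word (j # l)) (1 :: 'k) \<approx> 0"
      using ext_right[OF ext_rel(3)[of "monom 1 i"]] unfolding W 1 by (simp add: mult.assoc)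
    then show ?thesis by (intro exI[of _ 0]) simp
  next
    case 2
    have "gen (monom 1 i) * Poly_Mapping.single (word (j # l)) (1 :: 'k) \<approx> Poly_Mapping.single (word (i # j # l)) 1"
      unfolding W[of i] by (rule ext_refl)
    then show ?thesis using Cons.prems 2
      by (intro exI[of _ 1] exI[of _ "i # j # l"]) auto
  next
    case 3
    obtain c l' where c: "c = 0 \<or> sorted_wrt (<) l' \<and> set l' = insert i (set l) \<and> length l' = Suc (length l)"
      and eq: "gen (monom 1 i) * Poly_Mapping.single (word l) (1 :: 'k) \<approx> Poly_Mapping.single (word l') c"
      using Cons by auto
    let ?i = "gen (monom 1 i) :: ('k poly, 'k) free_alg" and ?j = "gen (monom 1 j) :: ('k poly, 'k) free_alg"
    have "?i * Poly_Mapping.single (word (j # l)) 1 \<approx> - (?j * (?i * Poly_Mapping.single (word l) 1))"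
      using ext_right[OF ext_anticommute] unfolding W by (simp add: mult.assoc[symmetric])
    also have "\<dots> = scal (- 1) * ?j * (?i * Poly_Mapping.single (word l) 1)"
      by (simp add: scal_def single_uminus[of 0 1])
    finally have "?i * Poly_Mapping.single (word (j # l)) 1 \<approx> scal (- 1) * ?j * Poly_Mapping.single (word l') c"
      using ext_left[OF eq] ext_trans by blast
    also have "scal (- 1) * ?j * Poly_Mapping.single (word l') c = Poly_Mapping.single (word (j # l')) (- c)"
      by (simp add: mult.assoc scal_single flip: single_Cons)
    finally show ?thesis using c Cons.prems 3
      by (intro exI[of _ "- c"] exI[of _ "j # l'"]) auto
  qed
qed

lemma sorted_comb_gen_monom:
  assumes "sorted_comb n q"
  shows "\<exists>q'. sorted_comb (Suc n) q' \<and> gen (monom 1 i) * q \<approx> q'"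
proof (rule poly_mapping_keys_induct[where P = "\<lambda>q. \<exists>q'. sorted_comb (Suc n) q' \<and> gen (monom 1 i) * q \<approx> q'"])
  show "\<exists>q'. sorted_comb (Suc n) q' \<and> gen (monom 1 i) * 0 \<approx> q'"
    by (intro exI[of _ 0]) (simp add: sorted_comb_def ext_refl)
next
  fix w assume w: "w \<in> Poly_Mapping.keys q"
  obtain S where S: "finite S" "card S = n" "w = word (sorted_list_of_set S)"
    using assms w unfolding sorted_comb_def by blast
  obtain c l' where c: "c = 0 \<or> sorted_wrt (<) l' \<and> set l' = insert i S \<and> length l' = Suc n"
    and eq: "gen (monom 1 i) * Poly_Mapping.single w (1 :: 'a) \<approx> Poly_Mapping.single (word l') c"
    using gen_times_sorted_word[of "sorted_list_of_set S" i, where ?'k = 'a] S by auto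
  let ?d = "Poly_Mapping.lookup q w"
  have "sorted_comb (Suc n) (Poly_Mapping.single (word l') c)"
  proof (cases "c = 0")
    case False
    then have l': "sorted_wrt (<) l'" "set l' = insert i S" "length l' = Suc n" using c by auto
    then have d: "distinct l'" using strict_sorted_iff by blast
    have "sorted_list_of_set (set l') = l'"
      using l'(1) d strict_sorted_iff by (intro sorted_list_of_set.idem_if_sorted_distinct) auto
    then show ?thesis using l' d distinct_card[OF d] unfolding sorted_comb_def
      using S(1) by (intro ballI exI[of _ "set l'"]) (auto split: if_splits)
  qed (simp add: sorted_comb_def)
  then have "sorted_comb (Suc n) (scal ?d * Poly_Mapping.single (word l') c)" by (rule sorted_comb_scal)
  moreover have "gen (monom 1 i) * Poly_Mapping.single w ?d = scal ?d * (gen (monom 1 i) * Poly_Mapping.single w 1)"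
    by (simp add: scal_def gen_def mult_single)
  ultimately show "\<exists>q'. sorted_comb (Suc n) q' \<and> gen (monom 1 i) * Poly_Mapping.single w ?d \<approx> q'"
    using ext_left[OF eq, of "scal ?d"] by metis
next
  fix p q :: "('a poly, 'a) free_alg"
  assume "\<exists>q'. sorted_comb (Suc n) q' \<and> gen (monom 1 i) * p \<approx> q'" "\<exists>q'. sorted_comb (Suc n) q' \<and> gen (monom 1 i) * q \<approx> q'"
  then show "\<exists>q'. sorted_comb (Suc n) q' \<and> gen (monom 1 i) * (p + q) \<approx> q'"
    unfolding distrib_left using sorted_comb_add ext_add by blast
qed

text \<open>\<open>gen 0\<close> is a symbol of the free algebra and differs from its zero; the
  relation for the scalar 0 identifies the two.\<close>

lemma gen_0: "gen (0 :: 'k::field poly) \<approx> 0"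
  using ext_rel(2)[of 0 0] by simp

lemma gen_expand: "gen v \<approx> (\<Sum>i\<le>degree v. scal (Polynomial.coeff v i) * gen (monom 1 i))"
proof -
  have "gen (\<Sum>i\<in>A. Polynomial.smult (c i) (monom 1 i)) \<approx> (\<Sum>i\<in>A. scal (c i) * gen (monom 1 i))"
    if "finite A" for A and c :: "nat \<Rightarrow> 'a"
    using that
  proof (induction A)
    case (insert i A)
    then have "gen (\<Sum>i\<in>insert i A. Polynomial.smult (c i) (monom 1 i)) =
       gen (Polynomial.smult (c i) (monom 1 i) + (\<Sum>i\<in>A. Polynomial.smult (c i) (monom 1 i)))" by simp
    also have "\<dots> \<approx> gen (Polynomial.smult (c i) (monom 1 i)) + gen (\<Sum>i\<in>A. Polynomial.smult (c i) (monom 1 i))"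
      by (rule ext_rel)
    finally have "gen (\<Sum>i\<in>insert i A. Polynomial.smult (c i) (monom 1 i)) \<approx> gen (Polynomial.smult (c i) (monom 1 i)) + gen (\<Sum>i\<in>A. Polynomial.smult (c i) (monom 1 i))" .
    moreover have "\<dots> \<approx> scal (c i) * gen (monom 1 i) + (\<Sum>i\<in>A. scal (c i) * gen (monom 1 i))"
      by (rule ext_add[OF ext_rel(2) insert(3)])
    ultimately show ?case using insert ext_trans by simp blast
  qed (simp add: gen_0)
  from this[of "{..degree v}" "Polynomial.coeff v"] show ?thesis
    by (simp add: smult_monom poly_as_sum_of_monoms)
qed

lemma sorted_comb_gen:
  assumes "sorted_comb n q"
  shows "\<exists>q'. sorted_comb (Suc n) q' \<and> gen v * q \<approx> q'"
proof -
  obtain h where h: "\<And>i. sorted_comb (Suc n) (h i) \<and> gen (monom 1 i) * q \<approx> h i"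
    using sorted_comb_gen_monom[OF assms] by metis
  have "gen v * q \<approx> (\<Sum>i\<le>degree v. scal (Polynomial.coeff v i) * gen (monom 1 i)) * q"
    by (rule ext_right[OF gen_expand])
  moreover have "\<dots> \<approx> (\<Sum>i\<le>degree v. scal (Polynomial.coeff v i) * h i)"
    unfolding sum_distrib_right mult.assoc using h by (intro ext_sum ext_left) auto
  ultimately show ?thesis using h
    by (intro exI[of _ "\<Sum>i\<le>degree v. scal (Polynomial.coeff v i) * h i"])
      (auto intro: ext_trans sorted_comb_sum sorted_comb_scal)
qed

lemma homog_normal_form:
  assumes "homog n p"
  shows "\<exists>q. sorted_comb n q \<and> p \<approx> q"
proof -
  have word: "\<exists>q. sorted_comb (length vs) q \<and> Poly_Mapping.single (FMon vs) c \<approx> q" for vs and c :: 'a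
  proof (induction vs)
    case Nil
    have "sorted_comb 0 (Poly_Mapping.single (FMon []) c)"
      unfolding sorted_comb_def by (intro ballI exI[of _ "{}"]) (auto split: if_splits)
    then show ?case using ext_refl by auto
  next
    case (Cons v vs)
    then obtain q where q: "sorted_comb (length vs) q" "Poly_Mapping.single (FMon vs) c \<approx> q" by blast
    obtain q' where "sorted_comb (Suc (length vs)) q'" "gen v * q \<approx> q'" using sorted_comb_gen[OF q(1)] by blast
    then show ?case using ext_trans[OF ext_left[OF q(2)]] unfolding single_Cons by auto
  qed
  show ?thesis
  proof (rule poly_mapping_keys_induct[where P = "\<lambda>p. \<exists>q. sorted_comb n q \<and> p \<approx> q"])
    show "\<exists>q. sorted_comb n q \<and> 0 \<approx> q"
      by (intro exI[of _ 0]) (simp add: sorted_comb_def ext_refl)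
    show "\<exists>q. sorted_comb n q \<and> Poly_Mapping.single w (Poly_Mapping.lookup p w) \<approx> q"
      if "w \<in> Poly_Mapping.keys p" for w
      using word[of "letters w" "Poly_Mapping.lookup p w"] assms that by (auto simp: homog_def)
  qed (use sorted_comb_add ext_add in blast)
qed

section \<open>Injectivity and surjectivity of \<open>theta\<close> on cohomology\<close>

lemma inj_word: "word (sorted_list_of_set S) = (word (sorted_list_of_set S') :: ('k::field poly) fmon) \<Longrightarrow>
    finite S \<Longrightarrow> finite S' \<Longrightarrow> S = S'"
proof -
  assume a: "word (sorted_list_of_set S) = (word (sorted_list_of_set S') :: ('k poly) fmon)" and f: "finite S" "finite S'"
  have "inj (\<lambda>i. monom (1 :: 'k) i)" by (auto simp: inj_def monom_eq_iff')
  then have "sorted_list_of_set S = sorted_list_of_set S'" using a by (simp add: inj_map_eq_map)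
  then show ?thesis using f by (metis set_sorted_list_of_set)
qed

text \<open>Modulo the ideal, \<open>p\<close> is a combination of sorted words. These go to the
  cochains \<open>std S\<close>, which are independent modulo coboundaries, so all coefficients
  vanish.\<close>

theorem exact_theta_ext_ideal:
  assumes p: "homog n p" and G: "\<And>L. length L = n \<Longrightarrow> theta p L = bar0 G L"
  shows "p \<in> ext_ideal"
proof -
  obtain q where q: "sorted_comb n q" "p \<approx> q" using homog_normal_form[OF p] by blast
  obtain G' where G': "\<And>L. length L = n \<Longrightarrow> theta (p - q) L = bar0 G' L"
    using theta_ext_ideal[of "p - q" n] q(2) by (auto simp: req_def)
  define A where "A = {S. finite S \<and> card S = n \<and> word (sorted_list_of_set S) \<in> Poly_Mapping.keys q}"
  have inj: "inj_on (\<lambda>S. word (sorted_list_of_set S) :: ('a poly) fmon) A"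
    by (rule inj_onI, rule inj_word) (auto simp: A_def)
  have keys: "Poly_Mapping.keys q = (\<lambda>S. word (sorted_list_of_set S)) ` A"
    using q(1) by (auto simp: sorted_comb_def A_def)
  have A: "finite A" using finite_imageD[OF _ inj] keys by (metis finite_keys)
  let ?c = "\<lambda>S. Poly_Mapping.lookup q (word (sorted_list_of_set S))"
  have "(\<Sum>S\<in>A. ?c S * std S L) = bar0 (\<lambda>K. G K - G' K) L" if L: "length L = n" for L
  proof -
    have "theta q L = (\<Sum>S\<in>A. ?c S * tw (letters (word (sorted_list_of_set S))) L)"
      unfolding theta_def keys by (subst sum.reindex[OF inj]) simp
    also have "\<dots> = (\<Sum>S\<in>A. ?c S * std S L)"
      by (simp add: tw_word std_def)
    finally show ?thesis using G[OF L] G'[OF L] by (simp add: theta_diff bar_d_diff algebra_simps)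
  qed
  from std_independent[OF A _ this] have "?c S = 0" if "S \<in> A" for S
    using that by (auto simp: A_def)
  then have "A = {}" by (auto simp: A_def in_keys_iff)
  then have "q = 0" using keys by simp
  then show ?thesis using q(2) by (simp add: req_def)
qed

text \<open>\<open>std S\<close> is the image of the sorted word with the letters x^i for i in
  \<open>S\<close>.\<close>

theorem cocycle_theta:
  fixes F :: "nat multiset list \<Rightarrow> 'k::field"
  assumes fin: "lfin n F" and cocycle: "\<And>L. length L = Suc n \<Longrightarrow> bar0 F L = 0"
  shows "\<exists>p G. homog n p \<and> lfin (n - 1) G \<and> (\<forall>L. length L = n \<longrightarrow> F L = theta p L + bar0 G L)"
proof -
  obtain G c A where A: "finite A" "\<And>S. S \<in> A \<Longrightarrow> finite S \<and> card S = n" and G: "lfin (n - 1) G"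
    and F: "\<And>L. length L = n \<Longrightarrow> F L = bar0 G L + (\<Sum>S\<in>A. c S * std S L)"
    by (rule cocycle_decomposition[OF fin cocycle]) auto
  let ?p = "\<Sum>S\<in>A. Poly_Mapping.single (word (sorted_list_of_set S)) (c S)"
  have "homog n ?p"
    unfolding homog_def
  proof
    fix w assume "w \<in> Poly_Mapping.keys ?p"
    then obtain S where "S \<in> A" "w \<in> Poly_Mapping.keys (Poly_Mapping.single (word (sorted_list_of_set S)) (c S))"
      using Poly_Mapping.keys_sum[of "\<lambda>S. Poly_Mapping.single (word (sorted_list_of_set S)) (c S)" A] by blast
    then show "length (letters w) = n" using A(2)[of S] by (auto split: if_splits)
  qed
  moreover have "theta ?p L = (\<Sum>S\<in>A. c S * std S L)" for L
    by (simp add: theta_sum tw_word std_def)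
  ultimately show ?thesis using F G by (intro exI[of _ ?p] exI[of _ G]) simp
qed

text \<open>Where a word does not vanish, every exponent is the index of a nonzero coefficient of a
  letter and so is bounded by a degree.\<close>

lemma lfin_theta: "lfin n (theta p)"
proof -
  have single: "lfin n (tw vs)" for vs :: "'a poly list"
    unfolding lfin_def
  proof (intro allI exI impI ballI)
    fix L i assume "tw vs L \<noteq> 0" "i \<in># sum_list L"
    then have "\<exists>v\<in>set vs. i \<le> degree v"
    proof (induction vs L rule: tw.induct)
      case (3 v vs M L)
      then have "size M = 1" by (auto split: if_splits)
      then obtain j where "M = {#j#}" by (metis size_1_singleton_mset)
      then show ?case using 3 by (auto intro: le_degree)
    qed (auto split: if_splits)
    then show "i \<le> (\<Sum>v\<leftarrow>vs. degree v)"
    proof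
      fix v assume "v \<in> set vs" "i \<le> degree v"
      then show ?thesis using member_le_sum_list[of "degree v" "map degree vs"] by force
    qed
  qed
  have "lfin n (\<lambda>L. \<Sum>w\<in>A. Poly_Mapping.lookup p w * tw (letters w) L)" if "finite A" for A
    using that by (induction A) (auto intro!: lfin_zero lfin_add lfin_scale single)
  then show ?thesis unfolding theta_def[abs_def] by simp
qed

section \<open>Polynomials and divided differences\<close>

lemma poly_mapping_add_induct [case_names single add]:
  assumes "\<And>w c. P (Poly_Mapping.single w c)" "\<And>p q. P p \<Longrightarrow> P q \<Longrightarrow> P (p + q)"
  shows "P (p :: 'a \<Rightarrow>\<^sub>0 'b::comm_monoid_add)"
proof (rule poly_mapping_keys_induct[where P = P])
  show "P 0" using assms(1)[of undefined 0] by simp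
qed (simp_all add: assms)

definition lift_pm :: "('a \<Rightarrow> 'b::comm_monoid_add \<Rightarrow> 'c::comm_monoid_add) \<Rightarrow> ('a \<Rightarrow>\<^sub>0 'b) \<Rightarrow> 'c" where
  "lift_pm h u = (\<Sum>w\<in>Poly_Mapping.keys u. h w (Poly_Mapping.lookup u w))"

lemma lift_pm_single: "h w 0 = 0 \<Longrightarrow> lift_pm h (Poly_Mapping.single w c) = h w c"
  by (simp add: lift_pm_def)

lemma lift_pm_0 [simp]: "lift_pm h 0 = 0"
  by (simp add: lift_pm_def)

lemma lift_pm_add:
  assumes "\<And>w. h w 0 = 0" "\<And>w f g. h w (f + g) = h w f + h w g"
  shows "lift_pm h (u + v) = lift_pm h u + lift_pm h v"
proof -
  let ?A = "Poly_Mapping.keys u \<union> Poly_Mapping.keys v"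
  have "lift_pm h p = (\<Sum>w\<in>?A. h w (Poly_Mapping.lookup p w))" if "Poly_Mapping.keys p \<subseteq> ?A" for p
    unfolding lift_pm_def using that assms(1) by (intro sum.mono_neutral_left) (auto simp: in_keys_iff)
  from this[of u] this[of v] this[of "u + v"] show ?thesis
    using Poly_Mapping.keys_add[of u v] by (simp add: lookup_add assms(2) sum.distrib)
qed

text \<open>A multiset is a monomial here: its elements are indices of variables, their
  multiplicities the exponents. In the bar complex, by contrast, the elements of a multiset are
  exponents.\<close>

type_synonym 'k ypoly = "nat multiset \<Rightarrow>\<^sub>0 'k"

abbreviation yv :: "nat \<Rightarrow> 'k::field ypoly" where
  "yv j \<equiv> Poly_Mapping.single {#j#} 1"

abbreviation cst :: "'k::field \<Rightarrow> 'k ypoly" where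
  "cst c \<equiv> Poly_Mapping.single {#} c"

abbreviation sw :: "nat \<Rightarrow> nat \<Rightarrow> nat" where
  "sw i \<equiv> Transposition.transpose i (Suc i)"

lemma single_add_mset: "Poly_Mapping.single (add_mset j M) c = yv j * Poly_Mapping.single M c"
  by (simp add: mult_single)

lemma cst_1: "cst 1 = 1"
  by (metis single_one zero_multiset_def)

lemma ypoly_induct [case_names cst var add]:
  assumes "\<And>c. P (cst c)" "\<And>j f. P f \<Longrightarrow> P (yv j * f)" "\<And>f g. P f \<Longrightarrow> P g \<Longrightarrow> P (f + g)"
  shows "P (f :: 'k::field ypoly)"
proof (induction f rule: poly_mapping_add_induct)
  case (single M c)
  show ?case
  proof (induction M)
    case (add j M)
    show ?case unfolding single_add_mset[of j M] by (rule assms(2)[OF add])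
  qed (rule assms(1))
qed (rule assms)

lemma yv_diff_nonzero: "i \<noteq> j \<Longrightarrow> yv i - yv j \<noteq> (0 :: 'k::field ypoly)"
proof
  assume ij: "i \<noteq> j" and "yv i - yv j = (0 :: 'k ypoly)"
  then have "Poly_Mapping.lookup (yv i :: 'k ypoly) {#i#} = Poly_Mapping.lookup (yv j) {#i#}" by simp
  then show False using ij by (simp add: lookup_single)
qed

lemma sw_sw [simp]: "image_mset (sw i) (image_mset (sw i) M) = M"
  by (simp add: image_mset.compositionality)

lemma inj_image_sw: "inj (image_mset (sw i))"
  by (rule inj_on_inverseI[of _ "image_mset (sw i)"]) simp

definition swp :: "nat \<Rightarrow> 'k::field ypoly \<Rightarrow> 'k ypoly" where
  "swp i p = Poly_Mapping.map_key (image_mset (sw i)) p"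

lemma lookup_swp: "Poly_Mapping.lookup (swp i p) M = Poly_Mapping.lookup p (image_mset (sw i) M)"
  by (simp add: swp_def map_key.rep_eq inj_image_sw)

lemma swp_single [simp]: "swp i (Poly_Mapping.single M c) = Poly_Mapping.single (image_mset (sw i) M) c"
proof (rule poly_mapping_eqI)
  fix K
  have "M = image_mset (sw i) K \<longleftrightarrow> image_mset (sw i) M = K" by auto
  then show "Poly_Mapping.lookup (swp i (Poly_Mapping.single M c)) K = Poly_Mapping.lookup (Poly_Mapping.single (image_mset (sw i) M) c) K"
    by (simp add: lookup_swp lookup_single when_def)
qed

lemma swp_add: "swp i (p + q) = swp i p + swp i q"
  by (rule poly_mapping_eqI) (simp add: lookup_swp lookup_add)

lemma swp_0 [simp]: "swp i 0 = 0"
  by (rule poly_mapping_eqI) (simp add: lookup_swp)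

lemma swp_var: "swp i (yv j * f) = yv (sw i j) * swp i f"
  by (induction f rule: poly_mapping_add_induct) (simp_all add: mult_single swp_add distrib_left)

definition vars_upto :: "nat \<Rightarrow> 'k::field ypoly set" where
  "vars_upto N = {f. \<forall>M\<in>Poly_Mapping.keys f. set_mset M \<subseteq> {1..N}}"

lemma vars_upto_add: "f \<in> vars_upto N \<Longrightarrow> g \<in> vars_upto N \<Longrightarrow> f + g \<in> vars_upto N"
  using Poly_Mapping.keys_add[of f g] unfolding vars_upto_def by blast

lemma vars_upto_uminus: "f \<in> vars_upto N \<Longrightarrow> - f \<in> vars_upto N"
  unfolding vars_upto_def by simp

lemma vars_upto_0 [simp]: "0 \<in> vars_upto N"
  by (simp add: vars_upto_def)

lemma vars_upto_mult: "f \<in> vars_upto N \<Longrightarrow> g \<in> vars_upto N \<Longrightarrow> f * g \<in> vars_upto N"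
  using Poly_Mapping.keys_mult[of f g] unfolding vars_upto_def by fastforce

lemma vars_upto_cst [simp]: "cst c \<in> vars_upto N"
  by (simp add: vars_upto_def)

lemma vars_upto_yv [simp]: "j \<in> {1..N} \<Longrightarrow> yv j \<in> vars_upto N"
  by (simp add: vars_upto_def)

lemma vars_upto_single: "set_mset M \<subseteq> {1..N} \<Longrightarrow> Poly_Mapping.single M c \<in> vars_upto N"
  by (simp add: vars_upto_def)

lemma vars_upto_single_induct [consumes 1, case_names single add]:
  assumes f: "f \<in> vars_upto N"
    and single: "\<And>M c. set_mset M \<subseteq> {1..N} \<Longrightarrow> P (Poly_Mapping.single M c)"
    and add: "\<And>f g. f \<in> vars_upto N \<Longrightarrow> g \<in> vars_upto N \<Longrightarrow> P f \<Longrightarrow> P g \<Longrightarrow> P (f + g)"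
  shows "P f"
proof -
  have "f \<in> vars_upto N \<and> P f"
  proof (rule poly_mapping_keys_induct[where P = "\<lambda>f. f \<in> vars_upto N \<and> P f"])
    show "0 \<in> vars_upto N \<and> P 0" using single[of "{#}" 0] by simp
    fix M assume "M \<in> Poly_Mapping.keys f"
    then have "set_mset M \<subseteq> {1..N}" using f by (auto simp: vars_upto_def)
    then show "Poly_Mapping.single M (Poly_Mapping.lookup f M) \<in> vars_upto N \<and> P (Poly_Mapping.single M (Poly_Mapping.lookup f M))"
      by (simp only: single vars_upto_single)
  qed (use add vars_upto_add in blast)
  then show ?thesis by blast
qed

lemma vars_upto_induct [consumes 1, case_names cst var add]:
  assumes f: "f \<in> vars_upto N" and "\<And>c. P (cst c)"
    and "\<And>j f. j \<in> {1..N} \<Longrightarrow> f \<in> vars_upto N \<Longrightarrow> P f \<Longrightarrow> P (yv j * f)"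
    and "\<And>f g. f \<in> vars_upto N \<Longrightarrow> g \<in> vars_upto N \<Longrightarrow> P f \<Longrightarrow> P g \<Longrightarrow> P (f + g)"
  shows "P f"
  using f
proof (induction f rule: vars_upto_single_induct)
  case (single M c)
  then show ?case
  proof (induction M)
    case (add j M)
    then show ?case unfolding single_add_mset[of j M] by (intro assms(3) vars_upto_single) auto
  qed (simp add: assms(2))
qed (rule assms(4))

lemma sw_range: "1 \<le> i \<Longrightarrow> i < N \<Longrightarrow> j \<in> {1..N} \<Longrightarrow> sw i j \<in> {1..N}"
  by (auto simp: transpose_def)

lemma vars_upto_swp: "f \<in> vars_upto N \<Longrightarrow> 1 \<le> i \<Longrightarrow> i < N \<Longrightarrow> swp i f \<in> vars_upto N"
  by (induction f rule: vars_upto_induct)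
    (auto simp: swp_var swp_add intro!: vars_upto_add vars_upto_mult vars_upto_yv sw_range simp del: atLeastAtMost_iff)

section \<open>Divided differences\<close>

text \<open>The divided difference of y_j, which is also the correction that arises when t_i is
  moved past y_j.\<close>

abbreviation esgn :: "nat \<Rightarrow> nat \<Rightarrow> 'a::ring_1" where
  "esgn i j \<equiv> (if j = i then 1 else if j = Suc i then - 1 else 0)"

lemma yv_sw: "yv j - yv (sw i j) = esgn i j * (yv i - yv (Suc i))"
  by (auto simp: transpose_def)

definition dvd_diff :: "nat \<Rightarrow> 'k::field ypoly \<Rightarrow> 'k ypoly" where
  "dvd_diff i f = (SOME d. (yv i - yv (Suc i)) * d = f - swp i f)"

text \<open>Divisibility holds for constants, is additive, and passes from f to y_j f by a Leibniz
  rule twisted by s_i.\<close>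

lemma dvd_diff: "(yv i - yv (Suc i)) * dvd_diff i f = f - swp i f"
proof -
  have "\<exists>d. (yv i - yv (Suc i)) * d = f - swp i f"
  proof (induction f rule: ypoly_induct)
    case (cst c)
    show ?case by (rule exI[of _ 0]) simp
  next
    case (var j f)
    then obtain d where d: "(yv i - yv (Suc i)) * d = f - swp i f" by blast
    have "yv j * f - swp i (yv j * f) = yv (sw i j) * (f - swp i f) + (yv j - yv (sw i j)) * f"
      unfolding swp_var by (simp add: algebra_simps)
    also have "\<dots> = (yv i - yv (Suc i)) * (yv (sw i j) * d + esgn i j * f)"
      unfolding yv_sw d[symmetric] by (simp only: distrib_left mult_ac)
    finally show ?case by metis
  next
    case (add f g)
    then obtain d e where "(yv i - yv (Suc i)) * d = f - swp i f" "(yv i - yv (Suc i)) * e = g - swp i g" by blast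
    then have "(yv i - yv (Suc i)) * (d + e) = f + g - swp i (f + g)"
      unfolding distrib_left swp_add by (simp only: add_diff_add)
    then show ?case by blast
  qed
  then show ?thesis unfolding dvd_diff_def by (rule someI_ex)
qed

lemma dvd_diff_unique: "(yv i - yv (Suc i)) * d = f - swp i f \<Longrightarrow> dvd_diff i f = d"
  using dvd_diff[of i f] yv_diff_nonzero[of i "Suc i"] by (metis mult_left_cancel n_not_Suc_n)

lemma dvd_diff_0 [simp]: "dvd_diff i 0 = 0"
  by (rule dvd_diff_unique) simp

lemma dvd_diff_add: "dvd_diff i (f + g) = dvd_diff i f + dvd_diff i g"
  by (rule dvd_diff_unique) (simp add: distrib_left dvd_diff swp_add)

lemma dvd_diff_cst [simp]: "dvd_diff i (cst c) = 0"
  by (rule dvd_diff_unique) simp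

lemma dvd_diff_var: "dvd_diff i (yv j * f) = yv (sw i j) * dvd_diff i f + esgn i j * f"
proof (rule dvd_diff_unique)
  have "(yv i - yv (Suc i)) * (yv (sw i j) * dvd_diff i f + esgn i j * f) =
      yv (sw i j) * (f - swp i f) + (yv j - yv (sw i j)) * f"
    unfolding yv_sw dvd_diff[symmetric] by (simp only: distrib_left mult_ac)
  also have "\<dots> = yv j * f - swp i (yv j * f)"
    unfolding swp_var by (simp add: algebra_simps)
  finally show "(yv i - yv (Suc i)) * (yv (sw i j) * dvd_diff i f + esgn i j * f) = yv j * f - swp i (yv j * f)" .
qed

lemma vars_upto_dvd_diff: "f \<in> vars_upto N \<Longrightarrow> 1 \<le> i \<Longrightarrow> i < N \<Longrightarrow> dvd_diff i f \<in> vars_upto N"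
proof (induction f rule: vars_upto_induct)
  case (var j f)
  have "esgn i j * f \<in> vars_upto N" using var(2) by (auto simp: vars_upto_uminus)
  have "sw i j \<in> {1..N}" by (rule sw_range) (use var in auto)
  then have "yv (sw i j) * dvd_diff i f \<in> vars_upto N" using var by (intro vars_upto_mult vars_upto_yv)
  then show ?case unfolding dvd_diff_var using \<open>esgn i j * f \<in> vars_upto N\<close> by (rule vars_upto_add)
qed (simp_all add: dvd_diff_add vars_upto_add)

lemma dvd_diff_eq_0: "swp i f = f \<Longrightarrow> dvd_diff i f = 0"
  by (rule dvd_diff_unique) simp

section \<open>The regular representation of the degenerate affine Hecke algebra\<close>

text \<open>The element \<open>Poly_Mapping.single w f\<close> stands for the product of the polynomial \<open>f\<close> in the
  \<open>y\<^sub>j\<close> and the group element \<open>w\<close>.\<close>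

type_synonym 'k hmod = "(nat \<Rightarrow> nat) \<Rightarrow>\<^sub>0 'k ypoly"

definition psm :: "'k::field ypoly \<Rightarrow> 'k hmod \<Rightarrow> 'k hmod" where
  "psm f = lift_pm (\<lambda>w g. Poly_Mapping.single w (f * g))"

text \<open>Left multiplication of f w by t_i, once t_i has been moved past f by the rule t_i f =
  s_i(f) t_i + \<partial>_i(f) with the divided difference \<partial>_i.\<close>

definition tm :: "nat \<Rightarrow> 'k::field hmod \<Rightarrow> 'k hmod" where
  "tm i = lift_pm (\<lambda>w g. Poly_Mapping.single (sw i \<circ> w) (swp i g) + Poly_Mapping.single w (dvd_diff i g))"

lemma psm_single [simp]: "psm f (Poly_Mapping.single w g) = Poly_Mapping.single w (f * g)"
  by (simp add: psm_def lift_pm_single)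

lemma psm_add: "psm f (u + v) = psm f u + psm f v"
  unfolding psm_def by (rule lift_pm_add) (simp_all add: distrib_left single_add)

lemma psm_psm: "psm f (psm g u) = psm (f * g) u"
  by (induction u rule: poly_mapping_add_induct) (simp_all add: psm_add mult_ac)

lemma psm_1 [simp]: "psm 1 u = u"
  by (induction u rule: poly_mapping_add_induct) (simp_all add: psm_add)

lemma psm_add_left: "psm (f + g) u = psm f u + psm g u"
  by (induction u rule: poly_mapping_add_induct) (simp_all add: psm_add distrib_right single_add)

lemma psm_0_left [simp]: "psm 0 u = 0"
  by (induction u rule: poly_mapping_add_induct) (simp_all add: psm_add)

lemma psm_uminus_left: "psm (- f) u = - psm f u"
  using psm_add_left[of f "- f" u] by (simp add: eq_neg_iff_add_eq_0 add.commute)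

lemma lookup_psm: "Poly_Mapping.lookup (psm f u) w = f * Poly_Mapping.lookup u w"
  by (induction u rule: poly_mapping_add_induct)
    (simp_all add: psm_add lookup_add distrib_left lookup_single when_def)

lemma tm_single [simp]: "tm i (Poly_Mapping.single w g) =
    Poly_Mapping.single (sw i \<circ> w) (swp i g) + Poly_Mapping.single w (dvd_diff i g)"
  by (simp add: tm_def lift_pm_single)

lemma tm_add: "tm i (u + v) = tm i u + tm i v"
  unfolding tm_def by (rule lift_pm_add) (simp_all add: swp_add dvd_diff_add single_add algebra_simps)

lemma tm_0 [simp]: "tm i 0 = 0"
  by (simp add: tm_def)

lemma tm_uminus: "tm i (- u) = - tm i u"
  using tm_add[of i u "- u"] by (simp add: eq_neg_iff_add_eq_0 add.commute)

lemma tm_esgn: "tm i (psm (esgn a b) u) = psm (esgn a b) (tm i u)"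
  by (auto simp: tm_uminus psm_uminus_left)

lemma tm_var: "tm i (psm (yv j) u) = psm (yv (sw i j)) (tm i u) + psm (esgn i j) u"
proof (induction u rule: poly_mapping_add_induct)
  case (single w g)
  show ?case
    by (simp only: psm_single tm_single psm_add swp_var dvd_diff_var single_add add.assoc)
qed (simp add: psm_add tm_add algebra_simps)

lemma tm_cst: "tm i (psm (cst c) u) = psm (cst c) (tm i u)"
proof (induction u rule: poly_mapping_add_induct)
  case (single w g)
  have "swp i (cst c * g) = cst c * swp i g"
    by (induction g rule: poly_mapping_add_induct) (simp_all add: mult_single swp_add distrib_left)
  moreover from this have "dvd_diff i (cst c * g) = cst c * dvd_diff i g"
    by (intro dvd_diff_unique) (simp add: mult.left_commute[of _ "cst c"] dvd_diff right_diff_distrib)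
  ultimately show ?case by (simp add: psm_add)
qed (simp_all add: psm_add tm_add)

lemma tm_const_basis: "tm i (Poly_Mapping.single w (cst c)) = Poly_Mapping.single (sw i \<circ> w) (cst c)"
  by simp

text \<open>An additive operator that commutes with the \<open>y\<^sub>j\<close> up to a permutation of the variables is
  determined by its values on constants. This yields the relations between the operators \<open>tm i\<close>
  without computing with divided differences.\<close>

lemma hmod_operator_zero:
  assumes add: "\<And>u v. B (u + v) = B u + B v"
    and var: "\<And>j u. B u = 0 \<Longrightarrow> B (psm (yv j) u) = 0"
    and const: "\<And>w c. B (Poly_Mapping.single w (cst c)) = 0"
  shows "B u = (0 :: 'k::field hmod)"
proof (induction u rule: poly_mapping_add_induct)
  case (single w g)
  show ?case
  proof (induction g rule: ypoly_induct)
    case (var j g)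
    then show ?case using assms(2)[OF var, of j] by simp
  qed (simp_all add: const single_add add)
qed (simp add: add)

lemma sw_comp [simp]: "sw i \<circ> (sw i \<circ> w) = w"
  by (simp add: o_assoc)

lemma tm_tm: "tm i (tm i u) = u"
proof -
  have "tm i (tm i u) - u = 0"
  proof (rule hmod_operator_zero[where B = "\<lambda>u. tm i (tm i u) - u"])
    fix j u assume "tm i (tm i u) - u = (0 :: 'a hmod)"
    then have u: "tm i (tm i u) = u" by simp
    \<comment> \<open>s_i exchanges i and i + 1, so the two correction terms have opposite
      signs.\<close>
    have "psm (esgn i (sw i j)) (tm i u) + psm (esgn i j) (tm i u) = 0"
      by (auto simp: transpose_def psm_uminus_left)
    then show "tm i (tm i (psm (yv j) u)) - psm (yv j) u = 0"
      by (simp only: tm_var tm_add tm_esgn u) (simp add: algebra_simps)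
  qed (simp_all add: tm_add algebra_simps)
  then show ?thesis by simp
qed

lemma sw_commute: "\<bar>int i - int j\<bar> > 1 \<Longrightarrow> sw i (sw j k) = sw j (sw i k)"
  by (auto simp: transpose_def)

lemma tm_commute:
  assumes "\<bar>int i - int j\<bar> > 1"
  shows "tm i (tm j u) = tm j (tm i u)"
proof -
  have "tm i (tm j u) - tm j (tm i u) = 0"
  proof (rule hmod_operator_zero[where B = "\<lambda>u. tm i (tm j u) - tm j (tm i u)"])
    fix k u assume "tm i (tm j u) - tm j (tm i u) = (0 :: 'a hmod)"
    then have u: "tm i (tm j u) = tm j (tm i u)" by simp
    have e: "psm (esgn i (sw j k)) v = psm (esgn i k) v" "psm (esgn j (sw i k)) v = psm (esgn j k) v" for v :: "'a hmod"
      using assms by (auto simp: transpose_def)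
    show "tm i (tm j (psm (yv k) u)) - tm j (tm i (psm (yv k) u)) = 0"
      unfolding tm_var tm_add tm_esgn u e sw_commute[OF assms] by simp
  next
    fix w :: "nat \<Rightarrow> nat" and c :: 'a
    have "sw i \<circ> (sw j \<circ> w) = sw j \<circ> (sw i \<circ> w)" using sw_commute[OF assms] by (simp add: fun_eq_iff)
    then show "tm i (tm j (Poly_Mapping.single w (cst c))) - tm j (tm i (Poly_Mapping.single w (cst c))) = 0"
      by simp
  qed (simp_all add: tm_add algebra_simps)
  then show ?thesis by simp
qed

lemma sw_braid: "sw i (sw (Suc i) (sw i k)) = sw (Suc i) (sw i (sw (Suc i) k))"
  by (auto simp: transpose_def)

lemma tm_braid: "tm i (tm (Suc i) (tm i u)) = tm (Suc i) (tm i (tm (Suc i) u))"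
proof -
  let ?j = "Suc i"
  have "tm i (tm ?j (tm i u)) - tm ?j (tm i (tm ?j u)) = 0"
  proof (rule hmod_operator_zero[where B = "\<lambda>u. tm i (tm ?j (tm i u)) - tm ?j (tm i (tm ?j u))"])
    fix k u assume "tm i (tm ?j (tm i u)) - tm ?j (tm i (tm ?j u)) = (0 :: 'a hmod)"
    then have u: "tm i (tm ?j (tm i u)) = tm ?j (tm i (tm ?j u))" by simp
    \<comment> \<open>Each side has three correction terms: on t_i t_j u, on t_j t_i u and, because
      t_i and t_j are involutions, on u. These identities match them.\<close>
    have e: "psm (esgn i (sw ?j (sw i k))) v = psm (esgn ?j k) v" "psm (esgn ?j (sw i (sw ?j k))) v = psm (esgn i k) v"
      "psm (esgn ?j (sw i k)) v = psm (esgn i (sw ?j k)) v" for v :: "'a hmod"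
      by (auto simp: transpose_def)
    show "tm i (tm ?j (tm i (psm (yv k) u))) - tm ?j (tm i (tm ?j (psm (yv k) u))) = 0"
      unfolding tm_var tm_add tm_esgn tm_tm u e sw_braid by simp
  next
    fix w :: "nat \<Rightarrow> nat" and c :: 'a
    have "sw i \<circ> (sw ?j \<circ> (sw i \<circ> w)) = sw ?j \<circ> (sw i \<circ> (sw ?j \<circ> w))" using sw_braid[of i] by (simp add: fun_eq_iff)
    then show "tm i (tm ?j (tm i (Poly_Mapping.single w (cst c)))) - tm ?j (tm i (tm ?j (Poly_Mapping.single w (cst c)))) = 0"
      by simp
  qed (simp_all add: tm_add algebra_simps)
  then show ?thesis by simp
qed

section \<open>The action of the free algebra and its relations\<close>

fun actg :: "hecke_gen \<Rightarrow> 'k::field hmod \<Rightarrow> 'k hmod" where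
  "actg (T i) u = tm i u"
| "actg (Y j) u = psm (yv j) u"

definition actw :: "hecke_gen list \<Rightarrow> 'k::field hmod \<Rightarrow> 'k hmod" where
  "actw l u = foldr actg l u"

definition act :: "(hecke_gen, 'k::field) free_alg \<Rightarrow> 'k hmod \<Rightarrow> 'k hmod" where
  "act p u = lift_pm (\<lambda>x c. psm (cst c) (actw (letters x) u)) p"

lemma actg_add: "actg g (u + v) = actg g u + actg g v"
  by (cases g) (simp_all add: tm_add psm_add)

lemma actg_cst: "actg g (psm (cst c) u) = psm (cst c) (actg g u)"
  by (cases g) (simp_all only: actg.simps tm_cst psm_psm mult.commute)

lemma actw_add: "actw l (u + v) = actw l u + actw l v"
  by (induction l) (simp_all add: actw_def actg_add)

lemma actw_cst: "actw l (psm (cst c) u) = psm (cst c) (actw l u)"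
  by (induction l) (simp_all only: actw_def actg_cst foldr.simps o_apply id_apply)

lemma act_single [simp]: "act (Poly_Mapping.single x c) u = psm (cst c) (actw (letters x) u)"
  by (simp add: act_def lift_pm_single)

lemma act_add: "act (p + q) u = act p u + act q u"
  unfolding act_def by (rule lift_pm_add) (simp_all add: single_add psm_add_left)

lemma act_0 [simp]: "act 0 u = 0"
  by (simp add: act_def)

lemma act_diff: "act (p - q) u = act p u - act q u"
  using act_add[of "p - q" q u] by simp

lemma act_add_right: "act p (u + v) = act p u + act p v"
  by (induction p rule: poly_mapping_add_induct) (simp_all add: act_add actw_add psm_add)

lemma act_0_right [simp]: "act p 0 = 0"
  using act_add_right[of p 0 0] by simp

lemma act_mult: "act (p * q) u = act p (act q u)"
proof (induction p rule: poly_mapping_add_induct)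
  case (single x c)
  show ?case
  proof (induction q rule: poly_mapping_add_induct)
    case (single y d)
    show ?case
      by (simp add: mult_single actw_def actw_cst[unfolded actw_def] psm_psm mult_single)
  qed (simp_all only: distrib_left act_add act_add_right)
qed (simp_all only: distrib_right act_add)

lemma act_gen [simp]: "act (gen g) u = actg g u"
  by (simp add: gen_def actw_def cst_1)

lemma act_1 [simp]: "act 1 u = u"
  unfolding single_one[symmetric] act_single by (simp add: actw_def cst_1)

lemma act_scal [simp]: "act (scal c) u = psm (cst c) u"
  by (simp add: scal_def actw_def)

text \<open>Hence \<Lambda>_n acts, and elements of the free algebra with different actions are not
  congruent. All independence statements about \<Lambda>_n rest on this.\<close>

theorem act_HI:
  assumes "p \<in> HI n"
  shows "act p u = 0"
  using hecke_rels_carrier assms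
proof (induction arbitrary: u rule: rel_ideal_induct)
  case (rel r)
  have y: "psm (yv i) (tm i u) - tm i (psm (yv (Suc i)) u) - u = 0" for i
    by (simp add: tm_var psm_uminus_left)
  from rel show ?case
    unfolding hecke_rels_def
    by (auto simp: act_diff act_mult tm_tm tm_braid tm_var psm_psm psm_uminus_left mult.commute transpose_def y
        intro: tm_commute)
qed (simp_all add: act_add act_mult)

section \<open>Normal forms and centralizers in the degenerate affine Hecke algebra\<close>

abbreviation heq :: "nat \<Rightarrow> (hecke_gen, 'k::field) free_alg \<Rightarrow> (hecke_gen, 'k) free_alg \<Rightarrow> bool" where
  "heq n \<equiv> req (hecke_gens n) (hecke_rels n)"

lemmas heq_refl = req_refl[OF hecke_rels_carrier] and heq_sym = req_sym[OF hecke_rels_carrier]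
  and heq_trans [trans] = req_trans[OF hecke_rels_carrier] and heq_add = req_add[OF hecke_rels_carrier]
  and heq_diff = req_diff[OF hecke_rels_carrier] and heq_left = req_left[OF hecke_rels_carrier]
  and heq_right = req_right[OF hecke_rels_carrier] and heq_rel = req_rel[OF hecke_rels_carrier]

lemma heq_act: "heq n p q \<Longrightarrow> act p u = act q u"
  using act_HI[of "p - q" n u] by (simp add: req_def act_diff)

section \<open>Words in the t_i and permutations\<close>

definition tword :: "nat list \<Rightarrow> (hecke_gen, 'k::field) free_alg" where
  "tword l = Poly_Mapping.single (FMon (map T l)) 1"

lemma tword_Nil [simp]: "tword [] = 1"
  unfolding tword_def by (metis list.simps(8) single_one zero_fmon_def)

lemma tword_Cons: "tword (i # l) = tt i * tword l"
  by (simp add: tword_def single_Cons)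

lemma tword_append: "tword (l @ l') = tword l * tword l'"
  by (induction l) (simp_all add: tword_Cons mult.assoc)

lemma tt_HF: "1 \<le> i \<Longrightarrow> i < n \<Longrightarrow> tt i \<in> HF n" and yy_HF: "1 \<le> i \<Longrightarrow> i \<le> n \<Longrightarrow> yy i \<in> HF n"
  by (simp_all add: free_gen)

lemma tword_HF: "set l \<subseteq> {1..<n} \<Longrightarrow> tword l \<in> HF n"
  by (induction l) (auto simp: tword_Cons intro!: free_mult tt_HF)

definition perm_of :: "nat list \<Rightarrow> nat \<Rightarrow> nat" where
  "perm_of l = foldr (\<lambda>i w. sw i \<circ> w) l id"

lemma perm_of_simps [simp]: "perm_of [] = id" "perm_of (i # l) = sw i \<circ> perm_of l"
  by (simp_all add: perm_of_def)

lemma perm_of_append: "perm_of (l @ l') = perm_of l \<circ> perm_of l'"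
  by (induction l) (simp_all add: o_assoc)

lemma inj_perm_of: "inj (perm_of l)"
proof (induction l)
  case (Cons i l)
  have "inj (sw i)" by (rule inj_on_inverseI[of _ "sw i"]) simp
  then show ?case unfolding perm_of_simps by (rule inj_compose[OF _ Cons])
qed simp

lemma act_tword_cst: "act (tword l) (Poly_Mapping.single w (cst c)) = Poly_Mapping.single (perm_of l \<circ> w) (cst c)"
  by (induction l) (simp_all add: tword_Cons act_mult comp_def)

lemma act_tword_1: "act (tword l) (Poly_Mapping.single w 1) = Poly_Mapping.single (perm_of l \<circ> w) 1"
  using act_tword_cst[of l w 1] by (simp add: cst_1)

lemma weq_perm_of: "heq n (tword l :: (hecke_gen, 'k::field) free_alg) (tword l') \<Longrightarrow> perm_of l = perm_of l'"
proof -
  assume "heq n (tword l :: (hecke_gen, 'k) free_alg) (tword l')"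
  from heq_act[OF this, of "Poly_Mapping.single id 1"]
  have "Poly_Mapping.lookup (Poly_Mapping.single (perm_of l) (1 :: 'k ypoly)) (perm_of l) =
      Poly_Mapping.lookup (Poly_Mapping.single (perm_of l') 1) (perm_of l)"
    by (simp add: act_tword_1)
  then show ?thesis by (simp add: lookup_single when_def split: if_splits)
qed

lemma weq_prepend:
  assumes "heq n (tword l :: (hecke_gen, 'k::field) free_alg) (tword l')" "set r \<subseteq> {1..<n}"
  shows "heq n (tword (r @ l) :: (hecke_gen, 'k) free_alg) (tword (r @ l'))"
  unfolding tword_append by (rule heq_left[OF assms(1) tword_HF[OF assms(2)]])

lemma weq_square:
  assumes "1 \<le> i" "i < n" "set l \<subseteq> {1..<n}"
  shows "heq n (tword (i # i # l)) (tword l)"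
proof -
  have "heq n (tt i * tt i) 1" by (rule heq_rel) (use assms in \<open>auto simp: hecke_rels_def\<close>)
  from heq_right[OF this tword_HF[OF assms(3)]] show ?thesis by (simp add: tword_Cons mult.assoc)
qed

lemma weq_commute:
  assumes "1 \<le> i" "i < n" "1 \<le> j" "j < n" "\<bar>int i - int j\<bar> > 1" "set l \<subseteq> {1..<n}"
  shows "heq n (tword (i # j # l)) (tword (j # i # l))"
proof -
  have "heq n (tt i * tt j) (tt j * tt i)" by (rule heq_rel, rule hecke_relI) (use assms in auto)
  from heq_right[OF this tword_HF[OF assms(6)]] show ?thesis by (simp add: tword_Cons mult.assoc)
qed

lemma weq_braid:
  assumes "1 \<le> i" "Suc i < n" "set l \<subseteq> {1..<n}"
  shows "heq n (tword (Suc i # i # Suc i # l)) (tword (i # Suc i # i # l))"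
proof -
  have "heq n (tt i * tt (Suc i) * tt i) (tt (Suc i) * tt i * tt (Suc i))"
    by (rule heq_rel) (use assms in \<open>auto simp: hecke_rels_def\<close>)
  from heq_sym[OF heq_right[OF this tword_HF[OF assms(3)]]] show ?thesis by (simp add: tword_Cons mult.assoc)
qed

lemma weq_commute_past:
  assumes "1 \<le> i" "i < n" "set l \<subseteq> {1..<n}" "set r \<subseteq> {1..<n}" "\<forall>x\<in>set r. \<bar>int i - int x\<bar> > 1"
  shows "heq n (tword (i # r @ l) :: (hecke_gen, 'k::field) free_alg) (tword (r @ i # l))"
  using assms(4,5)
proof (induction r)
  case (Cons x r)
  have "heq n (tword (i # x # r @ l) :: (hecke_gen, 'k) free_alg) (tword (x # i # r @ l))"
    using Cons.prems assms(1-3) by (intro weq_commute) auto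
  also have "tword (x # i # r @ l) = (tword ([x] @ i # r @ l) :: (hecke_gen, 'k) free_alg)" by simp
  also have "heq n (tword ([x] @ i # r @ l) :: (hecke_gen, 'k) free_alg) (tword ([x] @ r @ i # l))"
    by (rule weq_prepend) (use Cons in auto)
  finally show ?case by simp
qed (simp add: heq_refl)

text \<open>The runs t_j ... t_k represent the cosets of S_k in S_{k+1}, with j = k + 1 for the
  empty run. A new letter i in front of a run cancels (i = j), prolongs it (i = j - 1), commutes
  past it (i < j - 1), or comes out on the other side as i - 1 (i > j).\<close>

lemma weq_run:
  assumes "k < n" "set l \<subseteq> {1..k}"
  shows "\<exists>j u. 1 \<le> j \<and> j \<le> Suc k \<and> set u \<subseteq> {1..<k} \<and>
    heq n (tword l :: (hecke_gen, 'k::field) free_alg) (tword ([j..<Suc k] @ u))"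
  using assms(2)
proof (induction l)
  case Nil
  show ?case by (intro exI[of _ "Suc k"] exI[of _ "[]"]) (simp add: heq_refl)
next
  case (Cons i l)
  then obtain j u where j: "1 \<le> j" "j \<le> Suc k" and u: "set u \<subseteq> {1..<k}"
    and eq: "heq n (tword l :: (hecke_gen, 'k) free_alg) (tword ([j..<Suc k] @ u))" by auto
  have i: "1 \<le> i" "i \<le> k" using Cons.prems by auto
  have in_range: "i < n" using i assms by simp
  have run: "set [a..<b] \<subseteq> {1..<n}" if "1 \<le> a" "b \<le> Suc k" for a b using that assms(1) by auto
  have un: "set u \<subseteq> {1..<n}" using u assms(1) by fastforce
  have "heq n (tword ([i] @ l) :: (hecke_gen, 'k) free_alg) (tword ([i] @ [j..<Suc k] @ u))"
    by (rule weq_prepend[OF eq]) (use i in_range in auto)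
  then have eq': "heq n (tword (i # l) :: (hecke_gen, 'k) free_alg) (tword (i # [j..<Suc k] @ u))" by simp
  consider "i = j" | "Suc i = j" | "Suc i < j" | "j < i" by linarith
  then show ?case
  proof cases
    case 1
    have "heq n (tword (i # i # [Suc i..<Suc k] @ u) :: (hecke_gen, 'k) free_alg) (tword ([Suc i..<Suc k] @ u))"
      by (rule weq_square) (use i in_range un run[of "Suc i" "Suc k"] in auto)
    then show ?thesis using heq_trans[OF eq'] 1 i u upt_conv_Cons[of i "Suc k"]
      by (intro exI[of _ "Suc i"] exI[of _ u]) (simp del: upt_Suc)
  next
    case 2
    then show ?thesis using eq' i u upt_conv_Cons[of i "Suc k"]
      by (intro exI[of _ i] exI[of _ u]) (simp del: upt_Suc)
  next
    case 3
    have "heq n (tword (i # [j..<Suc k] @ u) :: (hecke_gen, 'k) free_alg) (tword ([j..<Suc k] @ i # u))"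
      by (rule weq_commute_past) (use i in_range un run[of j "Suc k"] j 3 in auto)
    then show ?thesis using heq_trans[OF eq'] j u i 3
      by (intro exI[of _ j] exI[of _ "i # u"]) auto
  next
    case 4
    \<comment> \<open>With a = i - 1: t_i commutes past t_j ... t_{a-1}, the braid relation turns
      t_i t_a t_i into t_a t_i t_a, and the last t_a commutes past the rest of the run.\<close>
    then obtain a where a: "i = Suc a" "j \<le> a" by (cases i) auto
    let ?r = "[j..<a]" and ?s = "[Suc i..<Suc k]"
    have split: "[j..<Suc k] = ?r @ a # i # ?s"
    proof -
      have "[j..<Suc k] = [j..<a] @ [a..<Suc k]"
        using upt_add_eq_append[of j a "Suc k - a"] a i by simp
      also have "[a..<Suc k] = a # i # ?s"
        using a i by (simp add: upt_conv_Cons del: upt_Suc)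
      finally show ?thesis .
    qed
    have s: "set ?s \<subseteq> {1..<n}" by (rule run) auto
    have r: "set ?r \<subseteq> {1..<n}" using run[of j a] a i j by auto
    have "heq n (tword (i # ?r @ (a # i # ?s @ u)) :: (hecke_gen, 'k) free_alg) (tword (?r @ i # (a # i # ?s @ u)))"
      by (rule weq_commute_past) (use i in_range un s r a j in auto)
    also have "heq n (tword (?r @ i # (a # i # ?s @ u)) :: (hecke_gen, 'k) free_alg) (tword (?r @ a # i # a # ?s @ u))"
      unfolding a(1) by (rule weq_prepend[OF weq_braid]) (use i in_range un s r a j in auto)
    also have "tword (?r @ a # i # a # ?s @ u) = (tword ((?r @ [a, i]) @ a # ?s @ u) :: (hecke_gen, 'k) free_alg)" by simp
    also have "heq n (tword ((?r @ [a, i]) @ a # ?s @ u) :: (hecke_gen, 'k) free_alg) (tword ((?r @ [a, i]) @ ?s @ a # u))"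
      by (rule weq_prepend[OF weq_commute_past]) (use i in_range un s r a j in auto)
    finally have "heq n (tword (i # [j..<Suc k] @ u) :: (hecke_gen, 'k) free_alg) (tword ([j..<Suc k] @ a # u))"
      unfolding split by simp
    then show ?thesis using heq_trans[OF eq'] j u i a
      by (intro exI[of _ j] exI[of _ "a # u"]) auto
  qed
qed

lemma perm_of_fix: "\<forall>i\<in>set l. m \<noteq> i \<and> m \<noteq> Suc i \<Longrightarrow> perm_of l m = m"
  by (induction l) (auto simp: transpose_def)

lemma perm_of_run: "j \<le> Suc k \<Longrightarrow> perm_of [j..<Suc k] (Suc k) = j"
proof (induction "Suc k - j" arbitrary: j)
  case (Suc d)
  then have j: "j \<le> k" by auto
  then have "perm_of [Suc j..<Suc k] (Suc k) = Suc j" using Suc by auto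
  then show ?case using j upt_conv_Cons[of j "Suc k"] by (simp del: upt_Suc)
qed (use le_antisym in auto)

text \<open>The run in the form of \<open>weq_run\<close> is determined by the image of the last
  point, which the remaining word fixes; the remaining words are compared by induction. This is the
  completeness of the Coxeter relations for the symmetric group, obtained inside
  \<Lambda>_n.\<close>

theorem weq_complete:
  assumes "k < n" "set l \<subseteq> {1..k}" "set l' \<subseteq> {1..k}" "perm_of l = perm_of l'"
  shows "heq n (tword l :: (hecke_gen, 'k::field) free_alg) (tword l')"
  using assms
proof (induction k arbitrary: l l')
  case 0
  then show ?case by (simp add: heq_refl)
next
  case (Suc k)
  obtain j u where u: "1 \<le> j" "j \<le> Suc (Suc k)" "set u \<subseteq> {1..<Suc k}"
    "heq n (tword l :: (hecke_gen, 'k) free_alg) (tword ([j..<Suc (Suc k)] @ u))"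
    using weq_run[OF Suc.prems(1,2)] by blast
  obtain j' u' where u': "1 \<le> j'" "j' \<le> Suc (Suc k)" "set u' \<subseteq> {1..<Suc k}"
    "heq n (tword l' :: (hecke_gen, 'k) free_alg) (tword ([j'..<Suc (Suc k)] @ u'))"
    using weq_run[OF Suc.prems(1,3)] by blast
  have perm: "perm_of ([j..<Suc (Suc k)] @ u) = perm_of ([j'..<Suc (Suc k)] @ u')"
    using weq_perm_of[OF u(4)] weq_perm_of[OF u'(4)] Suc.prems(4) by simp
  have fixed: "perm_of u (Suc (Suc k)) = Suc (Suc k)" "perm_of u' (Suc (Suc k)) = Suc (Suc k)"
    by (rule perm_of_fix; use u(3) u'(3) in fastforce)+
  have jj: "j = j'"
    using fun_cong[OF perm, of "Suc (Suc k)"] fixed perm_of_run u(2) u'(2) by (simp add: perm_of_append del: upt_Suc)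
  then have "perm_of u = perm_of u'"
    using perm inj_perm_of[of "[j..<Suc (Suc k)]"]
    by (auto simp: perm_of_append fun_eq_iff simp del: upt_Suc dest: injD)
  then have "heq n (tword u :: (hecke_gen, 'k) free_alg) (tword u')"
    using Suc.prems(1) u(3) u'(3) by (intro Suc.IH) auto
  then have "heq n (tword ([j..<Suc (Suc k)] @ u) :: (hecke_gen, 'k) free_alg) (tword ([j..<Suc (Suc k)] @ u'))"
    using u(1) Suc.prems(1) by (intro weq_prepend) auto
  then show ?case using u(4) u'(4) jj heq_trans heq_sym by metis
qed

section \<open>Polynomials in the y_j inside the algebra\<close>

definition yword :: "nat list \<Rightarrow> 'k::field \<Rightarrow> (hecke_gen, 'k) free_alg" where
  "yword l c = Poly_Mapping.single (FMon (map Y l)) c"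

text \<open>A section of the action on polynomials (\<open>act_sec\<close>): each monomial is
  written with increasing variables. It is multiplicative modulo the relations only.\<close>

definition sec :: "'k::field ypoly \<Rightarrow> (hecke_gen, 'k) free_alg" where
  "sec f = lift_pm (\<lambda>M. yword (sorted_list_of_multiset M)) f"

lemma yword_Cons: "yword (j # l) c = yy j * yword l c"
  by (simp add: yword_def single_Cons)

lemma yword_HF: "set l \<subseteq> {1..n} \<Longrightarrow> yword l c \<in> HF n"
  unfolding yword_def by (rule free_single) auto

lemma sec_single: "sec (Poly_Mapping.single M c) = yword (sorted_list_of_multiset M) c"
  by (simp add: sec_def lift_pm_single yword_def)

lemma sec_add: "sec (f + g) = sec f + sec g"
  unfolding sec_def by (rule lift_pm_add) (simp_all add: yword_def single_add)

lemma sec_0 [simp]: "sec 0 = 0"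
  by (simp add: sec_def)

lemma sec_sum: "sec (sum f A) = (\<Sum>x\<in>A. sec (f x))"
  by (induction A rule: infinite_finite_induct) (simp_all add: sec_add)

lemma sec_uminus: "sec (- f) = - sec f"
  using sec_add[of f "- f"] by (simp add: eq_neg_iff_add_eq_0 add.commute)

lemma sec_cst [simp]: "sec (cst c) = scal c"
  by (simp add: sec_single yword_def scal_def zero_fmon_def)

lemma sec_cst_mult: "sec (cst c * f) = scal c * sec f"
  by (induction f rule: poly_mapping_add_induct)
    (simp_all add: mult_single sec_single yword_def scal_def sec_add distrib_left)

lemma sec_HF: "f \<in> vars_upto n \<Longrightarrow> sec f \<in> HF n"
  unfolding sec_def lift_pm_def by (intro free_sum yword_HF) (auto simp: vars_upto_def)

lemma act_yword: "act (yword l c) u = psm (Poly_Mapping.single (mset l) c) u"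
proof (induction l)
  case Nil
  show ?case by (simp add: yword_def actw_def)
next
  case (Cons j l)
  then show ?case by (simp add: yword_Cons act_mult psm_psm mult_single)
qed

lemma act_sec: "act (sec f) u = psm f u"
  by (induction f rule: poly_mapping_add_induct) (simp_all add: sec_single act_yword sec_add act_add psm_add_left)

lemma yword_insort:
  assumes "j \<in> {1..n}" "set l \<subseteq> {1..n}"
  shows "heq n (yword (insort j l) c) (yy j * yword l c)"
  using assms(2)
proof (induction l)
  case (Cons i l)
  show ?case
  proof (cases "j \<le> i")
    case False
    have "heq n (yy i * yword (insort j l) c) (yy i * (yy j * yword l c))"
      using Cons by (intro heq_left yy_HF) auto
    moreover have "heq n (yy i * yy j * yword l c) (yy j * yy i * yword l c)"
      by (rule heq_right[OF heq_rel[OF hecke_relI(3)] yword_HF]) (use Cons.prems assms(1) in auto)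
    ultimately show ?thesis using False heq_trans by (simp add: yword_Cons mult.assoc)
  qed (simp add: yword_Cons heq_refl)
qed (simp add: yword_Cons heq_refl)

lemma sec_var:
  assumes j: "j \<in> {1..n}" and f: "f \<in> vars_upto n"
  shows "heq n (sec (yv j * f)) (yy j * sec f)"
  using f
proof (induction f rule: vars_upto_single_induct)
  case (single M c)
  then show ?case by (simp add: mult_single sec_single yword_insort[OF j])
qed (simp add: distrib_left sec_add heq_add)

lemma T_Y:
  assumes i: "1 \<le> i" "i < n" and j: "j \<in> {1..n}"
  shows "heq n (tt i * yy j) (yy (sw i j) * tt i + esgn i j)"
proof -
  have rel: "heq n (yy i * tt i) (tt i * yy (i + 1) + 1)"
    by (rule heq_rel) (use i in \<open>auto simp: hecke_rels_def algebra_simps\<close>)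
  have tt: "heq n (tt i * tt i) 1" by (rule heq_rel) (use i in \<open>auto simp: hecke_rels_def\<close>)
  note HF = tt_HF[OF i] yy_HF[of i n] yy_HF[of "i + 1" n]
  consider "j = i" | "j = Suc i" | "j \<noteq> i" "j \<noteq> Suc i" by blast
  then show ?thesis
  proof cases
    case 1
    \<comment> \<open>Inserting t_i^2 = 1 on the right produces the factor y_i t_i, to which the
      defining relation applies.\<close>
    have "heq n (tt i * yy i * 1) (tt i * yy i * (tt i * tt i))"
      using HF i by (intro heq_left[OF heq_sym[OF tt]] free_mult) auto
    also have "tt i * yy i * (tt i * tt i) = tt i * (yy i * tt i) * (tt i :: (hecke_gen, 'a) free_alg)"
      by (simp add: mult.assoc)
    also have "heq n (tt i * (yy i * tt i) * tt i) (tt i * (tt i * yy (i + 1) + 1) * (tt i :: (hecke_gen, 'a) free_alg))"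
      using HF i by (intro heq_right[OF heq_left[OF rel]]) auto
    also have "tt i * (tt i * yy (i + 1) + 1) * tt i = (tt i * tt i) * yy (i + 1) * tt i + (tt i * tt i :: (hecke_gen, 'a) free_alg)"
      by (simp add: algebra_simps)
    also have "heq n ((tt i * tt i) * yy (i + 1) * tt i + tt i * tt i) (1 * yy (i + 1) * tt i + (1 :: (hecke_gen, 'a) free_alg))"
      using HF i by (intro heq_add tt heq_right[OF heq_right[OF tt]]) auto
    finally show ?thesis using 1 by simp
  next
    case 2
    have "heq n (yy i * tt i - 1) (tt i * yy (i + 1) + 1 - (1 :: (hecke_gen, 'a) free_alg))"
      by (intro heq_diff rel heq_refl)
    then show ?thesis using 2 heq_sym by (simp add: transpose_def)
  next
    case 3
    then show ?thesis using i j
      by (intro heq_rel) (auto simp: transpose_def intro!: hecke_relI(2))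
  qed
qed

lemma sec_esgn: "sec (esgn i j * f) = esgn i j * sec f"
  by (auto simp: sec_uminus)

text \<open>Both sides change in the same way when f is multiplied by y_j: by \<open>T_Y\<close> on
  the left, by \<open>swp_var\<close> and \<open>dvd_diff_var\<close> on the right.\<close>

lemma T_sec:
  assumes i: "1 \<le> i" "i < n" and f: "f \<in> vars_upto n"
  shows "heq n (tt i * sec f) (sec (swp i f) * tt i + sec (dvd_diff i f))"
  using f
proof (induction f rule: vars_upto_induct)
  case (cst c)
  show ?case by (simp add: scal_comm heq_refl)
next
  case (var j f)
  note HF = tt_HF[OF i] yy_HF[of j n] sec_HF[OF var(2)]
  have sj: "sw i j \<in> {1..n}" by (rule sw_range[OF i var(1)])
  have ysj: "yy (sw i j) \<in> HF n" using sj by (intro yy_HF) auto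
  have S: "swp i f \<in> vars_upto n" "dvd_diff i f \<in> vars_upto n"
    using var(2) i vars_upto_swp vars_upto_dvd_diff by blast+
  have "heq n (tt i * sec (yv j * f)) (tt i * (yy j * sec f))"
    by (rule heq_left[OF sec_var[OF var(1,2)] HF(1)])
  moreover have "heq n (tt i * yy j * sec f) ((yy (sw i j) * tt i + esgn i j) * sec f)"
    by (rule heq_right[OF T_Y[OF i var(1)] HF(3)])
  moreover have "heq n (yy (sw i j) * (tt i * sec f) + esgn i j * sec f)
      (yy (sw i j) * (sec (swp i f) * tt i + sec (dvd_diff i f)) + esgn i j * sec f)"
    by (intro heq_add heq_refl heq_left[OF var(3) ysj])
  moreover have "heq n (yy (sw i j) * sec (swp i f) * tt i + yy (sw i j) * sec (dvd_diff i f) + esgn i j * sec f)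
      (sec (yv (sw i j) * swp i f) * tt i + sec (yv (sw i j) * dvd_diff i f) + esgn i j * sec f)"
    by (intro heq_add heq_refl heq_right[OF heq_sym[OF sec_var[OF sj S(1)]] HF(1)] heq_sym[OF sec_var[OF sj S(2)]])
  ultimately have "heq n (tt i * sec (yv j * f))
      (sec (yv (sw i j) * swp i f) * tt i + sec (yv (sw i j) * dvd_diff i f) + esgn i j * sec f)"
    unfolding distrib_right distrib_left mult.assoc using heq_trans by blast
  then show ?case unfolding swp_var dvd_diff_var sec_add sec_esgn by (simp only: add.assoc)
next
  case (add f g)
  then have "heq n (tt i * sec f + tt i * sec g) (sec (swp i f) * tt i + sec (dvd_diff i f) + (sec (swp i g) * tt i + sec (dvd_diff i g)))"
    by (intro heq_add)
  then show ?case by (simp only: sec_add swp_add dvd_diff_add distrib_left distrib_right add_ac)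
qed

section \<open>Normal forms\<close>

definition perms :: "nat \<Rightarrow> (nat \<Rightarrow> nat) set" where
  "perms n = perm_of ` {l. set l \<subseteq> {1..<n}}"

text \<open>A shortest word, so that in the centralizer argument terms with shorter words cannot
  reach a permutation of maximal length.\<close>

definition rep :: "nat \<Rightarrow> (nat \<Rightarrow> nat) \<Rightarrow> nat list" where
  "rep n w = (ARG_MIN length l. set l \<subseteq> {1..<n} \<and> perm_of l = w)"

lemma rep:
  assumes "w \<in> perms n"
  shows "set (rep n w) \<subseteq> {1..<n}" "perm_of (rep n w) = w"
    "\<And>l. set l \<subseteq> {1..<n} \<Longrightarrow> perm_of l = w \<Longrightarrow> length (rep n w) \<le> length l"
proof -
  obtain l where "set l \<subseteq> {1..<n} \<and> perm_of l = w" using assms by (auto simp: perms_def)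
  from arg_min_nat_lemma[of "\<lambda>l. set l \<subseteq> {1..<n} \<and> perm_of l = w", OF this, of length]
  show "set (rep n w) \<subseteq> {1..<n}" "perm_of (rep n w) = w"
    "\<And>l. set l \<subseteq> {1..<n} \<Longrightarrow> perm_of l = w \<Longrightarrow> length (rep n w) \<le> length l"
    unfolding rep_def by blast+
qed

lemma id_perms: "id \<in> perms n"
  unfolding perms_def by (intro image_eqI[of _ _ "[]"]) auto

lemma rep_id: "rep n id = []"
  using rep(3)[OF id_perms, of "[]" n] by simp

lemma sw_perms:
  assumes "1 \<le> i" "i < n" "w \<in> perms n"
  shows "sw i \<circ> w \<in> perms n"
proof -
  obtain l where "set l \<subseteq> {1..<n}" "w = perm_of l" using assms by (auto simp: perms_def)
  then show ?thesis using assms unfolding perms_def by (intro image_eqI[of _ _ "i # l"]) auto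
qed

definition hmod_upto :: "nat \<Rightarrow> 'k::field hmod set" where
  "hmod_upto n = {U. Poly_Mapping.keys U \<subseteq> perms n \<and> (\<forall>w. Poly_Mapping.lookup U w \<in> vars_upto n)}"

lemma hmod_upto_add: "U \<in> hmod_upto n \<Longrightarrow> V \<in> hmod_upto n \<Longrightarrow> U + V \<in> hmod_upto n"
  using Poly_Mapping.keys_add[of U V] by (auto simp: hmod_upto_def lookup_add vars_upto_add)

lemma hmod_upto_single: "w \<in> perms n \<Longrightarrow> f \<in> vars_upto n \<Longrightarrow> Poly_Mapping.single w f \<in> hmod_upto n"
  by (auto simp: hmod_upto_def lookup_single when_def)

lemma hmod_upto_induct [consumes 1, case_names single add]:
  assumes U: "U \<in> hmod_upto n"
    and single: "\<And>w f. w \<in> perms n \<Longrightarrow> f \<in> vars_upto n \<Longrightarrow> P (Poly_Mapping.single w f)"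
    and add: "\<And>U V. P U \<Longrightarrow> P V \<Longrightarrow> P (U + V)"
  shows "P U"
proof (rule poly_mapping_keys_induct[of P])
  show "P 0" using single[OF id_perms vars_upto_0] by simp
qed (use U in \<open>auto simp: hmod_upto_def intro!: single add\<close>)

definition nfm :: "nat \<Rightarrow> 'k::field hmod \<Rightarrow> (hecke_gen, 'k) free_alg" where
  "nfm n U = lift_pm (\<lambda>w f. sec f * tword (rep n w)) U"

lemma nfm_single: "nfm n (Poly_Mapping.single w f) = sec f * tword (rep n w)"
  by (simp add: nfm_def lift_pm_single)

lemma nfm_add: "nfm n (U + V) = nfm n U + nfm n V"
  unfolding nfm_def by (rule lift_pm_add) (simp_all add: sec_add distrib_right)

text \<open>\<open>nfm\<close> turns the action into left multiplication. Applied to the basis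
  element of the identity it shows that \<open>act p e0\<close> determines p modulo the relations,
  so that the module is the regular representation.\<close>

theorem nfm_act:
  assumes "p \<in> HF n" "U \<in> hmod_upto n"
  shows "act p U \<in> hmod_upto n \<and> heq n (p * nfm n U) (nfm n (act p U))"
  using assms
proof (induction p arbitrary: U rule: free_induct)
  case (scal c)
  then show ?case
  proof (induction U rule: hmod_upto_induct)
    case (single w f)
    then show ?case
      by (auto simp: nfm_single sec_cst_mult mult.assoc heq_refl intro!: hmod_upto_single vars_upto_mult)
  qed (simp add: act_add_right nfm_add hmod_upto_add distrib_left heq_add)
next
  case (gen g)
  from gen(2) show ?case
  proof (induction U rule: hmod_upto_induct)
    case (single w f)
    note r = rep[OF single(1)] and tw = tword_HF[OF rep(1)[OF single(1)]]
    show ?case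
    proof (cases g)
      case (T i)
      then have i: "1 \<le> i" "i < n" using gen(1) by auto
      note S = vars_upto_swp[OF single(2) i] vars_upto_dvd_diff[OF single(2) i]
      note w' = sw_perms[OF i single(1)]
      have "heq n (tword (i # rep n w) :: (hecke_gen, 'a) free_alg) (tword (rep n (sw i \<circ> w)))"
      proof (rule weq_complete[of "n - 1"])
        show "n - 1 < n" using i by auto
        have "{1..<n} = {1..n - 1}" using i by auto
        then show "set (i # rep n w) \<subseteq> {1..n - 1}" "set (rep n (sw i \<circ> w)) \<subseteq> {1..n - 1}"
          using r(1) rep(1)[OF w'] i by auto
      qed (simp add: r rep(2)[OF w'])
      then have 2: "heq n (sec (swp i f) * (tt i * tword (rep n w))) (sec (swp i f) * tword (rep n (sw i \<circ> w)))"
        unfolding tword_Cons by (rule heq_left[OF _ sec_HF[OF S(1)]])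
      have "heq n (tt i * sec f * tword (rep n w)) ((sec (swp i f) * tt i + sec (dvd_diff i f)) * tword (rep n w))"
        by (rule heq_right[OF T_sec[OF i single(2)] tw])
      moreover have "heq n (sec (swp i f) * (tt i * tword (rep n w)) + sec (dvd_diff i f) * tword (rep n w))
         (sec (swp i f) * tword (rep n (sw i \<circ> w)) + sec (dvd_diff i f) * tword (rep n w))"
        by (rule heq_add[OF 2 heq_refl])
      ultimately have "heq n (tt i * nfm n (Poly_Mapping.single w f)) (nfm n (tm i (Poly_Mapping.single w f)))"
        unfolding tm_single nfm_add nfm_single distrib_right mult.assoc using heq_trans by blast
      then show ?thesis using T S w' single(1) by (simp add: hmod_upto_add hmod_upto_single)
    next
      case (Y j)
      then have j: "j \<in> {1..n}" using gen(1) by auto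
      have "heq n (yy j * sec f * tword (rep n w)) (sec (yv j * f) * tword (rep n w))"
        by (rule heq_right[OF heq_sym[OF sec_var[OF j single(2)]] tw])
      then show ?thesis using Y single j
        by (auto simp: nfm_single mult.assoc intro!: hmod_upto_single vars_upto_mult)
    qed
  qed (simp add: act_add_right nfm_add hmod_upto_add distrib_left heq_add)
next
  case (add p q)
  then show ?case by (simp add: act_add nfm_add hmod_upto_add distrib_right heq_add)
next
  case (mult p q)
  then have q: "act q U \<in> hmod_upto n" "heq n (q * nfm n U) (nfm n (act q U))" by auto
  have "heq n (p * (q * nfm n U)) (p * nfm n (act q U))" by (rule heq_left[OF q(2) mult(1)])
  then show ?case using mult(3)[OF q(1)] heq_trans by (auto simp: act_mult mult.assoc)
qed

abbreviation e0 :: "'k::field hmod" where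
  "e0 \<equiv> Poly_Mapping.single id 1"

lemma normal_form:
  assumes "p \<in> HF n"
  shows "act p e0 \<in> hmod_upto n" "heq n p (nfm n (act p e0))"
proof -
  have 1: "(1 :: 'a ypoly) \<in> vars_upto n" using vars_upto_cst[of 1 n] by (simp add: cst_1)
  have sec1: "sec (1 :: 'a ypoly) = 1" using sec_cst[of "1 :: 'a"] by (simp add: cst_1 del: sec_cst)
  have "nfm n (e0 :: 'a hmod) = 1" by (simp add: nfm_single rep_id sec1)
  then show "act p e0 \<in> hmod_upto n" "heq n p (nfm n (act p e0))"
    using nfm_act[OF assms hmod_upto_single[OF id_perms 1]] by simp_all
qed

section \<open>The centralizer of the y_j\<close>

lemma keys_tm: "w \<in> Poly_Mapping.keys (tm i U) \<Longrightarrow> w \<in> Poly_Mapping.keys U \<or> (\<exists>v\<in>Poly_Mapping.keys U. w = sw i \<circ> v)"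
proof -
  assume w: "w \<in> Poly_Mapping.keys (tm i U)"
  have "Poly_Mapping.keys (tm i U) \<subseteq> (\<Union>v\<in>Poly_Mapping.keys U. {sw i \<circ> v, v})"
    unfolding tm_def lift_pm_def
    by (rule order_trans[OF Poly_Mapping.keys_sum], rule UN_mono, rule order_refl,
        rule order_trans[OF Poly_Mapping.keys_add]) auto
  then show ?thesis using w by auto
qed

text \<open>Leading terms: moving t_i past a variable either permutes the variable or drops t_i, so
  every term but one belongs to a shorter word.\<close>

lemma act_tword_var:
  assumes "set l \<subseteq> {1..<n}"
  shows "\<exists>V. act (tword l) (Poly_Mapping.single id (yv j :: 'k::field ypoly)) = Poly_Mapping.single (perm_of l) (yv (perm_of l j)) + V \<and>
    (\<forall>w\<in>Poly_Mapping.keys V. \<exists>l'. set l' \<subseteq> {1..<n} \<and> length l' < length l \<and> perm_of l' = w)"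
  using assms
proof (induction l)
  case Nil
  show ?case by (intro exI[of _ 0]) simp
next
  case (Cons i l)
  then have "set l \<subseteq> {1..<n}" by simp
  from Cons.IH[OF this] obtain V where V: "act (tword l) (Poly_Mapping.single id (yv j :: 'k ypoly)) = Poly_Mapping.single (perm_of l) (yv (perm_of l j)) + V"
    and k: "\<forall>w\<in>Poly_Mapping.keys V. \<exists>l'. set l' \<subseteq> {1..<n} \<and> length l' < length l \<and> perm_of l' = w" by blast
  let ?V = "Poly_Mapping.single (perm_of l) (dvd_diff i (yv (perm_of l j))) + tm i V"
  have "\<exists>l'. set l' \<subseteq> {1..<n} \<and> length l' < length (i # l) \<and> perm_of l' = w" if w: "w \<in> Poly_Mapping.keys ?V" for w
  proof -
    consider "w = perm_of l" | "w \<in> Poly_Mapping.keys V" | v where "v \<in> Poly_Mapping.keys V" "w = sw i \<circ> v"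
      using w Poly_Mapping.keys_add[of "Poly_Mapping.single (perm_of l) (dvd_diff i (yv (perm_of l j)))" "tm i V"] keys_tm[of w i V]
      by (auto split: if_splits)
    then show ?thesis
    proof cases
      case 1
      then show ?thesis using Cons.prems by (intro exI[of _ l]) auto
    next
      case 2
      then obtain l' where "set l' \<subseteq> {1..<n}" "length l' < length l" "perm_of l' = w" using k by blast
      then show ?thesis by (intro exI[of _ l']) auto
    next
      case 3
      then obtain l' where "set l' \<subseteq> {1..<n}" "length l' < length l" "perm_of l' = v" using k by blast
      then show ?thesis using Cons.prems 3 by (intro exI[of _ "i # l'"]) auto
    qed
  qed
  moreover have "act (tword (i # l)) (Poly_Mapping.single id (yv j :: 'k ypoly)) = Poly_Mapping.single (perm_of (i # l)) (yv (perm_of (i # l) j)) + ?V"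
    by (simp add: tword_Cons act_mult V tm_add add.assoc)
  ultimately show ?case by blast
qed

text \<open>Let w be a longest permutation other than the identity in the support of p, with
  coefficient c. The coefficients of w in y_j p and p y_j give (y_j - y_{w(j)}) c = 0, so w fixes
  every j, which is a contradiction.\<close>

theorem centralizer_Y:
  assumes p: "p \<in> HF n" and comm: "\<And>j. j \<in> {1..n} \<Longrightarrow> heq n (yy j * p) (p * yy j)"
  shows "\<exists>g\<in>vars_upto n. heq n p (sec g)"
proof -
  let ?U = "act p e0"
  note U = normal_form[OF p]
  have "Poly_Mapping.keys ?U \<subseteq> {id}"
  proof (rule ccontr)
    assume "\<not> ?thesis"
    then have ne: "Poly_Mapping.keys ?U - {id} \<noteq> {}" by auto
    let ?len = "\<lambda>w. length (rep n w)"
    define m where "m = Max (?len ` (Poly_Mapping.keys ?U - {id}))"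
    have "m \<in> ?len ` (Poly_Mapping.keys ?U - {id})" unfolding m_def by (rule Max_in) (use ne in auto)
    then obtain w where w: "w \<in> Poly_Mapping.keys ?U" "w \<noteq> id" "?len w = m" by auto
    have max: "?len v \<le> m" if "v \<in> Poly_Mapping.keys ?U" for v
      using that by (cases "v = id") (auto simp: rep_id m_def)
    have perms: "Poly_Mapping.keys ?U \<subseteq> perms n" using U(1) by (auto simp: hmod_upto_def)
    have fixed: "w j = j" if j: "j \<in> {1..n}" for j
    proof -
      have "yv j * Poly_Mapping.lookup ?U w = Poly_Mapping.lookup (act (yy j * p) e0) w"
        by (simp add: act_mult lookup_psm)
      also have "\<dots> = Poly_Mapping.lookup (act (p * yy j) e0) w"
        using heq_act[OF comm[OF j]] by metis
      also have "\<dots> = Poly_Mapping.lookup (act (nfm n ?U) (Poly_Mapping.single id (yv j))) w"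
      proof -
        have "act (p * yy j) e0 = act p (Poly_Mapping.single id (yv j))"
          by (simp only: act_mult act_gen actg.simps psm_single mult_1_right)
        then show ?thesis using heq_act[OF U(2)] by metis
      qed
      also have "\<dots> = (\<Sum>v\<in>Poly_Mapping.keys ?U. Poly_Mapping.lookup ?U v *
          Poly_Mapping.lookup (act (tword (rep n v)) (Poly_Mapping.single id (yv j))) w)"
      proof -
        have "act (\<Sum>v\<in>A. h v) u = (\<Sum>v\<in>A. act (h v) u)" for A and h :: "(nat \<Rightarrow> nat) \<Rightarrow> (hecke_gen, 'a) free_alg" and u
          by (induction A rule: infinite_finite_induct) (simp_all add: act_add)
        then show ?thesis
          by (simp add: nfm_def lift_pm_def lookup_sum act_mult act_sec lookup_psm)
      qed
      also have "\<dots> = (\<Sum>v\<in>Poly_Mapping.keys ?U. if v = w then Poly_Mapping.lookup ?U w * yv (w j) else 0)"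
      proof (rule sum.cong[OF refl])
        fix v assume v: "v \<in> Poly_Mapping.keys ?U"
        then have vp: "v \<in> perms n" and wp: "w \<in> perms n" using perms w by auto
        obtain V where V: "act (tword (rep n v)) (Poly_Mapping.single id (yv j)) = Poly_Mapping.single v (yv (v j)) + (V :: 'a hmod)"
          "\<forall>w\<in>Poly_Mapping.keys V. \<exists>l'. set l' \<subseteq> {1..<n} \<and> length l' < ?len v \<and> perm_of l' = w"
          using act_tword_var[OF rep(1)[OF vp], of j] by (auto simp: rep(2)[OF vp])
        \<comment> \<open>The terms of \<open>V\<close> have words shorter than
          \<open>rep n v\<close>, which is at most as long as \<open>rep n w\<close>, and no word
          for w is shorter than that.\<close>
        have "w \<notin> Poly_Mapping.keys V"
        proof
          assume "w \<in> Poly_Mapping.keys V"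
          then obtain l' where "set l' \<subseteq> {1..<n}" "length l' < ?len v" "perm_of l' = w" using V(2) by blast
          then have "?len w < ?len v" using rep(3)[OF wp, of l'] by simp
          then show False using max[OF v] w(3) by simp
        qed
        then show "Poly_Mapping.lookup ?U v * Poly_Mapping.lookup (act (tword (rep n v)) (Poly_Mapping.single id (yv j))) w =
            (if v = w then Poly_Mapping.lookup ?U w * yv (w j) else 0)"
          by (auto simp: V(1) lookup_add lookup_single when_def in_keys_iff)
      qed
      also have "\<dots> = Poly_Mapping.lookup ?U w * yv (w j)"
        using w(1) by simp
      finally have "(yv j - yv (w j)) * Poly_Mapping.lookup ?U w = 0"
        by (simp add: algebra_simps)
      moreover have "Poly_Mapping.lookup ?U w \<noteq> 0" using w(1) by (simp add: in_keys_iff)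
      ultimately have "yv j - yv (w j) = (0 :: 'a ypoly)" by (metis mult_eq_0_iff)
      then show "w j = j" using yv_diff_nonzero by metis
    qed
    obtain l where l: "set l \<subseteq> {1..<n}" "w = perm_of l" using w(1) perms by (auto simp: perms_def)
    have "w j = j" for j
    proof (cases "j \<in> {1..n}")
      case False
      have "\<forall>i\<in>set l. j \<noteq> i \<and> j \<noteq> Suc i" using False l(1) by force
      then show ?thesis using l(2) by (simp add: perm_of_fix)
    qed (rule fixed)
    then show False using w(2) by auto
  qed
  then have "?U = Poly_Mapping.single id (Poly_Mapping.lookup ?U id)"
    by (intro poly_mapping_eqI[of ?U]) (metis (no_types, lifting) in_keys_iff lookup_single_eq lookup_single_not_eq singletonD subsetD)
  then have "heq n p (sec (Poly_Mapping.lookup ?U id))"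
    using U(2) nfm_single[of n id "Poly_Mapping.lookup ?U id"] by (simp add: rep_id)
  then show ?thesis using U(1) by (auto simp: hmod_upto_def)
qed

lemma sec_inject: "heq n (sec f) (sec g) \<Longrightarrow> f = g"
  using arg_cong[OF heq_act[of n "sec f" "sec g" e0], of "\<lambda>U. Poly_Mapping.lookup U id"] by (simp add: act_sec)

text \<open>At the permutation s_i, the left product has the coefficient s_i(g), the right one g;
  the other terms of the left product are a divided difference, which vanishes for symmetric
  g.\<close>

lemma sec_commute_T:
  assumes i: "1 \<le> i" "i < n" and g: "g \<in> vars_upto n"
  shows "heq n (tt i * sec g) (sec g * tt i) \<longleftrightarrow> swp i g = g"
proof
  assume "heq n (tt i * sec g) (sec g * tt i)"
  from arg_cong[OF heq_act[OF this, of e0], of "\<lambda>U. Poly_Mapping.lookup U (sw i)"]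
  moreover have "tm i e0 = Poly_Mapping.single (sw i) (1 :: 'a ypoly)"
    using tm_const_basis[of i id "1 :: 'a"] by (simp add: cst_1)
  ultimately have "Poly_Mapping.lookup (Poly_Mapping.single (sw i) (swp i g) + Poly_Mapping.single id (dvd_diff i g)) (sw i) =
     Poly_Mapping.lookup (Poly_Mapping.single (sw i) g) (sw i)"
    by (simp add: act_mult act_sec)
  moreover have "sw i \<noteq> id" by (metis id_apply n_not_Suc_n transpose_apply_first)
  ultimately show "swp i g = g" by (simp add: lookup_add lookup_single when_def)
next
  assume S: "swp i g = g"
  show "heq n (tt i * sec g) (sec g * tt i)"
    using T_sec[OF i g] by (simp add: S dvd_diff_eq_0[OF S])
qed

lemma sec_commute_Y:
  assumes "j \<in> {1..n}" "g \<in> vars_upto n"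
  shows "heq n (yy j * sec g) (sec g * yy j)"
proof -
  have "yy j * sec g - sec g * yy j \<in> HI n"
  proof (rule commute_ideal[OF hecke_rels_carrier, of "Y ` {1..n}" n "Y ` {1..n}"])
    show "yy j \<in> carrier (free_algebra (Y ` {1..n}))" using assms(1) by (intro free_gen) auto
    show "sec g \<in> carrier (free_algebra (Y ` {1..n}))"
      unfolding sec_def lift_pm_def yword_def
      using assms(2) by (intro free_sum free_single) (auto simp: vars_upto_def)
    fix a b assume "a \<in> Y ` {1..n}" "b \<in> Y ` {1..n}"
    then show "gen a * gen b - gen b * gen a \<in> HI n"
      by (auto intro!: subsetD[OF ideal_rels[OF hecke_rels_carrier]] hecke_relI(3))
  qed auto
  then show ?thesis by (simp add: req_def)
qed

section \<open>Block symmetric polynomials\<close>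

definition expo :: "nat \<Rightarrow> nat multiset \<Rightarrow> nat list" where
  "expo N M = map (count M) [1..<Suc N]"

text \<open>The monomial with exponents \<open>es\<close> in the variables y_{p+1}, y_{p+2}, ...;
  for p = 0 it is inverse to \<open>expo\<close>.\<close>

fun ex_mset :: "nat \<Rightarrow> nat list \<Rightarrow> nat multiset" where
  "ex_mset p [] = {#}"
| "ex_mset p (e # es) = replicate_mset e (Suc p) + ex_mset (Suc p) es"

text \<open>Here monomials become arguments of the bar complex. Zero exponents are kept, so the
  sizes of the entries are the sizes of the blocks, and one function on lists of multisets serves
  all tuples of objects at once.\<close>

fun splits :: "nat list \<Rightarrow> 'a list \<Rightarrow> 'a multiset list" where
  "splits [] es = []"
| "splits (X # Xs) es = mset (take X es) # splits Xs (drop X es)"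

text \<open>The i for which y_i and y_{i+1} lie in the same block, when p variables precede the
  first block.\<close>

fun inner :: "nat \<Rightarrow> nat list \<Rightarrow> nat set" where
  "inner p [] = {}"
| "inner p (X # Xs) = {p<..<p + X} \<union> inner (p + X) Xs"

lemma count_ex_mset: "count (ex_mset p es) j = (if p < j \<and> j \<le> p + length es then es ! (j - Suc p) else 0)"
proof (induction es arbitrary: p j)
  case (Cons e es)
  show ?case
  proof (cases "j = Suc p")
    case False
    then have "j - Suc p = Suc (j - Suc (Suc p))" if "p < j" using that by auto
    then show ?thesis using False Cons[of "Suc p"] by auto
  qed (simp add: Cons)
qed simp

lemma length_expo [simp]: "length (expo N M) = N"
  by (simp add: expo_def)

lemma expo_ex_mset: "length es = N \<Longrightarrow> expo N (ex_mset 0 es) = es"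
  by (rule nth_equalityI) (auto simp: expo_def count_ex_mset simp del: upt_Suc)

lemma ex_mset_expo: "set_mset M \<subseteq> {1..N} \<Longrightarrow> ex_mset 0 (expo N M) = M"
proof (rule multiset_eqI)
  fix j assume M: "set_mset M \<subseteq> {1..N}"
  show "count (ex_mset 0 (expo N M)) j = count M j"
  proof (cases "j \<in> {1..N}")
    case True
    then show ?thesis by (auto simp: count_ex_mset expo_def simp del: upt_Suc)
  next
    case False
    then have "j \<notin># M" using M by blast
    then show ?thesis using False by (auto simp: count_ex_mset not_in_iff)
  qed
qed

lemma set_ex_mset: "set_mset (ex_mset p es) \<subseteq> {Suc p..p + length es}"
proof
  fix j assume "j \<in># ex_mset p es"
  then have "count (ex_mset p es) j \<noteq> 0" by simp
  then show "j \<in> {Suc p..p + length es}" by (auto simp: count_ex_mset split: if_splits)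
qed

lemma ex_mset_append: "ex_mset p (a @ b) = ex_mset p a + ex_mset (p + length a) b"
  by (induction a arbitrary: p) (simp_all add: add.assoc)

lemma ex_mset_shift: "ex_mset (p + m) es = image_mset (\<lambda>j. j + m) (ex_mset p es)"
  by (induction es arbitrary: p) (simp_all flip: add_Suc)

lemma image_sw_fixed: "\<forall>j\<in>#M. j \<noteq> i \<and> j \<noteq> Suc i \<Longrightarrow> image_mset (sw i) M = M"
  by (rule trans[OF image_mset_cong[of M "sw i" id]]) (auto simp: transpose_def)

lemma ex_mset_swap:
  "image_mset (sw (Suc (length a))) (ex_mset 0 (a @ x # y # b)) = ex_mset 0 (a @ y # x # b)"
proof -
  let ?i = "Suc (length a)"
  have "image_mset (sw ?i) (ex_mset 0 a) = ex_mset 0 a"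
    by (rule image_sw_fixed) (use set_ex_mset[of 0 a] in fastforce)
  moreover have "image_mset (sw ?i) (ex_mset (Suc ?i) b) = ex_mset (Suc ?i) b"
    by (rule image_sw_fixed) (use set_ex_mset[of "Suc ?i" b] in fastforce)
  ultimately show ?thesis by (simp add: ex_mset_append)
qed

lemma length_splits [simp]: "length (splits Xs es) = length Xs"
  by (induction Xs arbitrary: es) auto

lemma sum_splits: "length es = sum_list Xs \<Longrightarrow> sum_list (splits Xs es) = mset es"
proof (induction Xs arbitrary: es)
  case (Cons X Xs)
  then have "sum_list (splits Xs (drop X es)) = mset (drop X es)" by simp
  then show ?case by (simp flip: mset_append)
qed simp

lemma size_splits: "length es = sum_list Xs \<Longrightarrow> map size (splits Xs es) = Xs"
  by (induction Xs arbitrary: es) auto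

lemma splits_surj: "\<exists>es. length es = sum_list (map size L) \<and> splits (map size L) es = L"
proof (induction L)
  case (Cons M L)
  then obtain es where es: "length es = sum_list (map size L)" "splits (map size L) es = L" by blast
  obtain u where "mset u = M" using ex_mset by blast
  then show ?case using es by (intro exI[of _ "u @ es"]) auto
qed simp

lemma splits_append: "length a = sum_list Ys \<Longrightarrow> splits (Ys @ Zs) (a @ b) = splits Ys a @ splits Zs b"
  by (induction Ys arbitrary: a) auto

lemma inner_range: "inner p Xs \<subseteq> {Suc p..<p + sum_list Xs}"
proof (induction Xs arbitrary: p)
  case (Cons X Xs)
  show ?case using Cons[of "p + X"] by auto
qed simp

lemma splits_swap:
  assumes "p + Suc (length a) \<in> inner p Xs"
  shows "splits Xs (a @ x # y # b) = splits Xs (a @ y # x # b)"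
  using assms
proof (induction Xs arbitrary: a p)
  case (Cons X Xs)

  show ?case
  proof (cases "Suc (length a) < X")
    case True
    then obtain d where "X = length a + Suc (Suc d)" by (metis add_Suc_shift less_imp_Suc_add add_Suc_right)
    then show ?thesis by simp
  next
    case False
    then have i: "p + Suc (length a) \<in> inner (p + X) Xs" using Cons.prems by auto
    have X: "X \<le> length a" using i inner_range[of "p + X" Xs] by auto
    then have "p + X + Suc (length (drop X a)) \<in> inner (p + X) Xs" using i by simp
    from Cons.IH[OF this] show ?thesis using X by simp
  qed
qed simp

lemma mset_eq_swap_induct [consumes 1, case_names refl trans Cons swap]:
  assumes "mset u = mset u'"
    and refl: "\<And>u. P u u" and trans: "\<And>u v w. P u v \<Longrightarrow> P v w \<Longrightarrow> P u w"
    and Cons: "\<And>x u v. P u v \<Longrightarrow> P (x # u) (x # v)" and swap: "\<And>x y u. P (x # y # u) (y # x # u)"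
  shows "P u u'"
  using assms(1)
proof (induction u arbitrary: u')
  case Nil
  then show ?case using refl by simp
next
  case (Cons x u)
  then have "x \<in> set u'" by (metis list.set_intros(1) set_mset_mset)
  then obtain a b where u': "u' = a @ x # b" by (meson split_list)
  have "P (x # a @ b) (a @ x # b)"
  proof (induction a)
    case (Cons y a)
    then show ?case using trans[OF swap assms(4)] by simp
  qed (simp add: refl)
  moreover have "P u (a @ b)" by (rule Cons.IH) (use Cons.prems u' in simp)
  ultimately show ?case using trans[OF assms(4)] u' by blast
qed

text \<open>Invariance under s_i says that exchanging two neighbouring exponents keeps the
  coefficient, and such exchanges connect all arrangements of a multiset.\<close>

lemma sym_lookup_block:
  assumes sym: "\<And>i. length a < i \<Longrightarrow> i < length a + length u \<Longrightarrow> swp i g = g" and u: "mset u = mset u'"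
  shows "Poly_Mapping.lookup g (ex_mset 0 (a @ u @ b)) = Poly_Mapping.lookup g (ex_mset 0 (a @ u' @ b))"
proof -
  have "length u = length u' \<and> (\<forall>a. (\<forall>i. length a < i \<and> i < length a + length u \<longrightarrow> swp i g = g) \<longrightarrow>
      Poly_Mapping.lookup g (ex_mset 0 (a @ u @ b)) = Poly_Mapping.lookup g (ex_mset 0 (a @ u' @ b)))"
    using u
  proof (induction rule: mset_eq_swap_induct)
    case (Cons x u v)
    show ?case
    proof (intro conjI allI impI)
      fix a :: "nat list" assume "\<forall>i. length a < i \<and> i < length a + length (x # u) \<longrightarrow> swp i g = g"
      then show "Poly_Mapping.lookup g (ex_mset 0 (a @ (x # u) @ b)) = Poly_Mapping.lookup g (ex_mset 0 (a @ (x # v) @ b))"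
        using Cons[THEN conjunct2, rule_format, of "a @ [x]"] by simp
    qed (use Cons in simp)
  next
    case (swap x y u)
    show ?case
    proof (intro conjI allI impI)
      fix a :: "nat list" assume "\<forall>i. length a < i \<and> i < length a + length (x # y # u) \<longrightarrow> swp i g = g"
      then have "swp (Suc (length a)) g = g" by simp
      then have "Poly_Mapping.lookup g (ex_mset 0 (a @ x # y # u @ b)) =
          Poly_Mapping.lookup g (image_mset (sw (Suc (length a))) (ex_mset 0 (a @ x # y # u @ b)))"
        by (metis lookup_swp)
      then show "Poly_Mapping.lookup g (ex_mset 0 (a @ (x # y # u) @ b)) = Poly_Mapping.lookup g (ex_mset 0 (a @ (y # x # u) @ b))"
        by (simp add: ex_mset_swap)
    qed simp
  qed auto
  then show ?thesis using sym by blast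
qed

lemma sym_lookup:
  assumes "\<And>i. i \<in> inner (length a) Xs \<Longrightarrow> swp i g = g"
    and "length es = sum_list Xs" "length es' = sum_list Xs" "splits Xs es = splits Xs es'"
  shows "Poly_Mapping.lookup g (ex_mset 0 (a @ es)) = Poly_Mapping.lookup g (ex_mset 0 (a @ es'))"
  using assms
proof (induction Xs arbitrary: a es es')
  case (Cons X Xs)
  let ?u = "take X es" and ?u' = "take X es'" and ?r = "drop X es" and ?r' = "drop X es'"
  have len: "length ?u = X" "length ?u' = X" using Cons.prems(2,3) by auto
  have "Poly_Mapping.lookup g (ex_mset 0 (a @ ?u @ ?r)) = Poly_Mapping.lookup g (ex_mset 0 (a @ ?u' @ ?r))"
    using Cons.prems len by (intro sym_lookup_block) auto
  also have "a @ ?u' @ ?r = (a @ ?u') @ ?r" by simp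
  also have "Poly_Mapping.lookup g (ex_mset 0 ((a @ ?u') @ ?r)) = Poly_Mapping.lookup g (ex_mset 0 ((a @ ?u') @ ?r'))"
    using Cons.prems len by (intro Cons.IH) auto
  finally show ?case by simp
qed simp

section \<open>Polynomials with given coefficients\<close>

definition mp :: "(nat multiset list \<Rightarrow> 'k::field) \<Rightarrow> nat list \<Rightarrow> 'k ypoly" where
  "mp F Xs = Abs_poly_mapping (\<lambda>M. if set_mset M \<subseteq> {1..sum_list Xs} then F (splits Xs (expo (sum_list Xs) M)) else 0)"

text \<open>The exponents of a monomial, zeros included, form a total of size
  \<open>sum_list Xs\<close>, so \<open>lfin\<close> bounds them and leaves finitely many monomials.
  This is what gives \<open>Abs_poly_mapping\<close> its meaning in \<open>mp\<close>.\<close>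

lemma mp_finite:
  assumes "lfin (length Xs) F"
  shows "finite {M. (if set_mset M \<subseteq> {1..sum_list Xs} then F (splits Xs (expo (sum_list Xs) M)) else 0) \<noteq> 0}"
proof -
  let ?N = "sum_list Xs"
  obtain b where b: "\<And>L. length L = length Xs \<Longrightarrow> size (sum_list L) \<le> ?N \<Longrightarrow> F L \<noteq> 0 \<Longrightarrow> \<forall>i\<in>#sum_list L. i \<le> b"
    using assms unfolding lfin_def by metis
  have "{M. (if set_mset M \<subseteq> {1..?N} then F (splits Xs (expo ?N M)) else 0) \<noteq> 0}
    \<subseteq> ex_mset 0 ` {es. set es \<subseteq> {..b} \<and> length es = ?N}"
  proof
    fix M assume "M \<in> {M. (if set_mset M \<subseteq> {1..?N} then F (splits Xs (expo ?N M)) else 0) \<noteq> 0}"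
    then have M: "set_mset M \<subseteq> {1..?N}" "F (splits Xs (expo ?N M)) \<noteq> 0" by (auto split: if_splits)
    have "set (expo ?N M) \<subseteq> {..b}" using b[OF _ _ M(2)] by (auto simp: sum_splits simp del: set_mset_sum_list)
    then show "M \<in> ex_mset 0 ` {es. set es \<subseteq> {..b} \<and> length es = ?N}"
      using ex_mset_expo[OF M(1)] by (intro image_eqI[of _ _ "expo ?N M"]) auto
  qed
  then show ?thesis by (rule finite_subset) (intro finite_imageI finite_lists_length_eq finite_atMost)
qed

lemma lookup_mp:
  "lfin (length Xs) F \<Longrightarrow> Poly_Mapping.lookup (mp F Xs) M =
    (if set_mset M \<subseteq> {1..sum_list Xs} then F (splits Xs (expo (sum_list Xs) M)) else 0)"
  unfolding mp_def by (simp only: lookup_Abs_poly_mapping[OF mp_finite])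

lemma lookup_mp_ex:
  "lfin (length Xs) F \<Longrightarrow> length es = sum_list Xs \<Longrightarrow> Poly_Mapping.lookup (mp F Xs) (ex_mset 0 es) = F (splits Xs es)"
  using set_ex_mset[of 0 es] by (simp add: lookup_mp expo_ex_mset)

lemma mp_vars: "lfin (length Xs) F \<Longrightarrow> mp F Xs \<in> vars_upto (sum_list Xs)"
  unfolding vars_upto_def by (auto simp only: in_keys_iff lookup_mp mem_Collect_eq split: if_splits)

lemma mp_eqI:
  assumes "lfin (length Xs) F" "g \<in> vars_upto (sum_list Xs)"
    and "\<And>es. length es = sum_list Xs \<Longrightarrow> Poly_Mapping.lookup g (ex_mset 0 es) = F (splits Xs es)"
  shows "mp F Xs = g"
proof (rule poly_mapping_eqI)
  fix M
  show "Poly_Mapping.lookup (mp F Xs) M = Poly_Mapping.lookup g M"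
  proof (cases "set_mset M \<subseteq> {1..sum_list Xs}")
    case True
    then show ?thesis using assms(3)[of "expo (sum_list Xs) M"] assms(1) by (simp add: lookup_mp ex_mset_expo)
  next
    case False
    then have "M \<notin> Poly_Mapping.keys g" using assms(2) unfolding vars_upto_def by blast
    then show ?thesis using False assms(1) by (simp add: lookup_mp in_keys_iff)
  qed
qed

lemma mp_cong: "(\<And>L. length L = length Xs \<Longrightarrow> F L = G L) \<Longrightarrow> mp F Xs = mp G Xs"
  unfolding mp_def by (rule arg_cong[of _ _ Abs_poly_mapping]) (simp add: fun_eq_iff)

lemma mp_sym:
  assumes F: "lfin (length Xs) F" and i: "i \<in> inner 0 Xs"
  shows "swp i (mp F Xs) = mp F Xs"
proof (rule sym, rule mp_eqI[OF F])
  have range: "1 \<le> i" "i < sum_list Xs" using i inner_range[of 0 Xs] by auto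
  show "swp i (mp F Xs) \<in> vars_upto (sum_list Xs)"
    by (rule vars_upto_swp[OF mp_vars[OF F] range])
  fix es :: "nat list" assume es: "length es = sum_list Xs"
  let ?a = "take (i - 1) es"
  have "drop (i - 1) es = es ! (i - 1) # es ! i # drop (Suc i) es"
    using range es by (metis Cons_nth_drop_Suc One_nat_def Suc_diff_1 less_imp_diff_less less_le_trans zero_less_one)
  then have split: "es = ?a @ es ! (i - 1) # es ! i # drop (Suc i) es" by (metis append_take_drop_id)
  have a: "Suc (length ?a) = i" using range es by simp
  let ?es = "?a @ es ! i # es ! (i - 1) # drop (Suc i) es"
  have "length ?es = length es" by (subst (2) split) simp
  then have "length ?es = sum_list Xs" using es by simp
  have "Poly_Mapping.lookup (swp i (mp F Xs)) (ex_mset 0 es) = Poly_Mapping.lookup (mp F Xs) (ex_mset 0 ?es)"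
    using ex_mset_swap[of ?a "es ! (i - 1)" "es ! i" "drop (Suc i) es"] split a by (simp add: lookup_swp)
  also have "\<dots> = F (splits Xs ?es)"
    by (rule lookup_mp_ex) fact+
  also have "splits Xs ?es = splits Xs es"
    using splits_swap[of 0 ?a Xs "es ! (i - 1)" "es ! i" "drop (Suc i) es"] i a split by simp
  finally show "Poly_Mapping.lookup (swp i (mp F Xs)) (ex_mset 0 es) = F (splits Xs es)" .
qed

section \<open>Tensor products of polynomials\<close>

definition shiftp :: "nat \<Rightarrow> 'k::field ypoly \<Rightarrow> 'k ypoly" where
  "shiftp m = lift_pm (\<lambda>M. Poly_Mapping.single (image_mset (\<lambda>j. j + m) M))"

lemma shiftp_single [simp]: "shiftp m (Poly_Mapping.single M c) = Poly_Mapping.single (image_mset (\<lambda>j. j + m) M) c"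
  by (simp add: shiftp_def lift_pm_single)

lemma shiftp_add: "shiftp m (f + g) = shiftp m f + shiftp m g"
  unfolding shiftp_def by (rule lift_pm_add) (simp_all add: single_add)

lemma shiftp_vars: "g \<in> vars_upto n \<Longrightarrow> shiftp m g \<in> vars_upto (m + n)"
proof (induction g rule: vars_upto_single_induct)
  case (single M c)
  then have "set_mset (image_mset (\<lambda>j. j + m) M) \<subseteq> {1..m + n}" by fastforce
  then show ?case by (simp only: shiftp_single vars_upto_single)
qed (simp add: shiftp_add vars_upto_add)

lemma vars_upto_mono: "f \<in> vars_upto m \<Longrightarrow> f \<in> vars_upto (m + n)"
  by (fastforce simp: vars_upto_def)

lemma split_mset_unique:
  assumes "set_mset A \<subseteq> {1..m}" "set_mset A' \<subseteq> {1..m}" "\<forall>j\<in>#B. 1 \<le> j" "\<forall>j\<in>#B'. 1 \<le> j"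
    and eq: "A + image_mset (\<lambda>j. j + m) B = A' + image_mset (\<lambda>j. j + m) B'"
  shows "A = A' \<and> B = (B' :: nat multiset)"
proof -
  have 1: "filter_mset (\<lambda>j. j \<le> m) A = A" "filter_mset (\<lambda>j. j \<le> m) A' = A'"
    using assms(1,2) by (auto simp: filter_mset_eq_conv)
  have "filter_mset (\<lambda>j. j \<le> m) (image_mset (\<lambda>j. j + m) B) = {#}" if "\<forall>j\<in>#B. 1 \<le> j" for B
    using that by force
  with arg_cong[OF eq, of "filter_mset (\<lambda>j. j \<le> m)"] have A: "A = A'"
    using assms(3,4) 1 by (simp only: filter_union_mset add_0_right)
  then have "image_mset (\<lambda>j. j + m) B = image_mset (\<lambda>j. j + m) B'" using eq by simp
  then have "image_mset (\<lambda>j. j - m) (image_mset (\<lambda>j. j + m) B) = image_mset (\<lambda>j. j - m) (image_mset (\<lambda>j. j + m) B')" by simp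
  then show ?thesis using A by (simp add: image_mset.compositionality comp_def)
qed

text \<open>The factors involve disjoint sets of variables, so a monomial splits in only one
  way.\<close>

lemma lookup_tensor:
  assumes f: "f \<in> vars_upto m" and g: "g \<in> vars_upto n"
    and A: "set_mset A \<subseteq> {1..m}" and B: "set_mset B \<subseteq> {1..n}"
  shows "Poly_Mapping.lookup (f * shiftp m g) (A + image_mset (\<lambda>j. j + m) B) =
    Poly_Mapping.lookup f A * Poly_Mapping.lookup g B"
  using f
proof (induction f rule: vars_upto_single_induct)
  case (single A' a)
  from g show ?case
  proof (induction g rule: vars_upto_single_induct)
    case (single B' b)
    have "A' + image_mset (\<lambda>j. j + m) B' = A + image_mset (\<lambda>j. j + m) B \<longleftrightarrow> A' = A \<and> B' = B"
      using split_mset_unique[of A' m A B' B] \<open>set_mset A' \<subseteq> {1..m}\<close> single A B by fastforce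
    then show ?case by (auto simp: mult_single lookup_single when_def)
  qed (simp add: shiftp_add distrib_left lookup_add)
qed (simp add: distrib_right lookup_add)

lemma mp_tensor:
  assumes F: "lfin (length Ys) F" and G: "lfin (length Zs) G"
  shows "mp (bar_cup (length Ys) F G) (Ys @ Zs) = mp F Ys * shiftp (sum_list Ys) (mp G Zs)"
proof (rule mp_eqI)
  show "lfin (length (Ys @ Zs)) (bar_cup (length Ys) F G)" using lfin_cup[OF F G] by simp
  show "mp F Ys * shiftp (sum_list Ys) (mp G Zs) \<in> vars_upto (sum_list (Ys @ Zs))"
    using mp_vars[OF F] mp_vars[OF G] by (simp add: vars_upto_mult vars_upto_mono shiftp_vars)
  fix es :: "nat list" assume es: "length es = sum_list (Ys @ Zs)"
  let ?m = "sum_list Ys"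
  let ?a = "take ?m es" and ?b = "drop ?m es"
  have len: "length ?a = ?m" "length ?b = sum_list Zs" using es by auto
  have "ex_mset 0 es = ex_mset 0 ?a + image_mset (\<lambda>j. j + ?m) (ex_mset 0 ?b)"
    using ex_mset_append[of 0 ?a ?b] ex_mset_shift[of 0 ?m ?b] len by simp
  then have "Poly_Mapping.lookup (mp F Ys * shiftp ?m (mp G Zs)) (ex_mset 0 es) =
      Poly_Mapping.lookup (mp F Ys) (ex_mset 0 ?a) * Poly_Mapping.lookup (mp G Zs) (ex_mset 0 ?b)"
    using lookup_tensor[OF mp_vars[OF F] mp_vars[OF G], of "ex_mset 0 ?a" "ex_mset 0 ?b"]
      set_ex_mset[of 0 ?a] set_ex_mset[of 0 ?b] len by simp
  also have "\<dots> = F (splits Ys ?a) * G (splits Zs ?b)"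
    by (simp only: lookup_mp_ex[OF F len(1)] lookup_mp_ex[OF G len(2)])
  finally show "Poly_Mapping.lookup (mp F Ys * shiftp ?m (mp G Zs)) (ex_mset 0 es) = bar_cup (length Ys) F G (splits (Ys @ Zs) es)"
    using splits_append[OF len(1), of Zs ?b] by (simp add: bar_cup_def)
qed

lemma sorted_list_of_multiset_append:
  assumes "\<forall>a\<in>#A. \<forall>b\<in>#B. a \<le> (b :: nat)"
  shows "sorted_list_of_multiset (A + B) = sorted_list_of_multiset A @ sorted_list_of_multiset B"
proof -
  let ?l = "sorted_list_of_multiset A @ sorted_list_of_multiset B"
  have "sorted ?l" using assms by (simp add: sorted_append)
  moreover have "A + B = mset ?l" by simp
  ultimately show ?thesis by (metis sorted_list_of_multiset_mset sorted_sort_id)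
qed

lemma sorted_list_of_multiset_shift:
  "sorted_list_of_multiset (image_mset (\<lambda>j. j + m) M) = map (\<lambda>j. j + m) (sorted_list_of_multiset (M :: nat multiset))"
proof -
  let ?l = "map (\<lambda>j. j + m) (sorted_list_of_multiset M)"
  have "sorted ?l" by (simp add: sorted_map sorted_sorted_list_of_multiset)
  moreover have "image_mset (\<lambda>j. j + m) M = mset ?l" by simp
  ultimately show ?thesis by (metis sorted_list_of_multiset_mset sorted_sort_id)
qed

text \<open>This is an equality in the free algebra, not just a congruence: the shifted variables
  come after those of f, so sorted words concatenate to sorted words.\<close>

lemma sec_tensor:
  assumes "f \<in> vars_upto m"
  shows "sec f * free_map (shift_gen m) (sec g) = sec (f * shiftp m g)"
  using assms
proof (induction f rule: vars_upto_single_induct)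
  case (single A a)
  show ?case
  proof (induction g rule: poly_mapping_add_induct)
    case (single B b)
    have "\<forall>x\<in>#A. \<forall>y\<in>#image_mset (\<lambda>j. j + m) B. x \<le> y"
      using \<open>set_mset A \<subseteq> {1..m}\<close> by fastforce
    from sorted_list_of_multiset_append[OF this] show ?case
      by (simp add: sec_single yword_def mult_single plus_fmon_def sorted_list_of_multiset_shift comp_def)
  qed (simp add: sec_add shiftp_add distrib_left free_map_add)
qed (simp add: sec_add distrib_right)

section \<open>Cochains of the degenerate affine Hecke category\<close>

abbreviation hecke_cat :: "('k::field, nat, (hecke_gen, 'k) free_alg set) tensor_category" where
  "hecke_cat \<equiv> hecke_category"

lemma tens_list_hecke [simp]: "tens_list hecke_cat Xs = sum_list Xs"
  by (simp add: tens_list_def sum_list.eq_foldr)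

abbreviation lens :: "nat \<Rightarrow> nat list set" where
  "lens n \<equiv> {Xs. length Xs = n}"

lemma ob_lists_hecke: "ob_lists hecke_cat n = lens n"
  by (simp add: ob_lists_def)

lemma HC_eq: "p \<in> HF n \<Longrightarrow> q \<in> HF n \<Longrightarrow> HC n p = HC n q \<longleftrightarrow> heq n p q"
  by (simp add: HC_eq_iff req_def)

text \<open>A representative of the tensor product of the classes of \<open>ps\<close>.\<close>

fun pshift :: "nat list \<Rightarrow> (hecke_gen, 'k::field) free_alg list \<Rightarrow> (hecke_gen, 'k) free_alg" where
  "pshift (X # Xs) (p # ps) = p * free_map (shift_gen X) (pshift Xs ps)"
| "pshift _ _ = 1"

lemma pshift_HF: "list_all2 (\<lambda>X p. p \<in> HF X) Xs ps \<Longrightarrow> pshift Xs ps \<in> HF (sum_list Xs)"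
  by (induction rule: list_all2_induct) (simp_all add: free_mult HF_mono HF_shift)

lemma tens_mor_list_diag:
  "list_all2 (\<lambda>X p. p \<in> HF X) Xs ps \<Longrightarrow>
    tens_mor_list hecke_cat Xs Xs (map2 HC Xs ps) = HC (sum_list Xs) (pshift Xs ps)"
  by (induction rule: list_all2_induct) (simp_all add: tens_hecke_HC pshift_HF)

text \<open>Different lists of objects can have the same sum, and then the tensor product is an
  endomorphism; it is zero because one of its factors is.\<close>

lemma tens_mor_list_offdiag:
  assumes "length Ys = length Xs" "length fs = length Xs"
    and "\<And>i. i < length Xs \<Longrightarrow> fs ! i \<in> carrier (hecke_hom (Xs ! i) (Ys ! i))"
  shows "tens_mor_list hecke_cat Xs Ys fs \<in> carrier (hecke_hom (sum_list Xs) (sum_list Ys)) \<and>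
    (Xs \<noteq> Ys \<longrightarrow> tens_mor_list hecke_cat Xs Ys fs = \<zero>\<^bsub>hecke_hom (sum_list Xs) (sum_list Ys)\<^esub>)"
  using assms
proof (induction Xs arbitrary: Ys fs)
  case Nil
  then show ?case by (auto simp: ha_carrier)
next
  case (Cons X Xs)
  obtain Y Ys' f fs' where eq: "Ys = Y # Ys'" "fs = f # fs'"
    using Cons.prems(1,2) by (metis Suc_length_conv length_Cons)
  have f: "f \<in> carrier (hecke_hom X Y)" using Cons.prems(3)[of 0] eq by simp
  have IH: "tens_mor_list hecke_cat Xs Ys' fs' \<in> carrier (hecke_hom (sum_list Xs) (sum_list Ys'))"
    "Xs \<noteq> Ys' \<Longrightarrow> tens_mor_list hecke_cat Xs Ys' fs' = \<zero>\<^bsub>hecke_hom (sum_list Xs) (sum_list Ys')\<^esub>"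
    using Cons.IH[of Ys' fs'] Cons.prems eq by fastforce+
  have "tens_mor_list hecke_cat (X # Xs) Ys fs \<in> carrier (hecke_hom (sum_list (X # Xs)) (sum_list Ys))"
    using tensm_closed[OF f IH(1)] eq by simp
  moreover have "tens_mor_list hecke_cat (X # Xs) Ys fs = \<zero>\<^bsub>hecke_hom (sum_list (X # Xs)) (sum_list Ys)\<^esub>"
    if ne: "X # Xs \<noteq> Ys"
  proof (cases "X = Y")
    case True
    then show ?thesis using tens_zero_right[OF f] IH(2) ne eq by simp
  next
    case False
    show ?thesis using tens_zero_left[OF IH(1), of X Y] hh_offdiag[OF f False] eq by simp
  qed
  ultimately show ?case by blast
qed

lemma list_all2_HC:
  assumes "length fs = length Xs" "\<And>i. i < length Xs \<Longrightarrow> fs ! i \<in> carrier (hecke_hom (Xs ! i) (Xs ! i))"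
  shows "\<exists>ps. list_all2 (\<lambda>X p. p \<in> HF X) Xs ps \<and> fs = map2 HC Xs ps"
  using assms
proof (induction Xs arbitrary: fs)
  case (Cons X Xs)
  obtain f fs' where eq: "fs = f # fs'" using Cons.prems(1) by (metis Suc_length_conv length_Cons)
  obtain p where "p \<in> HF X" "f = HC X p" using Cons.prems(2)[of 0] eq by (auto simp: ha_carrier)
  moreover obtain ps where "list_all2 (\<lambda>X p. p \<in> HF X) Xs ps" "fs' = map2 HC Xs ps"
    using Cons.IH[of fs'] Cons.prems eq by fastforce
  ultimately show ?case using eq by (intro exI[of _ "p # ps"]) simp
qed simp

text \<open>For endomorphisms of the \<open>X\<^sub>i\<close> naturality says that the value commutes with the image of
  \<open>\<Lambda>\<^bsub>X\<^sub>1\<^esub> \<otimes> \<dots> \<otimes> \<Lambda>\<^bsub>X\<^sub>n\<^esub>\<close>; between different objects it is vacuous.\<close>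

lemma cochains_hecke_iff:
  "a \<in> cochains hecke_cat n \<longleftrightarrow>
    (\<exists>q. a = (\<lambda>Xs\<in>lens n. HC (sum_list Xs) (q Xs)) \<and>
      (\<forall>Xs. length Xs = n \<longrightarrow> q Xs \<in> HF (sum_list Xs) \<and>
        (\<forall>ps. list_all2 (\<lambda>X p. p \<in> HF X) Xs ps \<longrightarrow> heq (sum_list Xs) (q Xs * pshift Xs ps) (pshift Xs ps * q Xs))))"
    (is "_ \<longleftrightarrow> (\<exists>q. ?P q)")
proof
  assume a: "a \<in> cochains hecke_cat n"
  then have mem: "\<And>Xs. length Xs = n \<Longrightarrow> a Xs \<in> carrier (hecke_algebra (sum_list Xs))"
    and ext: "a \<in> extensional (lens n)" and nat: "natural_family hecke_cat n a"
    by (auto simp: cochains_def ob_lists_hecke PiE_def)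
  have "\<exists>q. length Xs = n \<longrightarrow> q \<in> HF (sum_list Xs) \<and> a Xs = HC (sum_list Xs) q" for Xs
    using mem[of Xs] by (auto simp: ha_carrier)
  then obtain q where q: "\<And>Xs. length Xs = n \<Longrightarrow> q Xs \<in> HF (sum_list Xs) \<and> a Xs = HC (sum_list Xs) (q Xs)" by metis
  have "?P q"
  proof (intro conjI allI impI)
    show "a = (\<lambda>Xs\<in>lens n. HC (sum_list Xs) (q Xs))"
      using ext q by (intro extensionalityI[of a "lens n"]) (auto simp: ob_lists_hecke)
    fix Xs :: "nat list" assume Xs: "length Xs = n"
    show "q Xs \<in> HF (sum_list Xs)" using q Xs by blast
    fix ps :: "(hecke_gen, 'a) free_alg list" assume ps: "list_all2 (\<lambda>X p. p \<in> HF X) Xs ps"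
    have len: "length ps = n" using ps Xs by (simp add: list_all2_lengthD)
    have "Comp hecke_cat (sum_list Xs) (sum_list Xs) (sum_list Xs) (a Xs) (tens_mor_list hecke_cat Xs Xs (map2 HC Xs ps)) =
       Comp hecke_cat (sum_list Xs) (sum_list Xs) (sum_list Xs) (tens_mor_list hecke_cat Xs Xs (map2 HC Xs ps)) (a Xs)"
      using nat Xs len ps unfolding natural_family_def
      by (auto simp: ob_lists_hecke ha_carrier list_all2_conv_all_nth)
    then show "heq (sum_list Xs) (q Xs * pshift Xs ps) (pshift Xs ps * q Xs)"
      using q[OF Xs] pshift_HF[OF ps] by (simp add: tens_mor_list_diag[OF ps] comp_hecke_HC HC_eq free_mult)
  qed
  then show "\<exists>q. ?P q" by blast
next
  assume "\<exists>q. ?P q"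
  then obtain q where a: "a = (\<lambda>Xs\<in>lens n. HC (sum_list Xs) (q Xs))"
    and q: "\<And>Xs. length Xs = n \<Longrightarrow> q Xs \<in> HF (sum_list Xs)"
    and comm: "\<And>Xs ps. length Xs = n \<Longrightarrow> list_all2 (\<lambda>X p. p \<in> HF X) Xs ps \<Longrightarrow>
      heq (sum_list Xs) (q Xs * pshift Xs ps) (pshift Xs ps * q Xs)" by blast
  have val: "a Xs = HC (sum_list Xs) (q Xs)" if "length Xs = n" for Xs
    using that by (simp add: a ob_lists_hecke)
  have mem: "a Xs \<in> carrier (hecke_hom (sum_list Xs) (sum_list Xs))" if "length Xs = n" for Xs
    using that q by (simp add: val ha_carrier)
  have "natural_family hecke_cat n a"
    unfolding natural_family_def
  proof (intro ballI allI impI)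
    fix Xs Ys :: "nat list" and fs :: "(hecke_gen, 'a) free_alg set list"
    assume "Xs \<in> ob_lists (hecke_cat :: ('a, nat, _) tensor_category) n" "Ys \<in> ob_lists (hecke_cat :: ('a, nat, _) tensor_category) n"
    then have len: "length Xs = n" "length Ys = n" by (auto simp: ob_lists_hecke)
    assume fs: "length fs = n \<and> (\<forall>i<n. fs ! i \<in> mor hecke_cat (Xs ! i) (Ys ! i))"
    let ?t = "tens_mor_list hecke_cat Xs Ys fs"
    show "Comp hecke_cat (tens_list hecke_cat Xs) (tens_list hecke_cat Ys) (tens_list hecke_cat Ys) (a Ys) ?t =
      Comp hecke_cat (tens_list hecke_cat Xs) (tens_list hecke_cat Xs) (tens_list hecke_cat Ys) ?t (a Xs)"
    proof (cases "Xs = Ys")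
      case False
      have "?t = \<zero>\<^bsub>hecke_hom (sum_list Xs) (sum_list Ys)\<^esub>"
        using tens_mor_list_offdiag[of Ys Xs fs] fs len False by auto
      then show ?thesis using comp_zero_left[OF mem] comp_zero_right[OF mem] mem len
        by (metis comp_zero_left comp_zero_right tens_list_hecke)
    next
      case True
      obtain ps where ps: "list_all2 (\<lambda>X p. p \<in> HF X) Xs ps" "fs = map2 HC Xs ps"
        using list_all2_HC[of fs Xs] fs len True by auto
      show ?thesis using ps(2) True[symmetric] comm[OF len(1) ps(1)] q[OF len(1)] pshift_HF[OF ps(1)]
        by (simp add: val[OF len(1)] tens_mor_list_diag[OF ps(1)] comp_hecke_HC HC_eq free_mult del: tens_mor_list.simps)
    qed
  qed
  then show "a \<in> cochains hecke_cat n"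
    using mem by (auto simp: cochains_def a ob_lists_hecke)
qed

section \<open>Naturality tested on generators\<close>

text \<open>Generators of the image of the tensor product of the algebras of the blocks.\<close>

definition block_gens :: "nat list \<Rightarrow> hecke_gen set" where
  "block_gens Xs = T ` inner 0 Xs \<union> Y ` {1..sum_list Xs}"

lemma block_gens_subset: "block_gens Xs \<subseteq> hecke_gens (sum_list Xs)"
  using inner_range[of 0 Xs] by (auto simp: block_gens_def)

lemma inner_shift: "inner (p + m) Xs = (\<lambda>i. i + m) ` inner p Xs"
proof (induction Xs arbitrary: p)
  case (Cons X Xs)
  have "{p + m<..<p + m + X} = (\<lambda>i. i + m) ` {p<..<p + X}"
  proof (intro equalityI subsetI)
    fix x assume "x \<in> {p + m<..<p + m + X}"
    then show "x \<in> (\<lambda>i. i + m) ` {p<..<p + X}" by (intro image_eqI[of _ _ "x - m"]) auto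
  qed auto
  moreover have "inner (p + m + X) Xs = (\<lambda>i. i + m) ` inner (p + X) Xs"
    using Cons[of "p + X"] by (simp add: add_ac)
  ultimately show ?case by (simp add: image_Un)
qed simp

lemma block_gens_Cons: "block_gens (X # Xs) = hecke_gens X \<union> shift_gen X ` block_gens Xs"
proof
  show "block_gens (X # Xs) \<subseteq> hecke_gens X \<union> shift_gen X ` block_gens Xs"
  proof
    fix g assume "g \<in> block_gens (X # Xs)"
    then consider i where "g = T i" "0 < i" "i < X" | i where "g = T i" "i \<in> inner X Xs"
      | j where "g = Y j" "1 \<le> j" "j \<le> X" | j where "g = Y j" "X < j" "j \<le> X + sum_list Xs"
      by (auto simp: block_gens_def) (metis not_le)
    then show "g \<in> hecke_gens X \<union> shift_gen X ` block_gens Xs"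
    proof cases
      case 2
      then obtain i' where "i = i' + X" "i' \<in> inner 0 Xs" using inner_shift[of 0 X Xs] by auto
      then have "g = shift_gen X (T i')" "T i' \<in> block_gens Xs" using 2 by (auto simp: block_gens_def)
      then show ?thesis by blast
    next
      case 4
      then have "j - X \<in> {1..sum_list Xs}" by auto
      then have "g = shift_gen X (Y (j - X))" "Y (j - X) \<in> block_gens Xs" using 4 unfolding block_gens_def by simp_all
      then show ?thesis by blast
    qed auto
  qed
  show "hecke_gens X \<union> shift_gen X ` block_gens Xs \<subseteq> block_gens (X # Xs)"
    using inner_shift[of 0 X Xs] by (auto simp: block_gens_def hecke_gens_def)
qed

lemma free_mono: "p \<in> carrier (free_algebra A) \<Longrightarrow> A \<subseteq> B \<Longrightarrow> p \<in> carrier (free_algebra B)"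
  by (fastforce simp: free_carrier)

lemma pshift_block_gens:
  "list_all2 (\<lambda>X p. p \<in> HF X) Xs ps \<Longrightarrow> pshift Xs ps \<in> carrier (free_algebra (block_gens Xs))"
proof (induction rule: list_all2_induct)
  case (Cons X Xs p ps)
  have "free_map (shift_gen X) (pshift Xs ps) \<in> carrier (free_algebra (shift_gen X ` block_gens Xs))"
    using Cons by (intro free_map_closed) auto
  then show ?case using Cons unfolding block_gens_Cons pshift.simps
    by (intro free_mult) (auto intro: free_mono)
qed simp

lemma block_gens_pshift:
  "g \<in> block_gens Xs \<Longrightarrow> \<exists>ps. list_all2 (\<lambda>X p. p \<in> HF X) Xs ps \<and> pshift Xs ps = (gen g :: (hecke_gen, 'k::field) free_alg)"
proof (induction Xs arbitrary: g)
  case Nil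
  then show ?case by (simp add: block_gens_def)
next
  case (Cons X Xs)
  have ones: "list_all2 (\<lambda>X p. p \<in> HF X) Xs (map (\<lambda>_. 1 :: (hecke_gen, 'k) free_alg) Xs)"
    "pshift Xs (map (\<lambda>_. 1) Xs) = (1 :: (hecke_gen, 'k) free_alg)" for Xs
    by (induction Xs) auto
  consider "g \<in> hecke_gens X" | g' where "g' \<in> block_gens Xs" "g = shift_gen X g'"
    using Cons.prems unfolding block_gens_Cons by blast
  then show ?case
  proof cases
    case 1
    then show ?thesis using ones[of Xs] by (intro exI[of _ "gen g # map (\<lambda>_. 1) Xs"]) (auto intro: free_gen)
  next
    case 2
    obtain ps where "list_all2 (\<lambda>X p. p \<in> HF X) Xs ps" "pshift Xs ps = (gen g' :: (hecke_gen, 'k) free_alg)" using Cons.IH[OF 2(1)] by blast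
    then show ?thesis using 2 by (intro exI[of _ "1 # ps"]) auto
  qed
qed

lemma heq_commute_gens:
  assumes x: "x \<in> HF n" and S: "S \<subseteq> hecke_gens n"
    and comm: "\<And>g. g \<in> S \<Longrightarrow> heq n (x * gen g) (gen g * x)"
    and y: "y \<in> carrier (free_algebra S)"
  shows "heq n (x * y) (y * x)"
  using y
proof (induction rule: free_induct)
  case (scal c)
  then show ?case by (simp add: scal_comm heq_refl)
next
  case (gen g)
  then show ?case by (rule comm)
next
  case (add p q)
  then show ?case by (simp add: distrib_left distrib_right heq_add)
next
  case (mult p q)
  then have "p \<in> HF n" "q \<in> HF n" using S free_mono by blast+
  then have "heq n (x * p * q) (p * x * q)" "heq n (p * (x * q)) (p * (q * x))"
    using mult heq_left heq_right by blast+
  then show ?case using heq_trans by (simp add: mult.assoc)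
qed

section \<open>Cochains as coefficient functions\<close>

definition coch :: "nat \<Rightarrow> (nat multiset list \<Rightarrow> 'k::field) \<Rightarrow> nat list \<Rightarrow> (hecke_gen, 'k) free_alg set" where
  "coch n F = (\<lambda>Xs\<in>lens n. HC (sum_list Xs) (sec (mp F Xs)))"

lemma coch_apply: "length Xs = n \<Longrightarrow> coch n F Xs = HC (sum_list Xs) (sec (mp F Xs))"
  by (simp add: coch_def ob_lists_hecke)

lemma coch_eqI:
  assumes "f \<in> extensional (lens n)"
    and "\<And>Xs. length Xs = n \<Longrightarrow> f Xs = HC (sum_list Xs) (sec (mp F Xs))"
  shows "f = coch n F"
  using assms by (intro extensionalityI[of f "lens n"]) (auto simp: coch_def ob_lists_hecke)

lemma sec_mp_HF: "lfin (length Xs) F \<Longrightarrow> sec (mp F Xs) \<in> HF (sum_list Xs)"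
  by (rule sec_HF[OF mp_vars])

lemma coch_closed:
  assumes F: "lfin n F"
  shows "coch n F \<in> cochains hecke_cat n"
  unfolding cochains_hecke_iff
proof (intro exI[of _ "\<lambda>Xs. sec (mp F Xs)"] conjI allI impI)
  show "coch n F = (\<lambda>Xs\<in>lens n. HC (sum_list Xs) (sec (mp F Xs)))" by (simp add: coch_def)
  fix Xs :: "nat list" assume Xs: "length Xs = n"
  have F': "lfin (length Xs) F" using F Xs by simp
  show "sec (mp F Xs) \<in> HF (sum_list Xs)" by (rule sec_mp_HF[OF F'])
  fix ps :: "(hecke_gen, 'a) free_alg list" assume ps: "list_all2 (\<lambda>X p. p \<in> HF X) Xs ps"
  show "heq (sum_list Xs) (sec (mp F Xs) * pshift Xs ps) (pshift Xs ps * sec (mp F Xs))"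
  proof (rule heq_commute_gens[OF sec_mp_HF[OF F'] block_gens_subset _ pshift_block_gens[OF ps]])
    fix g assume "g \<in> block_gens Xs"
    then consider i where "g = T i" "i \<in> inner 0 Xs" | j where "g = Y j" "j \<in> {1..sum_list Xs}"
      by (auto simp: block_gens_def)
    then show "heq (sum_list Xs) (sec (mp F Xs) * gen g) (gen g * sec (mp F Xs))"
    proof cases
      case 1
      then have "1 \<le> i" "i < sum_list Xs" using inner_range[of 0 Xs] by auto
      from sec_commute_T[OF this mp_vars[OF F']] mp_sym[OF F' 1(2)] 1 show ?thesis by (auto intro: heq_sym)
    next
      case 2
      then show ?thesis using heq_sym[OF sec_commute_Y[OF _ mp_vars[OF F']]] by simp
    qed
  qed
qed

text \<open>Naturality makes the values polynomials (\<open>centralizer_Y\<close>) that are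
  symmetric in each block (\<open>sec_commute_T\<close>). \<open>F L\<close> reads the objects off
  the sizes of the entries; by symmetry the chosen arrangement \<open>es\<close> of the exponents
  does not matter.\<close>

lemma coch_surj:
  assumes a: "a \<in> cochains hecke_cat n"
  shows "\<exists>F. lfin n F \<and> a = coch n F"
proof -
  obtain q where aq: "a = (\<lambda>Xs\<in>lens n. HC (sum_list Xs) (q Xs))"
    and q: "\<And>Xs. length Xs = n \<Longrightarrow> q Xs \<in> HF (sum_list Xs)"
    and comm: "\<And>Xs ps. length Xs = n \<Longrightarrow> list_all2 (\<lambda>X p. p \<in> HF X) Xs ps \<Longrightarrow>
      heq (sum_list Xs) (q Xs * pshift Xs ps) (pshift Xs ps * q Xs)"
    using a unfolding cochains_hecke_iff by blast
  have comm_gen: "heq (sum_list Xs) (q Xs * gen g) (gen g * q Xs)" if "length Xs = n" "g \<in> block_gens Xs" for Xs g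
    using comm[OF that(1)] block_gens_pshift[OF that(2)] by metis
  have "\<exists>g\<in>vars_upto (sum_list Xs). heq (sum_list Xs) (q Xs) (sec g)" if Xs: "length Xs = n" for Xs
    by (rule centralizer_Y[OF q[OF Xs]]) (auto intro!: heq_sym[OF comm_gen[OF Xs]] simp: block_gens_def)
  then obtain g where g: "\<And>Xs. length Xs = n \<Longrightarrow> g Xs \<in> vars_upto (sum_list Xs) \<and> heq (sum_list Xs) (q Xs) (sec (g Xs))"
    by metis
  have sym: "swp i (g Xs) = g Xs" if Xs: "length Xs = n" and i: "i \<in> inner 0 Xs" for Xs i
  proof -
    have i': "1 \<le> i" "i < sum_list Xs" using i inner_range[of 0 Xs] by auto
    note gX = g[OF Xs, THEN conjunct1] g[OF Xs, THEN conjunct2]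
    have "heq (sum_list Xs) (tt i * sec (g Xs)) (tt i * q Xs)"
      by (rule heq_left[OF heq_sym[OF gX(2)] tt_HF[OF i']])
    also have "heq (sum_list Xs) (tt i * q Xs) (q Xs * tt i)"
      by (rule heq_sym[OF comm_gen[OF Xs]]) (use i in \<open>simp add: block_gens_def\<close>)
    also have "heq (sum_list Xs) (q Xs * tt i) (sec (g Xs) * tt i)"
      by (rule heq_right[OF gX(2) tt_HF[OF i']])
    finally show ?thesis by (simp add: sec_commute_T[OF i' gX(1)])
  qed
  define F where "F L = (let Xs = map size L; es = SOME es. length es = sum_list Xs \<and> splits Xs es = L
    in Poly_Mapping.lookup (g Xs) (ex_mset 0 es))" for L
  have F: "F (splits Xs es) = Poly_Mapping.lookup (g Xs) (ex_mset 0 es)" if Xs: "length Xs = n" and es: "length es = sum_list Xs" for Xs es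
  proof -
    define es' where "es' = (SOME es'. length es' = sum_list Xs \<and> splits Xs es' = splits Xs es)"
    have es': "length es' = sum_list Xs \<and> splits Xs es' = splits Xs es"
      unfolding es'_def by (rule someI[of _ es]) (use es in simp)
    have "F (splits Xs es) = Poly_Mapping.lookup (g Xs) (ex_mset 0 es')"
      unfolding F_def size_splits[OF es] Let_def es'_def ..
    also have "\<dots> = Poly_Mapping.lookup (g Xs) (ex_mset 0 es)"
      using sym_lookup[of "[]" Xs "g Xs" es' es] sym[OF Xs] es es' by simp
    finally show ?thesis .
  qed
  have fin: "lfin n F"
    unfolding lfin_def
  proof
    fix s
    \<comment> \<open>Totals of size at most s involve finitely many \<open>Xs\<close>, hence
      finitely many polynomials. An exponent is at most the degree of its monomial, and the sum of
      all these degrees is a common bound.\<close>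
    let ?K = "\<Union>Xs\<in>{Xs. set Xs \<subseteq> {..s} \<and> length Xs = n}. Poly_Mapping.keys (g Xs)"
    have K: "finite ?K" by (intro finite_UN_I finite_lists_length_eq) auto
    show "\<exists>b. \<forall>L. length L = n \<longrightarrow> size (sum_list L) \<le> s \<longrightarrow> F L \<noteq> 0 \<longrightarrow> (\<forall>i\<in>#sum_list L. i \<le> b)"
    proof (intro exI[of _ "\<Sum>M\<in>?K. size M"] allI impI ballI)
      fix L i assume L: "length L = n" "size (sum_list L) \<le> s" "F L \<noteq> 0" "i \<in># sum_list L"
      let ?Xs = "map size L"
      obtain es where es: "length es = sum_list ?Xs" "splits ?Xs es = L" using splits_surj by blast
      have sum: "sum_list L = mset es" using sum_splits[OF es(1)] es(2) by simp
      have "Poly_Mapping.lookup (g ?Xs) (ex_mset 0 es) \<noteq> 0" using F[of ?Xs es] es L by simp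
      then have k: "ex_mset 0 es \<in> Poly_Mapping.keys (g ?Xs)" by (simp add: in_keys_iff)
      have "size (sum_list L) = sum_list ?Xs" using es sum by simp
      then have "set ?Xs \<subseteq> {..s}" using L(2) member_le_sum_list by fastforce
      then have kK: "ex_mset 0 es \<in> ?K" using k L(1) by (intro UN_I[of ?Xs]) simp_all
      have "i \<in> set es" using L(4) sum by simp
      then obtain k where "k < length es" "es ! k = i" by (auto simp: in_set_conv_nth)
      then have "count (ex_mset 0 es) (Suc k) = i" by (simp add: count_ex_mset)
      then have "i \<le> size (ex_mset 0 es)" by (metis count_le_size)
      also have "\<dots> \<le> (\<Sum>M\<in>?K. size M)" by (rule member_le_sum[OF kK _ K]) simp
      finally show "i \<le> (\<Sum>M\<in>?K. size M)" .
    qed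
  qed
  moreover have "a = coch n F"
  proof (rule coch_eqI)
    show "a \<in> extensional (lens n)" by (simp add: aq)
    fix Xs :: "nat list" assume Xs: "length Xs = n"
    have "mp F Xs = g Xs"
      using g[OF Xs] F[OF Xs] fin Xs by (intro mp_eqI) auto
    then show "a Xs = HC (sum_list Xs) (sec (mp F Xs))"
      using g[OF Xs] q[OF Xs] Xs by (simp add: aq ob_lists_hecke HC_eq sec_HF)
  qed
  ultimately show ?thesis by blast
qed

lemma coch_eq_iff:
  assumes F: "lfin n F" and G: "lfin n G"
  shows "coch n F = coch n G \<longleftrightarrow> (\<forall>L. length L = n \<longrightarrow> F L = G L)"
proof
  assume eq: "coch n F = coch n G"
  show "\<forall>L. length L = n \<longrightarrow> F L = G L"
  proof (intro allI impI)
    fix L :: "nat multiset list" assume L: "length L = n"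
    let ?Xs = "map size L"
    have Xs: "length ?Xs = n" using L by simp
    have F': "lfin (length ?Xs) F" and G': "lfin (length ?Xs) G" using F G L by simp_all
    obtain es where es: "length es = sum_list ?Xs" "splits ?Xs es = L" using splits_surj by blast
    have "heq (sum_list ?Xs) (sec (mp F ?Xs)) (sec (mp G ?Xs))"
      using arg_cong[OF eq, of "\<lambda>a. a ?Xs"] sec_mp_HF[OF F'] sec_mp_HF[OF G'] by (simp add: coch_apply[OF Xs] HC_eq)
    then have "mp F ?Xs = mp G ?Xs" by (rule sec_inject)
    then show "F L = G L" using lookup_mp_ex[OF F' es(1)] lookup_mp_ex[OF G' es(1)] es(2) by simp
  qed
next
  assume "\<forall>L. length L = n \<longrightarrow> F L = G L"
  then show "coch n F = coch n G"
    unfolding coch_def by (intro restrict_ext) (auto simp: ob_lists_hecke intro!: arg_cong[of _ _ "\<lambda>f. HC _ (sec f)"] mp_cong)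
qed

lemma lookup_cst_mult: "Poly_Mapping.lookup (cst c * f) M = c * Poly_Mapping.lookup f M"
  by (induction f rule: poly_mapping_add_induct)
    (auto simp: mult_single lookup_single when_def distrib_left lookup_add)

lemma coch_add:
  assumes F: "lfin n F" and G: "lfin n G"
  shows "coch n F \<oplus>\<^bsub>cochain_space hecke_cat n\<^esub> coch n G = coch n (\<lambda>L. F L + G L)"
proof (rule coch_eqI)
  fix Xs :: "nat list" assume Xs: "length Xs = n"
  have F': "lfin (length Xs) F" and G': "lfin (length Xs) G" using F G Xs by simp_all
  have "mp (\<lambda>L. F L + G L) Xs = mp F Xs + mp G Xs"
    by (rule poly_mapping_eqI) (simp add: lookup_mp lfin_add F' G' lookup_add)
  then show "(coch n F \<oplus>\<^bsub>cochain_space hecke_cat n\<^esub> coch n G) Xs = HC (sum_list Xs) (sec (mp (\<lambda>L. F L + G L) Xs))"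
    using sec_mp_HF[OF F'] sec_mp_HF[OF G'] Xs
    by (simp add: cochain_space_def ob_lists_hecke coch_apply ha_add sec_add)
qed (simp add: cochain_space_def ob_lists_hecke)

lemma coch_smult:
  assumes F: "lfin n F"
  shows "c \<odot>\<^bsub>cochain_space hecke_cat n\<^esub> coch n F = coch n (\<lambda>L. c * F L)"
proof (rule coch_eqI)
  fix Xs :: "nat list" assume Xs: "length Xs = n"
  have F': "lfin (length Xs) F" using F Xs by simp
  have "mp (\<lambda>L. c * F L) Xs = cst c * mp F Xs"
    by (rule poly_mapping_eqI) (simp add: lookup_mp lfin_scale F' lookup_cst_mult)
  then show "(c \<odot>\<^bsub>cochain_space hecke_cat n\<^esub> coch n F) Xs = HC (sum_list Xs) (sec (mp (\<lambda>L. c * F L) Xs))"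
    using sec_mp_HF[OF F'] Xs
    by (simp add: cochain_space_def ob_lists_hecke coch_apply ha_smult sec_cst_mult)
qed (simp add: cochain_space_def ob_lists_hecke)

lemma mp_zero: "mp (\<lambda>_. 0) Xs = 0"
  by (rule poly_mapping_eqI) (simp add: lookup_mp lfin_zero)

lemma coch_zero: "\<zero>\<^bsub>cochain_space hecke_cat n\<^esub> = coch n (\<lambda>_. 0)"
  by (rule coch_eqI) (simp_all add: cochain_space_def ob_lists_hecke mp_zero ha_zero)

lemma coch_cup:
  assumes F: "lfin m F" and G: "lfin n G"
  shows "cup hecke_cat m n (coch m F) (coch n G) = coch (m + n) (bar_cup m F G)"
proof (rule coch_eqI)
  fix Xs :: "nat list" assume Xs: "length Xs = m + n"
  let ?Y = "take m Xs" and ?Z = "drop m Xs"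
  have len: "length ?Y = m" "length ?Z = n" using Xs by auto
  have F': "lfin (length ?Y) F" and G': "lfin (length ?Z) G" using F G len by simp_all
  have sum: "sum_list ?Y + sum_list ?Z = sum_list Xs" by (metis append_take_drop_id sum_list_append)
  have mp: "mp (bar_cup m F G) Xs = mp F ?Y * shiftp (sum_list ?Y) (mp G ?Z)"
    using mp_tensor[OF F' G'] len by simp
  have "cup hecke_cat m n (coch m F) (coch n G) Xs =
      HC (sum_list Xs) (sec (mp F ?Y) * free_map (shift_gen (sum_list ?Y)) (sec (mp G ?Z)))"
    using tens_hecke_HC[OF sec_mp_HF[OF F'] sec_mp_HF[OF G']] Xs
    by (simp add: cup_def ob_lists_hecke coch_apply[OF len(1)] coch_apply[OF len(2)] sum del: length_take length_drop)
  then show "cup hecke_cat m n (coch m F) (coch n G) Xs = HC (sum_list Xs) (sec (mp (bar_cup m F G) Xs))"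
    by (simp only: mp sec_tensor[OF mp_vars[OF F']])
qed (simp add: cup_def ob_lists_hecke)

section \<open>The differential on coefficient functions\<close>

definition eps_cochain :: "nat multiset list \<Rightarrow> 'k::comm_ring_1" where
  "eps_cochain L = eps1 (hd L)"

lemma lfin_eps_cochain: "lfin 1 (eps_cochain :: _ \<Rightarrow> 'k::comm_ring_1)"
  unfolding lfin_def
proof (intro allI exI[of _ 0] impI ballI)
  fix L :: "nat multiset list" and i assume "length L = 1" "eps_cochain L \<noteq> (0 :: 'k)" "i \<in># sum_list L"
  then show "i \<le> 0" by (cases L) (auto simp: eps_cochain_def split: if_splits)
qed

text \<open>The monomial 1 has only zero exponents, whatever the size of the block: this is where
  the augmentation \<open>eps1\<close> comes from.\<close>

lemma mp_eps_cochain: "mp eps_cochain [N] = (1 :: 'k::field ypoly)"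
proof (rule mp_eqI)
  show "lfin (length [N]) (eps_cochain :: _ \<Rightarrow> 'k)" using lfin_eps_cochain by simp
  show "(1 :: 'k ypoly) \<in> vars_upto (sum_list [N])" using vars_upto_cst[of 1 "sum_list [N]"] by (simp only: cst_1)
  fix es :: "nat list" assume "length es = sum_list [N]"
  have "ex_mset 0 es = {#} \<longleftrightarrow> set es \<subseteq> {0}"
  proof
    assume "ex_mset 0 es = {#}"
    then have "es ! k = 0" if "k < length es" for k
      using count_ex_mset[of 0 es "Suc k"] that by simp
    then show "set es \<subseteq> {0}" by (auto simp: in_set_conv_nth)
  next
    assume "set es \<subseteq> {0}"
    then have "es ! k = 0" if "k < length es" for k using that nth_mem by fastforce
    then show "ex_mset 0 es = {#}" by (intro multiset_eqI) (auto simp: count_ex_mset)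
  qed
  then show "Poly_Mapping.lookup (1 :: 'k ypoly) (ex_mset 0 es) = eps_cochain (splits [N] es)"
    using \<open>length es = sum_list [N]\<close> by (auto simp: lookup_one eps_cochain_def when_def)
qed

definition face :: "nat \<Rightarrow> nat \<Rightarrow> (nat multiset list \<Rightarrow> 'k::comm_ring_1) \<Rightarrow> nat multiset list \<Rightarrow> 'k" where
  "face n i F L = (if i = 0 then eps1 (hd L) * F (tl L)
     else if i \<le> n then F (take (i - 1) L @ [L ! (i - 1) + L ! i] @ drop (i + 1) L)
     else F (butlast L) * eps1 (last L))"

lemma bar_d_face: "length L = Suc n \<Longrightarrow> bar_d eps1 F L = (\<Sum>i\<le>Suc n. (- 1) ^ i * face n i F L)"
proof (induction L arbitrary: F n rule: induct_list012)
  case (2 M)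
  then show ?case by (simp add: face_def)
next
  case (3 M N L)
  then obtain m where n: "n = Suc m" "length (N # L) = Suc m" by auto
  have f: "face n (Suc (Suc i)) F (M # N # L) = face m (Suc i) (\<lambda>K. F (M # K)) (N # L)" for i
    using n by (auto simp: face_def)
  have IH: "bar_d eps1 (\<lambda>K. F (M # K)) (N # L) = (\<Sum>i\<le>Suc m. (- 1) ^ i * face m i (\<lambda>K. F (M # K)) (N # L))"
    by (rule 3(2)[OF n(2)])
  have "(\<Sum>i\<le>Suc n. (- 1) ^ i * face n i F (M # N # L)) =
      eps1 M * F (N # L) - F ((M + N) # L) + (\<Sum>i\<le>m. (- 1) ^ i * face m (Suc i) (\<lambda>K. F (M # K)) (N # L))"
    unfolding n(1) sum.atMost_Suc_shift by (simp add: f[unfolded n(1)]) (simp add: face_def)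
  also have "(\<Sum>i\<le>m. (- 1) ^ i * face m (Suc i) (\<lambda>K. F (M # K)) (N # L)) =
      eps1 N * F (M # L) - bar_d eps1 (\<lambda>K. F (M # K)) (N # L)"
    unfolding IH sum.atMost_Suc_shift by (simp add: face_def[of _ 0] sum_negf)
  finally show ?case by simp
qed simp

lemma merge_splits:
  assumes "i < length Xs - 1" "length es = sum_list Xs"
  shows "splits (take i Xs @ [Xs ! i + Xs ! Suc i] @ drop (i + 2) Xs) es =
    take i (splits Xs es) @ [splits Xs es ! i + splits Xs es ! Suc i] @ drop (i + 2) (splits Xs es)"
  using assms
proof (induction i arbitrary: Xs es)
  case 0
  then obtain X Y Zs where "Xs = X # Y # Zs" by (cases Xs; cases "tl Xs") auto
  then show ?case by (simp add: take_add drop_drop add.commute)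
next
  case (Suc i)
  then obtain X Zs where "Xs = X # Zs" by (cases Xs) auto
  then show ?case using Suc.IH[of Zs "drop X es"] Suc.prems by simp
qed

lemma sum_list_merge:
  "i + 1 < length L \<Longrightarrow> sum_list (take i L @ [L ! i + L ! Suc i] @ drop (i + 2) L) = (sum_list L :: 'a::comm_monoid_add)"
proof (induction i arbitrary: L)
  case 0
  then obtain X Y Zs where "L = X # Y # Zs" by (cases L; cases "tl L") auto
  then show ?case by (simp add: add.assoc)
next
  case (Suc i)
  then obtain X Zs where "L = X # Zs" by (cases L) auto
  then show ?case using Suc by simp
qed

text \<open>An outer face is a product with \<open>eps_cochain\<close>, that is, with the polynomial
  1 in an additional block. An inner face keeps the polynomial; the exponents in the merged block
  form the sum of two multisets.\<close>

lemma coface_coch: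
  assumes F: "lfin n F" and Xs: "length Xs = Suc n" and i: "i \<le> Suc n"
  shows "coface hecke_cat n i (coch n F) Xs = HC (sum_list Xs) (sec (mp (face n i F) Xs)) \<and>
     sec (mp (face n i F) Xs) \<in> HF (sum_list Xs) \<and> lfin (Suc n) (face n i F)"
proof -
  have e: "lfin (length [N]) eps_cochain" for N :: nat using lfin_eps_cochain by simp
  consider "i = 0" | "0 < i" "i \<le> n" | "i = Suc n" using i by linarith
  then show ?thesis
  proof cases
    case 1
    obtain X Zs where eq: "Xs = X # Zs" "length Zs = n" using Xs by (cases Xs) auto
    have F': "lfin (length Zs) F" using F eq by simp
    have face: "face n i F L = bar_cup 1 eps_cochain F L" if "length L = Suc n" for L
      using that 1 by (cases L) (auto simp: face_def bar_cup_def eps_cochain_def)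
    have mp: "mp (face n i F) Xs = mp eps_cochain (X # []) * shiftp X (mp F Zs)"
      using mp_tensor[OF e[of X] F'] mp_cong[of Xs, OF face] Xs eq by simp
    have "sec (mp (face n i F) Xs) = 1 * free_map (shift_gen X) (sec (mp F Zs))"
    proof -
      have "sec (mp eps_cochain (X # [])) = (1 :: (hecke_gen, 'a) free_alg)"
        unfolding mp_eps_cochain cst_1[symmetric] sec_cst by simp
      then show ?thesis using sec_tensor[OF mp_vars[OF e[of X]], of "mp F Zs"] by (simp add: mp)
    qed
    then have "coface hecke_cat n i (coch n F) Xs = HC (sum_list Xs) (sec (mp (face n i F) Xs))"
      using tens_hecke_HC[OF _ sec_mp_HF[OF F'], of 1 X] 1 eq by (simp add: coface_def coch_apply)
    moreover have L: "lfin (Suc n) (face n i F)"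
      using lfin_cup[OF lfin_eps_cochain F] face by (elim lfin_supp) auto
    ultimately show ?thesis using sec_mp_HF[of Xs "face n i F"] Xs by simp
  next
    case 3
    obtain Z Ys where eq: "Xs = Ys @ [Z]" "length Ys = n" using Xs by (cases Xs rule: rev_cases) auto
    have F': "lfin (length Ys) F" using F eq by simp
    have face: "face n i F L = bar_cup n F eps_cochain L" if "length L = Suc n" for L
      using that 3 by (cases L rule: rev_cases) (auto simp: face_def bar_cup_def eps_cochain_def)
    have mp: "mp (face n i F) Xs = mp F Ys * shiftp (sum_list Ys) (mp eps_cochain [Z])"
      using mp_tensor[OF F' e[of Z]] mp_cong[of Xs, OF face] Xs eq by simp
    have "sec (mp (face n i F) Xs) = sec (mp F Ys) * free_map (shift_gen (sum_list Ys)) 1"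
    proof -
      have "sec (mp eps_cochain [Z]) = (1 :: (hecke_gen, 'a) free_alg)"
        unfolding mp_eps_cochain cst_1[symmetric] sec_cst by simp
      then show ?thesis using sec_tensor[OF mp_vars[OF F'], of "mp eps_cochain [Z]"] by (simp only: mp)
    qed
    then have "coface hecke_cat n i (coch n F) Xs = HC (sum_list Xs) (sec (mp (face n i F) Xs))"
      using tens_hecke_HC[OF sec_mp_HF[OF F'], of 1 Z] 3 eq by (simp add: coface_def coch_apply)
    moreover have L: "lfin (Suc n) (face n i F)"
      using lfin_cup[OF F lfin_eps_cochain] face by (elim lfin_supp) auto
    ultimately show ?thesis using sec_mp_HF[of Xs "face n i F"] Xs by simp
  next
    case 2
    then obtain j where j: "i = Suc j" "j < n" by (cases i) auto
    let ?m = "\<lambda>L. take j L @ [L ! j + L ! Suc j] @ drop (j + 2) L"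
    have face: "face n i F L = F (?m L)" for L using 2 j by (simp add: face_def)
    have sum: "sum_list (?m Xs) = sum_list Xs" using j Xs by (intro sum_list_merge) simp
    have len: "length (?m Xs) = n" using j Xs by simp
    have F': "lfin (length (?m Xs)) F" using F len by simp
    have L: "lfin (Suc n) (face n i F)"
    proof (rule lfin_supp[OF F])
      fix L assume "length L = Suc n" "face n i F L \<noteq> 0"
      then have "length (?m L) = n" "sum_list (?m L) = sum_list L" "F (?m L) \<noteq> 0"
        using j(2) sum_list_merge[of j L] by (simp_all only: face) simp_all
      then show "\<exists>K. length K = n \<and> sum_list K = sum_list L \<and> F K \<noteq> 0" by blast
    qed
    have "mp (face n i F) Xs = mp F (?m Xs)"
    proof (rule mp_eqI)
      show "lfin (length Xs) (face n i F)" using L Xs by simp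
      show "mp F (?m Xs) \<in> vars_upto (sum_list Xs)" using mp_vars[OF F'] sum by simp
      fix es :: "nat list" assume es: "length es = sum_list Xs"
      then have "Poly_Mapping.lookup (mp F (?m Xs)) (ex_mset 0 es) = F (splits (?m Xs) es)"
        using sum by (intro lookup_mp_ex[OF F']) simp
      also have "splits (?m Xs) es = ?m (splits Xs es)" using j Xs es by (intro merge_splits) auto
      finally show "Poly_Mapping.lookup (mp F (?m Xs)) (ex_mset 0 es) = face n i F (splits Xs es)"
        by (simp add: face)
    qed
    moreover have "coface hecke_cat n i (coch n F) Xs = coch n F (?m Xs)"
      using 2 j by (simp add: coface_def)
    ultimately show ?thesis using coch_apply[OF len, of F] sum sec_mp_HF[of Xs "face n i F"] Xs L by simp
  qed
qed

lemma finsum_HC: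
  fixes f :: "'i \<Rightarrow> (hecke_gen, 'a::field) free_alg"
  assumes "finite A" "\<And>i. i \<in> A \<Longrightarrow> f i \<in> HF n"
  shows "finsum (hecke_algebra n) (\<lambda>i. HC n (f i)) A = HC n (\<Sum>i\<in>A. f i)"
proof -
  interpret M: Module.module "ring_of_type_algebra :: 'a ring" "hecke_algebra n :: ('a, _) module"
    using hh_module[of n n, where ?'k = 'a] by simp
  show ?thesis using assms
  proof (induction A)
    case (insert i A)
    have "finsum (hecke_algebra n) (\<lambda>i. HC n (f i)) (insert i A) =
        HC n (f i) \<oplus>\<^bsub>hecke_algebra n\<^esub> finsum (hecke_algebra n) (\<lambda>i. HC n (f i)) A"
      using insert by (intro M.M.finsum_insert) (auto simp: ha_carrier)
    then show ?case using insert by (simp add: ha_add free_sum)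
  qed (simp add: ha_zero)
qed

lemma coch_differential:
  assumes F: "lfin n F"
  shows "differential hecke_cat n (coch n F) = coch (Suc n) (bar_d eps1 F)"
proof (rule coch_eqI)
  show "differential hecke_cat n (coch n F) \<in> extensional (lens (Suc n))"
    by (simp add: differential_def ob_lists_hecke)
  fix Xs :: "nat list" assume Xs: "length Xs = Suc n"
  let ?N = "sum_list Xs"
  have c: "coface hecke_cat n i (coch n F) Xs = HC ?N (sec (mp (face n i F) Xs))"
    "sec (mp (face n i F) Xs) \<in> HF ?N" "lfin (length Xs) (face n i F)" if "i \<le> Suc n" for i
    using coface_coch[OF F Xs that] Xs by simp_all
  have "mp (bar_d eps1 F) Xs = (\<Sum>i\<le>Suc n. cst ((- 1) ^ i) * mp (face n i F) Xs)"
  proof (rule poly_mapping_eqI)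
    fix M
    have "lfin (length Xs) (bar_d eps1 F)" using lfin_bar_d[OF F] Xs by simp
    then show "Poly_Mapping.lookup (mp (bar_d eps1 F) Xs) M =
      Poly_Mapping.lookup (\<Sum>i\<le>Suc n. cst ((- 1) ^ i) * mp (face n i F) Xs) M"
      using c(3) Xs by (simp add: lookup_mp lookup_sum lookup_cst_mult bar_d_face del: sum.atMost_Suc)
  qed
  then have sec: "sec (mp (bar_d eps1 F) Xs) = (\<Sum>i\<le>Suc n. scal ((- 1) ^ i) * sec (mp (face n i F) Xs))"
    by (simp only: sec_sum sec_cst_mult)
  have "differential hecke_cat n (coch n F) Xs =
      (\<Oplus>\<^bsub>hecke_algebra ?N\<^esub>i\<in>{..Suc n}. (- 1) ^ i \<odot>\<^bsub>hecke_algebra ?N\<^esub> coface hecke_cat n i (coch n F) Xs)"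
    using Xs by (simp add: differential_def ob_lists_hecke)
  also have "\<dots> = (\<Oplus>\<^bsub>hecke_algebra ?N\<^esub>i\<in>{..Suc n}. HC ?N (scal ((- 1) ^ i) * sec (mp (face n i F) Xs)))"
  proof -
    interpret M: Module.module "ring_of_type_algebra :: 'a ring" "hecke_algebra ?N :: ('a, _) module"
      using hh_module[of ?N ?N, where ?'k = 'a] by simp
    show ?thesis
      by (rule M.M.finsum_cong') (auto simp: c(1,2) ha_smult ha_carrier intro!: free_mult)
  qed
  also have "\<dots> = HC ?N (\<Sum>i\<le>Suc n. scal ((- 1) ^ i) * sec (mp (face n i F) Xs))"
    by (rule finsum_HC) (auto intro!: free_mult c(2))
  finally show "differential hecke_cat n (coch n F) Xs = HC ?N (sec (mp (bar_d eps1 F) Xs))"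
    by (simp only: sec)
qed

lemma coch_one: "(\<lambda>Xs\<in>lens 0. Ident hecke_cat (Unit hecke_cat)) = coch 0 (\<lambda>_. 1)"
proof (rule coch_eqI)
  fix Xs :: "nat list" assume "length Xs = 0"
  moreover have "mp (\<lambda>_. 1) [] = (1 :: 'a ypoly)"
    by (rule poly_mapping_eqI) (auto simp: lookup_mp lfin_def lookup_one when_def)
  moreover have "sec (1 :: 'a ypoly) = 1" unfolding cst_1[symmetric] sec_cst by simp
  ultimately show "(\<lambda>Xs\<in>lens 0. Ident hecke_cat (Unit hecke_cat)) Xs = HC (sum_list Xs) (sec (mp (\<lambda>_. 1 :: 'a) Xs))"
    by (simp add: ob_lists_hecke)
qed simp

section \<open>The cohomology of the degenerate affine Hecke category\<close>

text \<open>For n = 0 the number n - 1 is 0 again, but every differential vanishes at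
  \<open>[]\<close>; so exactness means value 0 there, in accordance with
  \<open>coboundaries\<close>.\<close>

definition exactc :: "nat \<Rightarrow> (nat multiset list \<Rightarrow> 'k::field) \<Rightarrow> bool" where
  "exactc n F \<longleftrightarrow> (\<exists>G. lfin (n - 1) G \<and> (\<forall>L. length L = n \<longrightarrow> F L = bar_d eps1 G L))"

lemma exactcI: "lfin (n - 1) G \<Longrightarrow> (\<And>L. length L = n \<Longrightarrow> F L = bar_d eps1 G L) \<Longrightarrow> exactc n F"
  unfolding exactc_def by blast

lemma exactc_cong: "(\<And>L. length L = n \<Longrightarrow> F L = F' L) \<Longrightarrow> exactc n F \<longleftrightarrow> exactc n F'"
  unfolding exactc_def by simp

lemma exactc_add: "exactc n F \<Longrightarrow> exactc n F' \<Longrightarrow> exactc n (\<lambda>L. F L + F' L)"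
  unfolding exactc_def by (elim exE) (rule_tac x = "\<lambda>K. G K + Ga K" in exI, simp add: lfin_add bar_d_add)

lemma exactc_scale: "exactc n F \<Longrightarrow> exactc n (\<lambda>L. c * F L)"
  unfolding exactc_def by (elim exE) (rule_tac x = "\<lambda>K. c * G K" in exI, simp add: lfin_scale bar_d_scale)

lemma exactc_zero: "exactc n (\<lambda>L. 0)"
  by (rule exactcI[of _ "\<lambda>_. 0"]) (simp_all add: lfin_zero bar_d_zero)

lemma lfin_diff: "lfin n F \<Longrightarrow> lfin n G \<Longrightarrow> lfin n (\<lambda>L. F L - G L :: 'k::comm_ring_1)"
  using lfin_add[of n F "\<lambda>L. - 1 * G L"] lfin_scale[of n G "- 1"] by simp

lemma coboundaries_hecke: "coboundaries hecke_cat n = coch n ` {F. lfin n F \<and> exactc n F}"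
proof (cases n)
  case 0
  have "coch 0 F = coch 0 (\<lambda>_. 0)" if "lfin 0 F" "exactc 0 F" for F :: "nat multiset list \<Rightarrow> 'a"
    using that by (auto simp: coch_eq_iff lfin_zero exactc_def)
  moreover have "coch 0 (\<lambda>_. 0 :: 'a) \<in> coch 0 ` {F. lfin 0 F \<and> exactc 0 F}"
    using lfin_zero exactc_zero by blast
  ultimately show ?thesis by (auto simp: coboundaries_def 0 coch_zero)
next
  case (Suc m)
  have "differential hecke_cat m ` cochains hecke_cat m = coch n ` {F :: nat multiset list \<Rightarrow> 'a. lfin n F \<and> exactc n F}"
  proof (intro equalityI subsetI)
    fix x :: "nat list \<Rightarrow> (hecke_gen, 'a) free_alg set"
    assume "x \<in> differential hecke_cat m ` cochains hecke_cat m"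
    then obtain a where a: "a \<in> cochains hecke_cat m" "x = differential hecke_cat m a" by blast
    obtain G where G: "lfin m G" "a = coch m G" using coch_surj[OF a(1)] by blast
    then have "x = coch n (bar_d eps1 G)" using a(2) coch_differential[OF G(1)] Suc by simp
    note G = G(1) this
    then show "x \<in> coch n ` {F. lfin n F \<and> exactc n F}"
      using lfin_bar_d[OF G(1)] Suc exactcI[of n G "bar_d eps1 G"] by auto
  next
    fix x :: "nat list \<Rightarrow> (hecke_gen, 'a) free_alg set"
    assume "x \<in> coch n ` {F. lfin n F \<and> exactc n F}"
    then obtain F where F: "x = coch n F" "lfin n F" "exactc n F" by auto
    then obtain G where G: "lfin m G" "\<And>L. length L = n \<Longrightarrow> F L = bar_d eps1 G L" using Suc by (auto simp: exactc_def)
    have "x = coch n (bar_d eps1 G)" using F G lfin_bar_d[OF G(1)] Suc by (simp add: coch_eq_iff)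
    also have "\<dots> = differential hecke_cat m (coch m G)" using coch_differential[OF G(1)] Suc by simp
    finally show "x \<in> differential hecke_cat m ` cochains hecke_cat m" using coch_closed[OF G(1)] by blast
  qed
  then show ?thesis by (simp add: coboundaries_def Suc)
qed

lemma coch_cocycle:
  assumes F: "lfin n F"
  shows "coch n F \<in> cocycles hecke_cat n \<longleftrightarrow> (\<forall>L. length L = Suc n \<longrightarrow> bar_d eps1 F L = 0)"
  using coch_closed[OF F] lfin_bar_d[OF F]
  by (simp add: cocycles_def coch_differential[OF F] coch_zero coch_eq_iff lfin_zero)

section \<open>Cohomology classes of coefficient functions\<close>

definition cl :: "nat \<Rightarrow> (nat multiset list \<Rightarrow> 'k::field) \<Rightarrow> (nat list \<Rightarrow> (hecke_gen, 'k) free_alg set) set" where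
  "cl n F = cohom_class hecke_cat n (coch n F)"

lemma cl_eq:
  assumes F: "lfin n F"
  shows "cl n F = coch n ` {F'. lfin n F' \<and> exactc n (\<lambda>L. F' L - F L)}"
proof -
  have "cl n F = (\<lambda>H. coch n H \<oplus>\<^bsub>cochain_space hecke_cat n\<^esub> coch n F) ` {H. lfin n H \<and> exactc n H}"
    by (auto simp: cl_def cohom_class_def a_r_coset_def' coboundaries_hecke)
  also have "\<dots> = (\<lambda>H. coch n (\<lambda>L. H L + F L)) ` {H. lfin n H \<and> exactc n H}"
    by (intro image_cong) (auto simp: coch_add F)
  also have "\<dots> = coch n ` {F'. lfin n F' \<and> exactc n (\<lambda>L. F' L - F L)}"
  proof (intro equalityI subsetI)
    fix x assume "x \<in> (\<lambda>H. coch n (\<lambda>L. H L + F L)) ` {H. lfin n H \<and> exactc n H}"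
    then obtain H where "x = coch n (\<lambda>L. H L + F L)" "lfin n H" "exactc n H" by auto
    then show "x \<in> coch n ` {F'. lfin n F' \<and> exactc n (\<lambda>L. F' L - F L)}"
      using lfin_add[OF _ F] by (intro image_eqI[of _ _ "\<lambda>L. H L + F L"]) auto
  next
    fix x assume "x \<in> coch n ` {F'. lfin n F' \<and> exactc n (\<lambda>L. F' L - F L)}"
    then obtain F' where "x = coch n F'" "lfin n F'" "exactc n (\<lambda>L. F' L - F L)" by auto
    then show "x \<in> (\<lambda>H. coch n (\<lambda>L. H L + F L)) ` {H. lfin n H \<and> exactc n H}"
      using lfin_diff[OF _ F] by (intro image_eqI[of _ _ "\<lambda>L. F' L - F L"]) auto
  qed
  finally show ?thesis .
qed

lemma cl_eq_iff:
  assumes F: "lfin n F" and G: "lfin n G"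
  shows "cl n F = cl n G \<longleftrightarrow> exactc n (\<lambda>L. F L - G L)"
proof
  assume "cl n F = cl n G"
  moreover have "coch n F \<in> cl n F" unfolding cl_eq[OF F] by (intro image_eqI[of _ _ F]) (simp_all add: F exactc_zero)
  ultimately have "coch n F \<in> cl n G" by simp
  then obtain F' where F': "coch n F = coch n F'" "lfin n F'" "exactc n (\<lambda>L. F' L - G L)"
    unfolding cl_eq[OF G] by auto
  then have "\<forall>L. length L = n \<longrightarrow> F L = F' L" using coch_eq_iff[OF F] by blast
  then have "exactc n (\<lambda>L. F L - G L) \<longleftrightarrow> exactc n (\<lambda>L. F' L - G L)" by (intro exactc_cong) simp
  then show "exactc n (\<lambda>L. F L - G L)" using F'(3) by simp
next
  assume e: "exactc n (\<lambda>L. F L - G L)"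
  have "exactc n (\<lambda>L. H L - F L) \<longleftrightarrow> exactc n (\<lambda>L. H L - G L)" for H
    using exactc_add[OF _ e, of "\<lambda>L. H L - F L"] exactc_add[OF _ exactc_scale[OF e, of "- 1"], of "\<lambda>L. H L - G L"]
    by (auto simp: algebra_simps)
  then show "cl n F = cl n G" by (simp add: cl_eq F G)
qed

lemma cl_add:
  assumes F: "lfin n F" and G: "lfin n G"
  shows "set_add (cochain_space hecke_cat n) (cl n F) (cl n G) = cl n (\<lambda>L. F L + G L)"
proof -
  have "set_add (cochain_space hecke_cat n) (cl n F) (cl n G) =
    {coch n F' \<oplus>\<^bsub>cochain_space hecke_cat n\<^esub> coch n G' | F' G'. lfin n F' \<and> exactc n (\<lambda>L. F' L - F L) \<and>
      lfin n G' \<and> exactc n (\<lambda>L. G' L - G L)}"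
    unfolding set_add_def' cl_eq[OF F] cl_eq[OF G] by blast
  also have "\<dots> = cl n (\<lambda>L. F L + G L)"
    unfolding cl_eq[OF lfin_add[OF F G]]
  proof (intro equalityI subsetI)
    fix x assume "x \<in> {coch n F' \<oplus>\<^bsub>cochain_space hecke_cat n\<^esub> coch n G' | F' G'. lfin n F' \<and> exactc n (\<lambda>L. F' L - F L) \<and>
      lfin n G' \<and> exactc n (\<lambda>L. G' L - G L)}"
    then obtain F' G' where x: "x = coch n (\<lambda>L. F' L + G' L)"
      and *: "lfin n F'" "exactc n (\<lambda>L. F' L - F L)" "lfin n G'" "exactc n (\<lambda>L. G' L - G L)"
      by (auto simp: coch_add)
    show "x \<in> coch n ` {F'. lfin n F' \<and> exactc n (\<lambda>L. F' L - (F L + G L))}"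
      using x exactc_add[OF *(2,4)] lfin_add[OF *(1,3)]
      by (intro image_eqI[of _ _ "\<lambda>L. F' L + G' L"]) (auto simp: algebra_simps)
  next
    fix x assume "x \<in> coch n ` {F'. lfin n F' \<and> exactc n (\<lambda>L. F' L - (F L + G L))}"
    then obtain H where H: "x = coch n H" "lfin n H" "exactc n (\<lambda>L. H L - (F L + G L))" by auto
    have 1: "lfin n (\<lambda>L. H L - G L)" by (rule lfin_diff[OF H(2) G])
    have "x = coch n (\<lambda>L. H L - G L) \<oplus>\<^bsub>cochain_space hecke_cat n\<^esub> coch n G"
      using coch_add[OF 1 G] H(1) by simp
    then show "x \<in> {coch n F' \<oplus>\<^bsub>cochain_space hecke_cat n\<^esub> coch n G' | F' G'. lfin n F' \<and> exactc n (\<lambda>L. F' L - F L) \<and>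
      lfin n G' \<and> exactc n (\<lambda>L. G' L - G L)}"
      using 1 H(3) G exactc_zero[of n, where ?'a = 'a]
      by (intro CollectI exI[of _ "\<lambda>L. H L - G L"] exI[of _ G]) (simp add: algebra_simps)
  qed
  finally show ?thesis .
qed

text \<open>Operations on classes are unions over representatives; if all representatives give the
  same result, the union is that result.\<close>

lemma union_cl:
  assumes "lfin n F" "\<And>F'. lfin n F' \<Longrightarrow> exactc n (\<lambda>L. F' L - F L) \<Longrightarrow> f (coch n F') = A"
  shows "(\<Union>a\<in>cl n F. f a) = A"
proof -
  have "coch n F \<in> cl n F" unfolding cl_eq[OF assms(1)] by (intro image_eqI[of _ _ F]) (simp_all add: assms(1) exactc_zero)
  moreover have "f a = A" if "a \<in> cl n F" for a using that assms unfolding cl_eq[OF assms(1)] by blast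
  ultimately show ?thesis by blast
qed

lemma cl_smult:
  assumes F: "lfin n F"
  shows "(\<Union>a\<in>cl n F. cohom_class hecke_cat n (c \<odot>\<^bsub>cochain_space hecke_cat n\<^esub> a)) = cl n (\<lambda>L. c * F L)"
proof (rule union_cl[OF F])
  fix F' assume F': "lfin n F'" "exactc n (\<lambda>L. F' L - F L)"
  have "cl n (\<lambda>L. c * F' L) = cl n (\<lambda>L. c * F L)"
    using exactc_scale[OF F'(2), of c] F F' by (simp add: cl_eq_iff lfin_scale right_diff_distrib)
  then show "cohom_class hecke_cat n (c \<odot>\<^bsub>cochain_space hecke_cat n\<^esub> coch n F') = cl n (\<lambda>L. c * F L)"
    by (simp add: coch_smult F' flip: cl_def)
qed

text \<open>If F' - F = dU and G' - G = dW, the difference of the products is dU G' + F dW. Both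
  summands are exact by the Leibniz rule, as G' and F are cocycles.\<close>

lemma exactc_cup:
  assumes F: "lfin m F" "\<And>L. length L = Suc m \<Longrightarrow> bar_d eps1 F L = 0" and F': "lfin m F'" "exactc m (\<lambda>L. F' L - F L)"
    and G: "lfin n G" "\<And>L. length L = Suc n \<Longrightarrow> bar_d eps1 G L = 0" and G': "lfin n G'" "exactc n (\<lambda>L. G' L - G L)"
  shows "exactc (m + n) (\<lambda>L. bar_cup m F' G' L - bar_cup m F G L)"
proof -
  have e: "eps1 (M + N) = (eps1 M * eps1 N :: 'a)" for M N by auto
  obtain U where U: "lfin (m - 1) U" "\<And>L. length L = m \<Longrightarrow> F' L - F L = bar_d eps1 U L"
    using F'(2) by (auto simp: exactc_def)
  obtain W where W: "lfin (n - 1) W" "\<And>L. length L = n \<Longrightarrow> G' L - G L = bar_d eps1 W L"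
    using G'(2) by (auto simp: exactc_def)
  have dG': "bar_d eps1 G' L = 0" if L: "length L = Suc n" for L
  proof -
    have "bar_d eps1 G' L = bar_d eps1 (\<lambda>K. G K + bar_d eps1 W K) L"
      by (rule bar_d_cong) (use W(2) L in \<open>simp flip: W(2)\<close>)
    then show ?thesis using G(2)[OF L] by (simp add: bar_d_add bar_d_bar_d[OF e])
  qed
  have 1: "exactc (m + n) (bar_cup m (bar_d eps1 U) G')"
  proof (cases m)
    case 0
    then show ?thesis using exactc_zero by (simp add: bar_cup_def[abs_def])
  next
    case (Suc k)
    show ?thesis
    proof (rule exactcI)
      show "lfin (m + n - 1) (bar_cup k U G')" using lfin_cup[OF U(1) G'(1)] Suc by simp
      fix L :: "nat multiset list" assume "length L = m + n"
      then show "bar_cup m (bar_d eps1 U) G' L = bar_d eps1 (bar_cup k U G') L"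
        using dG'[of "drop k L"] Suc by (simp add: bar_d_cup bar_cup_def)
    qed
  qed
  have 2: "exactc (m + n) (bar_cup m F (bar_d eps1 W))"
  proof (cases n)
    case 0
    have "bar_cup m F (bar_d eps1 W) L = 0" if "length L = m + n" for L
      using that 0 by (simp add: bar_cup_def)
    then show ?thesis using exactc_cong[of "m + n" "bar_cup m F (bar_d eps1 W)" "\<lambda>_. 0"] exactc_zero by blast
  next
    case (Suc k)
    show ?thesis
    proof (rule exactcI)
      show "lfin (m + n - 1) (\<lambda>L. (- 1) ^ m * bar_cup m F W L)"
        using lfin_scale[OF lfin_cup[OF F(1) W(1)]] Suc by simp
      fix L :: "nat multiset list" assume "length L = m + n"
      then show "bar_cup m F (bar_d eps1 W) L = bar_d eps1 (\<lambda>L. (- 1) ^ m * bar_cup m F W L) L"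
        using F(2)[of "take (Suc m) L"] Suc
        by (simp add: bar_d_scale bar_d_cup) (simp add: bar_cup_def algebra_simps flip: power_mult_distrib)
    qed
  qed
  have "bar_cup m F' G' L - bar_cup m F G L = bar_cup m (bar_d eps1 U) G' L + bar_cup m F (bar_d eps1 W) L"
    if "length L = m + n" for L
    using U(2)[of "take m L"] W(2)[of "drop m L"] that by (simp add: bar_cup_def algebra_simps flip: U(2) W(2))
  then have "exactc (m + n) (\<lambda>L. bar_cup m F' G' L - bar_cup m F G L) \<longleftrightarrow>
      exactc (m + n) (\<lambda>L. bar_cup m (bar_d eps1 U) G' L + bar_cup m F (bar_d eps1 W) L)"
    by (rule exactc_cong)
  then show ?thesis using exactc_add[OF 1 2] by simp
qed

lemma cl_cup:
  assumes F: "lfin m F" "\<And>L. length L = Suc m \<Longrightarrow> bar_d eps1 F L = 0"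
    and G: "lfin n G" "\<And>L. length L = Suc n \<Longrightarrow> bar_d eps1 G L = 0"
  shows "(\<Union>a\<in>cl m F. \<Union>b\<in>cl n G. cohom_class hecke_cat (m + n) (cup hecke_cat m n a b)) = cl (m + n) (bar_cup m F G)"
proof (intro union_cl F(1) G(1))
  fix F' G' assume F': "lfin m F'" "exactc m (\<lambda>L. F' L - F L)" and G': "lfin n G'" "exactc n (\<lambda>L. G' L - G L)"
  have "cl (m + n) (bar_cup m F' G') = cl (m + n) (bar_cup m F G)"
    using exactc_cup[OF F F' G G'] F(1) G(1) F'(1) G'(1) by (simp add: cl_eq_iff lfin_cup)
  then show "cohom_class hecke_cat (m + n) (cup hecke_cat m n (coch m F') (coch n G')) = cl (m + n) (bar_cup m F G)"
    by (simp add: coch_cup F' G' flip: cl_def)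
qed

section \<open>The comparison with the exterior algebra\<close>

text \<open>\<open>theta\<close> has values in the complex with augmentation \<open>eps0\<close>;
  the substitution with c = 1, inverse to that with c = -1, carries them to the complex with
  augmentation \<open>eps1\<close>.\<close>

definition psi :: "('k::field poly, 'k) free_alg \<Rightarrow> nat multiset list \<Rightarrow> 'k" where
  "psi p = mext 1 (theta p)"

lemma mext_inverse: "mext (- 1) (mext 1 F) L = F L"
  using mext_mext[of "- 1" F L] by simp

lemma mext_bar0: "mext 1 (bar0 G) L = bar_d eps1 (mext 1 G) L"
proof -
  have "bar0 G = mext (- 1) (bar_d eps1 (mext 1 G))"
    using mext_bar_d[of "mext 1 G"] by (simp add: fun_eq_iff mext_inverse[abs_def])
  then show ?thesis using mext_mext[of 1] by simp
qed

lemma mext_zero: "mext c (\<lambda>_. 0) L = 0"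
  using mext_scale[of c 0 "\<lambda>_. 0" L] by simp

lemma lfin_psi: "lfin n (psi p)"
  unfolding psi_def by (rule lfin_mext[OF lfin_theta])

lemma psi_cocycle: "bar_d eps1 (psi p) L = 0"
  unfolding psi_def mext_bar0[symmetric] bar0_theta[abs_def] mext_zero ..

lemma psi_add: "psi (p + q) L = psi p L + psi q L"
  by (simp add: psi_def theta_add[abs_def] mext_add)

lemma psi_diff: "psi (p - q) L = psi p L - psi q L"
  by (simp add: psi_def theta_diff[abs_def] mext_diff)

lemma psi_scal: "psi (scal c * p) L = c * psi p L"
  by (simp add: psi_def theta_scal[abs_def] mext_scale)

lemma psi_mult: "homog m p \<Longrightarrow> length L = m + n \<Longrightarrow> psi (p * q) L = bar_cup m (psi p) (psi q) L"
  unfolding psi_def using theta_mult[of m p _ n q] mext_cup[of m L 1 "theta p" "theta q"]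
    mext_cong[of L "theta (p * q)" "bar_cup m (theta p) (theta q)" 1] by simp

text \<open>Substituting back reduces exactness to \<open>exact_theta_ext_ideal\<close>. Conversely,
  the primitive from \<open>theta_ext_ideal\<close> need not be locally finite;
  \<open>exact_lfin\<close> replaces it by one that is.\<close>

lemma exactc_psi:
  assumes p: "homog n p"
  shows "exactc n (psi p) \<longleftrightarrow> p \<in> ext_ideal"
proof
  assume "exactc n (psi p)"
  then obtain G where G: "\<And>L. length L = n \<Longrightarrow> psi p L = bar_d eps1 G L" by (auto simp: exactc_def)
  show "p \<in> ext_ideal"
  proof (rule exact_theta_ext_ideal[OF p])
    fix L :: "nat multiset list" assume L: "length L = n"
    have "theta p L = mext (- 1) (psi p) L" by (simp add: psi_def mext_inverse)
    also have "\<dots> = mext (- 1) (bar_d eps1 G) L" by (rule mext_cong) (simp add: G L)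
    also have "\<dots> = bar0 (mext (- 1) G) L" by (simp add: mext_bar_d)
    finally show "theta p L = bar0 (mext (- 1) G) L" .
  qed
next
  assume "p \<in> ext_ideal"
  then obtain G where "\<And>L. length L = n \<Longrightarrow> theta p L = bar0 G L" using theta_ext_ideal by blast
  then obtain G' where G': "lfin (n - 1) G'" "\<And>L. length L = n \<Longrightarrow> theta p L = bar0 G' L"
    using exact_lfin[OF lfin_theta, of n p G] by blast
  show "exactc n (psi p)"
  proof (rule exactcI[OF lfin_mext[OF G'(1), of 1]])
    fix L :: "nat multiset list" assume L: "length L = n"
    have "psi p L = mext 1 (bar0 G') L" unfolding psi_def by (rule mext_cong) (simp add: G'(2) L)
    then show "psi p L = bar_d eps1 (mext 1 G') L" by (simp add: mext_bar0)
  qed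
qed

lemma psi_surj:
  assumes F: "lfin n F" "\<And>L. length L = Suc n \<Longrightarrow> bar_d eps1 F L = 0"
  shows "\<exists>p. homog n p \<and> exactc n (\<lambda>L. F L - psi p L)"
proof -
  have "bar0 (mext (- 1) F) L = 0" if L: "length L = Suc n" for L
  proof -
    have "mext (- 1) (bar_d eps1 F) L = mext (- 1) (\<lambda>_. 0) L" by (rule mext_cong) (simp add: F(2) L)
    then show ?thesis by (simp add: mext_bar_d mext_zero)
  qed
  from cocycle_theta[OF lfin_mext[OF F(1)] this] obtain p G where p: "homog n p" and G: "lfin (n - 1) G"
    and eq: "\<And>L. length L = n \<Longrightarrow> mext (- 1) F L = theta p L + bar0 G L" by blast
  have "exactc n (\<lambda>L. F L - psi p L)"
  proof (rule exactcI[OF lfin_mext[OF G, of 1]])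
    fix L :: "nat multiset list" assume L: "length L = n"
    have "F L = mext 1 (mext (- 1) F) L" by (simp add: mext_mext)
    also have "\<dots> = mext 1 (\<lambda>K. theta p K + bar0 G K) L" by (rule mext_cong) (simp add: eq L)
    also have "\<dots> = psi p L + bar_d eps1 (mext 1 G) L" by (simp add: mext_add psi_def mext_bar0)
    finally show "F L - psi p L = bar_d eps1 (mext 1 G) L" by simp
  qed
  then show ?thesis using p by blast
qed

definition kl :: "nat \<Rightarrow> ('k::field poly, 'k) free_alg \<Rightarrow> (nat list \<Rightarrow> (hecke_gen, 'k) free_alg set) set" where
  "kl n p = cl n (psi p)"

abbreviation ext_cls :: "('k::field poly, 'k) free_alg \<Rightarrow> ('k poly, 'k) free_alg set" where
  "ext_cls \<equiv> cls UNIV ext_rels"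

lemma homog_add: "homog n p \<Longrightarrow> homog n q \<Longrightarrow> homog n (p + q)"
  using Poly_Mapping.keys_add[of p q] unfolding homog_def by blast

lemma homog_diff: "homog n p \<Longrightarrow> homog n q \<Longrightarrow> homog n (p - q :: ('g, 'k::field) free_alg)"
  using Poly_Mapping.keys_diff[of p q] unfolding homog_def by blast

lemma homog_mult: "homog m p \<Longrightarrow> homog n q \<Longrightarrow> homog (m + n) (p * q :: ('g, 'k::field) free_alg)"
  using Poly_Mapping.keys_mult[of p q] unfolding homog_def by fastforce

lemma homog_scal: "homog n p \<Longrightarrow> homog n (scal c * p :: ('g, 'k::field) free_alg)"
  using homog_mult[of 0 "scal c" n p] by (simp add: homog_def scal_def)

lemma homog_one: "homog 0 (1 :: ('g, 'k::field) free_alg)"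
  by (simp add: homog_def)

lemma kl_eq_iff: "homog n p \<Longrightarrow> homog n q \<Longrightarrow> kl n p = kl n q \<longleftrightarrow> ext_cls p = ext_cls q"
  unfolding kl_def cl_eq_iff[OF lfin_psi lfin_psi] cls_eq_iff[OF ext_rels_carrier free_UNIV free_UNIV]
  using exactc_psi[OF homog_diff, of n p q] by (simp add: psi_diff[abs_def])

lemma carrier_cohomology: "carrier (cohomology_space hecke_cat n) = kl n ` {p. homog n p}"
proof (intro equalityI subsetI)
  fix A assume "A \<in> carrier (cohomology_space (hecke_cat :: ('a, nat, _) tensor_category) n)"
  then obtain a where a: "a \<in> cocycles hecke_cat n" "A = cohom_class hecke_cat n a" by (auto simp: cohomology_space_def)
  then have "a \<in> cochains hecke_cat n" by (simp add: cocycles_def)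
  then obtain F where F: "lfin n F" "a = coch n F" using coch_surj by blast
  then have "\<And>L. length L = Suc n \<Longrightarrow> bar_d eps1 F L = 0" using a(1) coch_cocycle by blast
  from psi_surj[OF F(1) this] obtain p where "homog n p" "exactc n (\<lambda>L. F L - psi p L)" by blast
  then show "A \<in> kl n ` {p. homog n p}" using a(2) F by (auto simp: kl_def cl_eq_iff lfin_psi simp flip: cl_def)
next
  fix A :: "(nat list \<Rightarrow> (hecke_gen, 'a) free_alg set) set" assume "A \<in> kl n ` {p. homog n p}"
  then show "A \<in> carrier (cohomology_space hecke_cat n)"
    using psi_cocycle by (force simp: cohomology_space_def kl_def cl_def coch_cocycle[OF lfin_psi])
qed

lemma cohomology_add:
  "kl n p \<oplus>\<^bsub>cohomology_space hecke_cat n\<^esub> kl n q = kl n (p + q)"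
  using cl_add[OF lfin_psi lfin_psi, of n p q] by (simp add: cohomology_space_def kl_def psi_add[abs_def])

lemma cohomology_smult:
  "c \<odot>\<^bsub>cohomology_space hecke_cat n\<^esub> kl n p = kl n (scal c * p)"
  using cl_smult[OF lfin_psi[of n p], of c] by (simp add: cohomology_space_def kl_def psi_scal[abs_def])

lemma cohomology_mult:
  assumes "homog m p"
  shows "Gmult (deformation_cohomology hecke_cat) m n (kl m p) (kl n q) = kl (m + n) (p * q)"
proof -
  have "cl (m + n) (bar_cup m (psi p) (psi q)) = cl (m + n) (psi (p * q))"
    unfolding cl_def using psi_mult[OF assms, of _ n q] lfin_psi
    by (intro arg_cong[of _ _ "cohom_class hecke_cat (m + n)"], subst coch_eq_iff) (auto simp: lfin_cup)
  then show ?thesis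
    using cl_cup[OF lfin_psi[of m p] psi_cocycle lfin_psi[of n q] psi_cocycle]
    by (simp add: deformation_cohomology_def kl_def)
qed

lemma cohomology_one: "Gone (deformation_cohomology hecke_cat) = kl 0 1"
proof -
  have "coch 0 (\<lambda>_. 1 :: 'a) = coch 0 (psi 1)"
    using lfin_psi by (subst coch_eq_iff) (auto simp: psi_def theta_1 lfin_def)
  then show ?thesis
    using coch_one[where ?'a = 'a] by (simp add: deformation_cohomology_def kl_def cl_def ob_lists_hecke)
qed

lemma exterior_piece:
  fixes p q :: "('k::field poly, 'k) free_alg"
  defines "E \<equiv> exterior_algebra (polynomial_space :: ('k, 'k poly) module)"
  shows "carrier (Piece E n) = ext_cls ` {p. homog n p}"
    and "ext_cls p \<oplus>\<^bsub>Piece E n\<^esub> ext_cls q = ext_cls (p + q)"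
    and "c \<odot>\<^bsub>Piece E n\<^esub> ext_cls p = ext_cls (scal c * p)"
    and "Gmult E m n (ext_cls p) (ext_cls q) = ext_cls (p * q)"
    and "Gone E = ext_cls 1"
  by (auto simp: E_def exterior_algebra_def Let_def exterior_power_def homog_def
      pa_add[OF ext_rels_carrier] pa_smult[OF ext_rels_carrier] pa_mult[OF ext_rels_carrier] pa_one[OF ext_rels_carrier])

theorem theorem4p18:
  shows "\<exists>\<phi>. graded_algebra_iso
    (deformation_cohomology (hecke_category :: ('k::field, nat, (hecke_gen, 'k) free_alg set) tensor_category))
    (exterior_algebra (polynomial_space :: ('k, 'k poly) module)) \<phi>"
proof -
  \<comment> \<open>By \<open>carrier_cohomology\<close> every class is \<open>kl n p\<close> for
    some homogeneous p; by \<open>kl_eq_iff\<close> the choice of p does not affect its class in the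
    exterior algebra.\<close>
  define \<phi> where "\<phi> n A = ext_cls (SOME p :: ('k poly, 'k) free_alg. homog n p \<and> A = kl n p)" for n A
  have \<phi>: "\<phi> n (kl n p) = ext_cls p" if p: "homog n p" for n and p :: "('k poly, 'k) free_alg"
  proof -
    define q where "q = (SOME q. homog n q \<and> kl n p = kl n q)"
    have "homog n q \<and> kl n p = kl n q" unfolding q_def by (rule someI[of _ p]) (use p in simp)
    then have "ext_cls q = ext_cls p" using kl_eq_iff[OF p, of q] by simp
    then show ?thesis unfolding \<phi>_def q_def .
  qed
  have piece: "Piece (deformation_cohomology (hecke_cat :: ('k, nat, _) tensor_category)) = cohomology_space hecke_cat"
    by (simp add: deformation_cohomology_def)
  let ?E = "exterior_algebra (polynomial_space :: ('k, 'k poly) module)"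
  have "linear_iso (cohomology_space hecke_cat n) (Piece ?E n) (\<phi> n)" for n
    unfolding linear_iso_def
  proof (intro conjI ballI allI)
    show "bij_betw (\<phi> n) (carrier (cohomology_space hecke_cat n)) (carrier (Piece ?E n))"
      unfolding carrier_cohomology exterior_piece
    proof (rule bij_betw_imageI)
      show "inj_on (\<phi> n) (kl n ` {p. homog n p})"
      proof (rule inj_onI)
        fix A B assume "A \<in> kl n ` {p :: ('k poly, 'k) free_alg. homog n p}" "B \<in> kl n ` {p :: ('k poly, 'k) free_alg. homog n p}" "\<phi> n A = \<phi> n B"
        then obtain p q :: "('k poly, 'k) free_alg" where "A = kl n p" "B = kl n q" "homog n p" "homog n q" "ext_cls p = ext_cls q"
          using \<phi> by auto
        then show "A = B" using kl_eq_iff by metis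
      qed
      show "\<phi> n ` kl n ` {p. homog n p} = ext_cls ` {p. homog n p}"
        unfolding image_image by (intro image_cong) (auto simp: \<phi>)
    qed
  next
    fix x y :: "(nat list \<Rightarrow> (hecke_gen, 'k) free_alg set) set"
    assume "x \<in> carrier (cohomology_space hecke_cat n)" "y \<in> carrier (cohomology_space hecke_cat n)"
    then show "\<phi> n (x \<oplus>\<^bsub>cohomology_space hecke_cat n\<^esub> y) = \<phi> n x \<oplus>\<^bsub>Piece ?E n\<^esub> \<phi> n y"
      by (auto simp: carrier_cohomology cohomology_add \<phi> homog_add exterior_piece)
  next
    fix c :: 'k and x :: "(nat list \<Rightarrow> (hecke_gen, 'k) free_alg set) set"
    assume "x \<in> carrier (cohomology_space hecke_cat n)"
    then show "\<phi> n (c \<odot>\<^bsub>cohomology_space hecke_cat n\<^esub> x) = c \<odot>\<^bsub>Piece ?E n\<^esub> \<phi> n x"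
      by (auto simp: carrier_cohomology cohomology_smult \<phi> homog_scal exterior_piece)
  qed
  moreover have "\<phi> (m + n) (Gmult (deformation_cohomology hecke_cat) m n x y) = Gmult ?E m n (\<phi> m x) (\<phi> n y)"
    if "x \<in> carrier (cohomology_space hecke_cat m)" "y \<in> carrier (cohomology_space hecke_cat n)" for m n x y
    using that by (auto simp: carrier_cohomology cohomology_mult \<phi> homog_mult exterior_piece)
  moreover have "\<phi> 0 (Gone (deformation_cohomology hecke_cat)) = Gone ?E"
    by (simp add: cohomology_one \<phi> homog_one exterior_piece)
  ultimately have "graded_algebra_iso (deformation_cohomology hecke_cat) ?E \<phi>"
    by (simp add: graded_algebra_iso_def piece)
  then show ?thesis by blast
qed

end
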